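(* Let $d=1$, $\mathcal S=[0,1]$, $\nu=1/2$, and suppose $Y=X$ (no regression terms) is observed on the grid $s_i=i/n$, $i=1,\ldots,n$. Assume: (1) $\pi(\theta|\alpha)$ is a proper density in $\theta\in(0,\infty)$, continuously differentiable in $\theta$, continuous in $\alpha$, finite for all $\theta,\alpha\in(0,\infty)$, not depending on $n$, with $\pi(\theta_0|\alpha)>0$ for all $\alpha>0$. (2) There exist positive constants $C_{\pi,1},C_{\pi,2},C_{\pi,3}$ (which may depend on $\alpha_0,\theta_0$) with $C_{\pi,1}+C_{\pi,2}<1/2$ and $C_{\pi,3}<1$ such that for all sufficiently large $n$, $$\sup_{\alpha\in[\underline\alpha_n,\overline\alpha_n]}\ \sup_{\theta\in(\theta_0/2,2\theta_0)}\Big|\frac{\partial\log\pi(\theta|\alpha)}{\partial\theta}\Big|\le n^{C_{\pi,1}},\quad \sup_{\alpha\in[\underline\alpha_n,\overline\alpha_n]}\ \sup_{\theta\in(\theta_0/2,2\theta_0)}\frac{\pi(\theta|\alpha)}{\pi(\theta_0|\alpha)}\le n^{C_{\pi,2}},\quad \inf_{\alpha\in[\underline\alpha_n,\overline\alpha_n]}\log\pi(\theta_0|\alpha)\ge -n^{C_{\pi,3}}.$$ (3) $\pi(\alpha)$ is a proper continuous density on $(0,\infty)$ not depending on $n$, $\pi(\alpha_0)>0$, the integrals $\int_0^\infty\pi(\theta_0|\alpha)\pi(\alpha)d\alpha$, $\int_0^\infty\sqrt\alpha\,\pi(\theta_0|\alpha)\pi(\alpha)d\alpha$ and $\int_0^\infty\sqrt\alpha\,\pi(\alpha)d\alpha$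 are finite, and as $n\to\infty$, $\sqrt n\int_0^{\underline\alpha_n}\sqrt\alpha\,\pi(\alpha)d\alpha\to0$ and $\sqrt n\int_{\overline\alpha_n}^\infty\sqrt\alpha\,\pi(\alpha)d\alpha\to0$. Then, as $n\to\infty$ in $P_{(\sigma_0^2,\alpha_0)}$-probability, $$\Big\|\Pi(d\theta,d\alpha|Y_n)-\mathcal N\big(d\theta\,\big|\,\widetilde\theta_{\alpha_0},2\theta_0^2/n\big)\times\widetilde\Pi(d\alpha|Y_n)\Big\|_{TV}\to0,$$ $$\Big\|\Pi(d\theta,d\alpha|Y_n)-\mathcal N\big(d\theta\,\big|\,\widetilde\theta_{\alpha_0},2\theta_0^2/n\big)\times\Pi_*(d\alpha|Y_n)\Big\|_{TV}\to0,$$ where $\widetilde\theta_{\alpha_0}=n^{-1}\alpha_0^{2\nu}Y_n^\top R_{\alpha_0}^{-1}Y_n$, $\widetilde\Pi(d\alpha|Y_n)$ has density $\widetilde\pi(\alpha|Y_n)\propto\exp\{\widetilde{\mathcal L}_n(\alpha)\}\pi(\alpha|\theta_0)$ with $$\widetilde{\mathcal L}_n(\alpha)=-\tfrac n2\log\big(A_1e^{-2\alpha/n}-2A_2e^{-\alpha/n}+A_3\big)+\tfrac12\log(1-e^{-2\alpha/n}),$$ and $\Pi_*(d\alpha|Y_n)$ has density $$\pi_*(\alpha|Y_n)\propto\sqrt\alpha\,\exp\Big\{-\frac{(\alpha-u_* )^2}{2v_*}\Big\}\,\pi(\alpha|\theta_0),\quad \alpha>0,\qquad u_*=\frac{n(A_1-A_2)}{A_1},\quad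 v_*=\frac{n(A_1-2A_2+A_3)}{A_1}.$$ Furthermore, in $P_{(\sigma_0^2,\alpha_0)}$-probability as $n\to\infty$, $|u_*|$ is bounded above, $v_*>0$, and $v_*$ is bounded above and bounded away from zero (that is, $u_*$, $v_*$ and $1/v_*$ are $O_p(1)$). Therefore, $\Pi(d\alpha|Y_n)$ does not converge to any point mass distribution as $n\to\infty$ in $P_{(\sigma_0^2,\alpha_0)}$-probability.
   Context: $X$ is a mean-zero Gaussian process on $[0,1]$ with covariance $\sigma_0^2\exp(-\alpha_0|s-t|)$ (Ornstein–Uhlenbeck process, i.e. Matérn with $\nu=1/2$); $\sigma_0^2,\alpha_0>0$ are the fixed true values, $\theta_0=\sigma_0^2\alpha_0$, and $P_{(\sigma_0^2,\alpha_0)}$ is the law of $X$. $Y_n=(Y(s_1),\ldots,Y(s_n))^\top$, $R_\alpha$ is the $n\times n$ matrix with entries $\exp(-\alpha|s_i-s_j|)$, and $$A_1=\sum_{i=2}^{n-1}Y(s_i)^2,\quad A_2=\sum_{i=1}^{n-1}Y(s_i)Y(s_{i+1}),\quad A_3=\sum_{i=1}^{n}Y(s_i)^2 .$$ The log-likelihood is $\mathcal L_n(\sigma^2,\alpha)=-\frac{1}{2\sigma^2}Y_n^\top R_\alpha^{-1}Y_n-\frac n2\log\sigma^2-\frac12\log|R_\alpha|$. With $\theta=\sigma^2\alpha^{2\nu}=\sigma^2\alpha$, the prior of $(\theta,\alpha)$ has density $\pi(\theta|\alpha)\pi(\alpha)$; the joint posterior $\Pi(d\theta,d\alpha|Y_n)$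 has density proportional to $\exp\{\mathcal L_n(\theta/\alpha,\alpha)\}\pi(\theta|\alpha)\pi(\alpha)$, and $\Pi(d\alpha|Y_n)$ is its marginal. $\pi(\alpha|\theta_0)\propto\pi(\theta_0|\alpha)\pi(\alpha)$ is the conditional prior density of $\alpha$ given $\theta=\theta_0$. ($\widetilde{\mathcal L}_n$ is, up to an additive constant, the profile log-likelihood of $\alpha$.) Constants (to be taken with $d=1$, $\nu=1/2$): $\underline\alpha_n=n^{-\underline\kappa}$, $\overline\alpha_n=n^{\overline\kappa}$, with $$\underline\kappa=\tfrac12\min\Big\{\tfrac{0.9}{(2d+0.94)(8\nu+3d-0.9)},\tfrac{1}{4(3\nu+d)},0.01\Big\},\qquad \overline\kappa=\tfrac12\min\Big\{\tfrac{0.9}{(2d+0.94)(8\nu+5d+0.9)},\tfrac{1}{2(2\nu+d)},0.01\Big\}.$$ $\|P_1-P_2\|_{TV}=\sup_A|P_1(A)-P_2(A)|$; $\mathcal N(d\theta|\mu,v)$ is the normal measure with mean $\mu$ and variance $v$. *)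

theory Defs
  imports "HOL-Probability.Probability" "Jordan_Normal_Form.Determinant"
    "Jordan_Normal_Form.Gauss_Jordan_Elimination"
begin

text \<open>The second parameter is the variance, whereas \<^const>\<open>normal_density\<close> takes the standard deviation.\<close>

definition normal_measure :: "real \<Rightarrow> real \<Rightarrow> real measure" where
  "normal_measure m v =
     (if v = 0 then return borel m
      else density lborel (\<lambda>x. ennreal (normal_density m (sqrt v) x)))"

definition gaussian_process :: "'w measure \<Rightarrow> real set \<Rightarrow> (real \<Rightarrow> 'w \<Rightarrow> real) \<Rightarrow> bool" where
  "gaussian_process M T X \<longleftrightarrow>
     prob_space M \<and> (\<forall>t\<in>T. X t \<in> borel_measurable M) \<and>
     (\<forall>F c. finite F \<and> F \<subseteq> T \<longrightarrow>
        (\<exists>m v. v \<ge> 0 \<and> distr M borel (\<lambda>w. \<Sum>t\<in>F. c t * X t w) = normal_measure m v))"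

definition ou_process ::
    "'w measure \<Rightarrow> real set \<Rightarrow> real \<Rightarrow> real \<Rightarrow> (real \<Rightarrow> 'w \<Rightarrow> real) \<Rightarrow> bool" where
  "ou_process M T s2 a X \<longleftrightarrow>
     gaussian_process M T X \<and>
     (\<forall>t\<in>T. (\<integral>w. X t w \<partial>M) = 0) \<and>
     (\<forall>s\<in>T. \<forall>t\<in>T. (\<integral>w. X s w * X t w \<partial>M) = s2 * exp (- a * \<bar>s - t\<bar>))"

text \<open>Outer probability is used so that no measurability of the random quantities has to be
  presupposed; on measurable events it is the probability.\<close>

definition tendsto_in_prob :: "'w measure \<Rightarrow> (nat \<Rightarrow> 'w \<Rightarrow> real) \<Rightarrow> real \<Rightarrow> bool" where
  "tendsto_in_prob M Z l \<longleftrightarrow>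
     (\<forall>\<epsilon>>0. (\<lambda>n. outer_measure_of M {w \<in> space M. \<bar>Z n w - l\<bar> > \<epsilon>}) \<longlonglongrightarrow> 0)"

definition bounded_in_prob :: "'w measure \<Rightarrow> (nat \<Rightarrow> 'w \<Rightarrow> real) \<Rightarrow> bool" where
  "bounded_in_prob M Z \<longleftrightarrow>
     (\<forall>\<epsilon>::real. \<epsilon> > 0 \<longrightarrow> (\<exists>K. \<forall>\<^sub>F n in sequentially.
        outer_measure_of M {w \<in> space M. \<bar>Z n w\<bar> > K} < ennreal \<epsilon>))"

definition weak_conv_in_prob ::
    "'w measure \<Rightarrow> (nat \<Rightarrow> 'w \<Rightarrow> real measure) \<Rightarrow> real measure \<Rightarrow> bool" where
  "weak_conv_in_prob M Q N \<longleftrightarrow>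
     (\<forall>f::real \<Rightarrow> real. continuous_on UNIV f \<and> bounded (range f) \<longrightarrow>
        tendsto_in_prob M (\<lambda>n w. \<integral>x. f x \<partial>Q n w) (\<integral>x. f x \<partial>N))"

definition tv_dist :: "'b measure \<Rightarrow> 'b measure \<Rightarrow> real" where
  "tv_dist P Q = (SUP A\<in>sets P. \<bar>measure P A - measure Q A\<bar>)"

text \<open>The measure with density proportional to \<open>f\<close> with respect to \<open>M\<close>. If \<open>f\<close> integrates to
  \<open>0\<close> or \<open>\<infinity>\<close> this is the null measure, whose distance \<^const>\<open>tv_dist\<close> to any probability measure
  is \<open>1\<close>.\<close>

definition normalized :: "'b measure \<Rightarrow> ('b \<Rightarrow> real) \<Rightarrow> 'b measure" where
  "normalized M f = density M (\<lambda>x. ennreal (f x) / (\<integral>\<^sup>+ z. ennreal (f z) \<partial>M))"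

definition proper_density :: "(real \<Rightarrow> real) \<Rightarrow> bool" where
  "proper_density f \<longleftrightarrow>
     (\<forall>x>0. f x \<ge> 0) \<and> set_integrable lborel {0<..} f \<and> (LINT x:{0<..}|lborel. f x) = 1"

text \<open>A sample is a function \<open>y\<close> on \<open>{1..n}\<close> with \<open>y i = Y(s\<^sub>i)\<close>. Vectors and matrices of
  \<^typ>\<open>real Matrix.vec\<close>, \<^typ>\<open>real Matrix.mat\<close> are indexed from \<open>0\<close>, hence the shifts by \<^const>\<open>Suc\<close>.\<close>

definition grid :: "nat \<Rightarrow> nat \<Rightarrow> real" where
  "grid n i = real i / real n"

definition stat_A1 :: "nat \<Rightarrow> (nat \<Rightarrow> real) \<Rightarrow> real" where
  "stat_A1 n y = (\<Sum>i=2..n-1. (y i)\<^sup>2)"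

definition stat_A2 :: "nat \<Rightarrow> (nat \<Rightarrow> real) \<Rightarrow> real" where
  "stat_A2 n y = (\<Sum>i=1..n-1. y i * y (i + 1))"

definition stat_A3 :: "nat \<Rightarrow> (nat \<Rightarrow> real) \<Rightarrow> real" where
  "stat_A3 n y = (\<Sum>i=1..n. (y i)\<^sup>2)"

definition u_star :: "nat \<Rightarrow> (nat \<Rightarrow> real) \<Rightarrow> real" where
  "u_star n y = real n * (stat_A1 n y - stat_A2 n y) / stat_A1 n y"

definition v_star :: "nat \<Rightarrow> (nat \<Rightarrow> real) \<Rightarrow> real" where
  "v_star n y = real n * (stat_A1 n y - 2 * stat_A2 n y + stat_A3 n y) / stat_A1 n y"

definition obs_vec :: "nat \<Rightarrow> (nat \<Rightarrow> real) \<Rightarrow> real Matrix.vec" where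
  "obs_vec n y = Matrix.vec n (\<lambda>i. y (Suc i))"

definition corr_mat :: "nat \<Rightarrow> real \<Rightarrow> real Matrix.mat" where
  "corr_mat n a =
     Matrix.mat n n (\<lambda>(i, j). exp (- a * \<bar>grid n (Suc i) - grid n (Suc j)\<bar>))"

definition quad_form :: "nat \<Rightarrow> (nat \<Rightarrow> real) \<Rightarrow> real \<Rightarrow> real" where
  "quad_form n y a =
     scalar_prod (obs_vec n y) (mult_mat_vec (the (mat_inverse (corr_mat n a))) (obs_vec n y))"

definition log_lik :: "nat \<Rightarrow> (nat \<Rightarrow> real) \<Rightarrow> real \<Rightarrow> real \<Rightarrow> real" where
  "log_lik n y s2 a =
     - (1 / (2 * s2)) * quad_form n y a - real n / 2 * ln s2
     - 1 / 2 * ln (Determinant.det (corr_mat n a))"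

definition theta_tilde :: "nat \<Rightarrow> (nat \<Rightarrow> real) \<Rightarrow> real \<Rightarrow> real" where
  "theta_tilde n y a = a * quad_form n y a / real n"

definition log_lik_tilde :: "nat \<Rightarrow> (nat \<Rightarrow> real) \<Rightarrow> real \<Rightarrow> real" where
  "log_lik_tilde n y a =
     - (real n / 2) * ln (stat_A1 n y * exp (- 2 * a / real n)
                          - 2 * stat_A2 n y * exp (- a / real n) + stat_A3 n y)
     + 1 / 2 * ln (1 - exp (- 2 * a / real n))"

text \<open>\<open>p \<theta> \<alpha>\<close> is the prior density \<open>\<pi>(\<theta>|\<alpha>)\<close> and \<open>q \<alpha>\<close> is \<open>\<pi>(\<alpha>)\<close>; both matter only for positive
  arguments. The parametrisation is \<open>\<theta> = \<sigma>\<^sup>2 \<alpha>\<close>.\<close>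

definition joint_posterior ::
    "(real \<Rightarrow> real \<Rightarrow> real) \<Rightarrow> (real \<Rightarrow> real) \<Rightarrow> nat \<Rightarrow> (nat \<Rightarrow> real) \<Rightarrow> (real \<times> real) measure" where
  "joint_posterior p q n y =
     normalized (lborel \<Otimes>\<^sub>M lborel)
       (\<lambda>(\<theta>, \<alpha>). indicator {0<..} \<theta> * indicator {0<..} \<alpha> *
          (exp (log_lik n y (\<theta> / \<alpha>) \<alpha>) * p \<theta> \<alpha> * q \<alpha>))"

definition alpha_posterior ::
    "(real \<Rightarrow> real \<Rightarrow> real) \<Rightarrow> (real \<Rightarrow> real) \<Rightarrow> nat \<Rightarrow> (nat \<Rightarrow> real) \<Rightarrow> real measure" where
  "alpha_posterior p q n y = distr (joint_posterior p q n y) borel snd"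

definition alpha_prior_given ::
    "(real \<Rightarrow> real \<Rightarrow> real) \<Rightarrow> (real \<Rightarrow> real) \<Rightarrow> real \<Rightarrow> real \<Rightarrow> real" where
  "alpha_prior_given p q \<theta> \<alpha> = p \<theta> \<alpha> * q \<alpha> / (LINT a:{0<..}|lborel. p \<theta> a * q a)"

definition profile_posterior ::
    "(real \<Rightarrow> real \<Rightarrow> real) \<Rightarrow> (real \<Rightarrow> real) \<Rightarrow> real \<Rightarrow> nat \<Rightarrow> (nat \<Rightarrow> real) \<Rightarrow> real measure" where
  "profile_posterior p q \<theta>\<^sub>0 n y =
     normalized lborel
       (\<lambda>\<alpha>. indicator {0<..} \<alpha> * (exp (log_lik_tilde n y \<alpha>) * alpha_prior_given p q \<theta>\<^sub>0 \<alpha>))"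

definition star_posterior ::
    "(real \<Rightarrow> real \<Rightarrow> real) \<Rightarrow> (real \<Rightarrow> real) \<Rightarrow> real \<Rightarrow> nat \<Rightarrow> (nat \<Rightarrow> real) \<Rightarrow> real measure" where
  "star_posterior p q \<theta>\<^sub>0 n y =
     normalized lborel
       (\<lambda>\<alpha>. indicator {0<..} \<alpha> *
          (sqrt \<alpha> * exp (- ((\<alpha> - u_star n y)\<^sup>2 / (2 * v_star n y))) * alpha_prior_given p q \<theta>\<^sub>0 \<alpha>))"

definition kappa_lower :: "real \<Rightarrow> real \<Rightarrow> real" where
  "kappa_lower d \<nu> =
     1 / 2 * Min {0.9 / ((2 * d + 0.94) * (8 * \<nu> + 3 * d - 0.9)), 1 / (4 * (3 * \<nu> + d)), 0.01}"

definition kappa_upper :: "real \<Rightarrow> real \<Rightarrow> real" where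
  "kappa_upper d \<nu> =
     1 / 2 * Min {0.9 / ((2 * d + 0.94) * (8 * \<nu> + 5 * d + 0.9)), 1 / (2 * (2 * \<nu> + d)), 0.01}"

definition alpha_lower :: "nat \<Rightarrow> real" where
  "alpha_lower n = real n powr (- kappa_lower 1 (1 / 2))"

definition alpha_upper :: "nat \<Rightarrow> real" where
  "alpha_upper n = real n powr kappa_upper 1 (1 / 2)"

end

theory Submission
  imports Defs "HOL-Real_Asymp.Real_Asymp"
begin

text \<open>The correlation matrix is that of an autoregression with coefficient \<open>b = exp (- \<alpha> / n)\<close>. Hence its
  determinant is \<open>(1 - b\<^sup>2) ^ (n - 1)\<close> and its inverse is tridiagonal, and in the coordinates \<open>(\<theta>, \<alpha>)\<close> the
  likelihood is exactly the profile likelihood of \<open>\<alpha>\<close> times the kernel \<open>((t / \<theta>) exp (1 - t / \<theta>)) powr (n / 2)\<close>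
  in \<open>\<theta>\<close>, where \<open>t\<close> is the maximizer in \<open>\<theta>\<close>. The kernel is at most \<open>1\<close> for all values of \<open>\<alpha>\<close>, and over the
  range \<open>{alpha_lower n..alpha_upper n}\<close> the maximizer moves by \<open>O(n powr (- 99 / 100))\<close> only, so there the kernel
  is uniformly close to one and the same normal density, of width \<open>n powr (- 1 / 2)\<close>. The profile likelihood
  is, up to a constant, at most a multiple of \<open>sqrt \<alpha>\<close> and converges to
  \<open>sqrt \<alpha> exp (- (\<alpha> - u)\<^sup>2 / (2 v))\<close>. Both total variation limits thus reduce to \<open>L\<^sup>1\<close> estimates of
  unnormalized densities, uniform over all samples with \<open>u\<close>, \<open>v\<close>, \<open>1 / v\<close> and \<open>sqrt n (D - 2 \<theta>\<^sub>0)\<close> bounded,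
  \<open>D\<close> being the quadratic variation.

  These quantities are bounded in probability because the estimator at \<open>\<alpha>\<^sub>0\<close> has mean \<open>\<theta>\<^sub>0\<close> and variance
  \<open>2 \<theta>\<^sub>0\<^sup>2 / n\<close>, and because \<open>A\<^sub>1 / n\<close> dominates the square of a sample mean, a Gaussian variable whose
  variance is bounded below.\<close>

text \<open>Outside \<open>{alpha_lower n..alpha_upper n}\<close> the prior of \<theta> given
  \<alpha> is known only to be a density. There the kernel is replaced by its maximum, of order
  \<open>sqrt n\<close>, and the profile likelihood by a multiple of \<open>sqrt \<alpha>\<close>;
  what remains is \<open>sqrt n\<close> times a tail of the integral of
  \<open>sqrt \<alpha> * q \<alpha>\<close>, which is exactly what the two tail hypotheses send to
  0. Inside, the comparison takes place on a window of half-width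
  \<open>n powr (slack - 1 / 2)\<close> about the true \<theta>: wide enough to hold almost all of
  the normal mass, narrow enough for the cubic term of the log-kernel and the variation of the log
  prior to vanish. Every estimate holds for all regular samples at once, so outer probability
  suffices and measurability of the distances in the sample never arises. Normalizing requires a
  lower bound on the mass of the limit that is uniform over regular samples
  (\<open>min_mass\<close>). The limit densities are also dominated by one integrable function, so
  short intervals have uniformly small posterior probability; this excludes every point
  mass.\<close>

section \<open>Correlation matrices of the Ornstein-Uhlenbeck process\<close>

text \<open>\<open>L\<close> turns the observations into the innovations
  \<open>y (i + 1) - b * y i\<close>, whose variances are proportional to \<open>d i\<close>.
  Multiplying by \<open>L\<close> on one side already makes the correlation matrix upper triangular
  with diagonal \<open>d\<close>, which yields the determinant. Dividing the rows by
  \<open>d\<close> leaves the inverse of the transpose of \<open>L\<close>, so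
  \<open>transpose_mat L * (E * L)\<close> is the inverse, and the quadratic form is the sum of
  squared innovations over their variances.\<close>

lemma det_corr_mat_and_quad_form:
  assumes n: "n \<ge> 2" and a: "a > 0"
  defines "b \<equiv> exp (- a / real n)"
  shows "Determinant.det (corr_mat n a) = (1 - b\<^sup>2) ^ (n - 1)"
    and "quad_form n y a
           = (\<Sum>i<n. (y (Suc i) - (if i = 0 then 0 else b * y i))\<^sup>2 / (if i = 0 then 1 else 1 - b\<^sup>2))"
    and "quad_form n y a
           = (stat_A1 n y * b\<^sup>2 - 2 * stat_A2 n y * b + stat_A3 n y) / (1 - b\<^sup>2)"
proof -
  have b0: "0 < b" by (simp add: b_def)
  have b1: "b < 1" using n a by (simp add: b_def)
  have c0: "1 - b\<^sup>2 > 0" using b0 b1 by (simp add: power_less_one_iff abs_square_less_1)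
  define d where "d i = (if i = 0 then 1 else 1 - b\<^sup>2)" for i :: nat
  have d0: "d i > 0" for i using c0 by (simp add: d_def)
  define L where "L = Matrix.mat n n (\<lambda>(i, j). if j = i then 1 else if Suc j = i then - b else 0)"
  define R where "R = corr_mat n a"
  have R: "R = Matrix.mat n n (\<lambda>(i, j). b ^ (if i \<le> j then j - i else i - j))"
  proof -
    have "exp (- a * \<bar>grid n (Suc i) - grid n (Suc j)\<bar>) = b ^ (if i \<le> j then j - i else i - j)"
      (is "exp ?l = b ^ ?k") for i j
    proof -
      have "grid n (Suc i) - grid n (Suc j) = (real i - real j) / real n"
        by (simp add: grid_def diff_divide_distrib[symmetric])
      then have "\<bar>grid n (Suc i) - grid n (Suc j)\<bar> = real ?k / real n"
        by (simp add: of_nat_diff)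
      then have "?l = real ?k * (- a / real n)" by simp
      then show ?thesis by (simp add: b_def exp_of_nat_mult[symmetric])
    qed
    then show ?thesis by (simp add: R_def corr_mat_def)
  qed
  \<comment> \<open>\<open>W\<close> will be \<open>L * R\<close>, and \<open>V\<close>, which is
    \<open>W\<close> with its rows divided by \<open>d\<close>, will be the inverse of
    \<open>transpose_mat L\<close>.\<close>
  define V where "V = Matrix.mat n n (\<lambda>(i, j). if i \<le> j then b ^ (j - i) else 0 :: real)"
  define W where "W = Matrix.mat n n (\<lambda>(i, j). if i \<le> j then d i * b ^ (j - i) else 0)"
  have carr: "L \<in> carrier_mat n n" "R \<in> carrier_mat n n" "V \<in> carrier_mat n n" "W \<in> carrier_mat n n"
    by (auto simp: L_def R V_def W_def)
  have rowL: "(\<Sum>k<n. (if k = i then 1 else if Suc k = i then - b else 0) * f k)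
      = f i - (if i = 0 then 0 else b * f (i - 1))" if "i < n" for i and f :: "nat \<Rightarrow> real"
  proof -
    have "(\<Sum>k<n. (if k = i then 1 else if Suc k = i then - b else 0) * f k)
        = (\<Sum>k<n. (if k = i then f k else 0)) + (\<Sum>k<n. (if Suc k = i then - b * f k else 0))"
      by (subst sum.distrib[symmetric], intro sum.cong) auto
    also have "(\<Sum>k<n. (if Suc k = i then - b * f k else 0)) = - (if i = 0 then 0 else b * f (i - 1))"
      using that by (cases i) (auto simp: sum.delta)
    finally show ?thesis using that by (simp add: sum.delta)
  qed
  have LR: "L * R = W"
  proof (rule eq_matI)
    fix i j assume "i < dim_row W" "j < dim_col W"
    then have ij: "i < n" "j < n" by (auto simp: W_def)
    then have "(L * R) $$ (i, j) = (\<Sum>k<n. (if k = i then 1 else if Suc k = i then - b else 0)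
        * b ^ (if k \<le> j then j - k else k - j))"
      by (simp add: L_def R scalar_prod_def atLeast0LessThan)
    also have "\<dots> = (if i \<le> j then d i * b ^ (j - i) else 0)"
    proof (cases i)
      case 0
      then show ?thesis using ij by (subst rowL) (auto simp: d_def)
    next
      case (Suc m)
      consider "Suc m \<le> j" | "j = m" | "j < m" by linarith
      then show ?thesis
      proof cases
        case 1
        then have "j - m = Suc (j - Suc m)" by simp
        then show ?thesis using ij Suc 1
          by (subst rowL) (auto simp: d_def power2_eq_square algebra_simps)
      next
        case 2
        then show ?thesis using ij Suc by (subst rowL) (auto simp: d_def)
      next
        case 3
        then have "Suc m - j = Suc (m - j)" by simp
        then show ?thesis using ij Suc 3 by (subst rowL) (auto simp: d_def)
      qed
    qed
    finally show "(L * R) $$ (i, j) = W $$ (i, j)" using ij by (simp add: W_def)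
  qed (auto simp: L_def R W_def)
  have "Determinant.det L = prod_list (diag_mat L)"
    by (rule det_lower_triangular[OF _ carr(1)]) (auto simp: L_def)
  also have "\<dots> = 1" proof -
    have "diag_mat L = replicate n 1" by (auto simp: diag_mat_def L_def intro!: nth_equalityI)
    then show ?thesis by (simp add: prod_list_replicate)
  qed
  finally have detL: "Determinant.det L = 1" .
  have "Determinant.det W = prod_list (diag_mat W)"
    by (rule det_upper_triangular[OF _ carr(4)]) (auto simp: W_def)
  also have "diag_mat W = map d [0..<n]"
    by (auto simp: diag_mat_def W_def intro!: nth_equalityI)
  also have "prod_list (map d [0..<n]) = (\<Prod>i<n. d i)"
    using prod.distinct_set_conv_list[of "[0..<n]" d] by (simp add: atLeast0LessThan)
  also have "\<dots> = (1 - b\<^sup>2) ^ (n - 1)"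
    using n by (cases n) (auto simp: prod.lessThan_Suc_shift d_def simp del: prod.lessThan_Suc)
  finally have "Determinant.det W = (1 - b\<^sup>2) ^ (n - 1)" .
  moreover have "Determinant.det W = Determinant.det L * Determinant.det R"
    unfolding LR[symmetric] by (rule det_mult[OF carr(1,2)])
  ultimately show "Determinant.det (corr_mat n a) = (1 - b\<^sup>2) ^ (n - 1)"
    using detL by (simp add: R_def)

  define E where "E = Matrix.mat n n (\<lambda>(i, j). if i = j then 1 / d i else 0)"
  have E: "E \<in> carrier_mat n n" by (simp add: E_def)
  have EW: "E * W = V"
  proof (rule eq_matI)
    fix i j assume "i < dim_row V" "j < dim_col V"
    then have ij: "i < n" "j < n" by (auto simp: V_def)
    have "(E * W) $$ (i, j) = (\<Sum>k<n. (if k = i then (if i \<le> j then b ^ (j - i) else 0) else 0))"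
    proof -
      have "(E * W) $$ (i, j) = (\<Sum>k<n. (if i = k then 1 / d i else 0) *
          (if k \<le> j then d k * b ^ (j - k) else 0))"
        using ij by (simp add: E_def W_def scalar_prod_def atLeast0LessThan)
      also have "\<dots> = (\<Sum>k<n. (if k = i then (if i \<le> j then b ^ (j - i) else 0) else 0))"
        using d0[of i] by (intro sum.cong) auto
      finally show ?thesis .
    qed
    also have "\<dots> = (if i \<le> j then b ^ (j - i) else 0)" using ij by (simp add: sum.delta)
    finally show "(E * W) $$ (i, j) = V $$ (i, j)" using ij by (simp add: V_def)
  qed (auto simp: E_def V_def W_def)
  have LV: "transpose_mat L * V = 1\<^sub>m n"
  proof (rule eq_matI)
    fix i j assume "i < dim_row (1\<^sub>m n :: real mat)" "j < dim_col (1\<^sub>m n :: real mat)"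
    then have ij: "i < n" "j < n" by auto
    have "(transpose_mat L * V) $$ (i, j) = (\<Sum>k<n. (if i = k then 1 else if Suc i = k then - b else 0) * 
        (if k \<le> j then b ^ (j - k) else 0))"
      using ij by (simp add: L_def V_def scalar_prod_def atLeast0LessThan)
    also have "\<dots> = (\<Sum>k<n. (if k = i then (if k \<le> j then b ^ (j - k) else 0) else 0)) +
        (\<Sum>k<n. (if k = Suc i then - b * (if k \<le> j then b ^ (j - k) else 0) else 0))"
      by (subst sum.distrib[symmetric], intro sum.cong) auto
    also have "\<dots> = (if i \<le> j then b ^ (j - i) else 0) 
       - (if Suc i < n then b * (if Suc i \<le> j then b ^ (j - Suc i) else 0) else 0)"
      using ij by (subst sum.delta, simp, subst sum.delta) auto
    also have "\<dots> = (if i = j then 1 else 0)"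
    proof (cases "Suc i \<le> j")
      case True
      then have "j - i = Suc (j - Suc i)" by simp
      then show ?thesis using True ij by auto
    qed auto
    finally show "(transpose_mat L * V) $$ (i, j) = (1\<^sub>m n :: real mat) $$ (i, j)" using ij by simp
  qed (auto simp: L_def V_def)
  define B where "B = transpose_mat L * (E * L)"
  have B: "B \<in> carrier_mat n n" using carr E by (auto simp: B_def)
  have BR: "B * R = 1\<^sub>m n"
  proof -
    have "B * R = transpose_mat L * (E * (L * R))"
      unfolding B_def using carr E
      by (simp add: assoc_mult_mat[of _ n n _ n _ n])
    then show ?thesis by (simp add: LR EW LV)
  qed
  have inv: "the (mat_inverse R) = B"
  proof (cases "mat_inverse R")
    \<comment> \<open>\<open>mat_inverse\<close> returns \<open>None\<close> only for a matrix that
      is not a unit, and \<open>B\<close> shows \<open>R\<close> to be one. In the other case the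
      inverse found must be \<open>B\<close>, as \<open>B\<close> is a left inverse.\<close>
    case None
    have "R * B = 1\<^sub>m n" by (rule mat_mult_left_right_inverse[OF B carr(2) BR])
    then have "R \<in> Units (ring_mat TYPE(real) n undefined)"
      using carr(2) B BR by (auto simp: Units_def ring_mat_def)
    then show ?thesis using mat_inverse(1)[OF carr(2) None, of undefined] by blast
  next
    case (Some C)
    from mat_inverse(2)[OF carr(2) Some] have C: "R * C = 1\<^sub>m n" "C \<in> carrier_mat n n" by auto
    have "B = B * (R * C)" using C B by simp
    also have "\<dots> = (B * R) * C" using C B carr by (simp add: assoc_mult_mat[of _ n n _ n _ n])
    also have "\<dots> = C" using C BR by simp
    finally show ?thesis using Some by simp
  qed
  define z where "z = obs_vec n y"
  have z: "z \<in> carrier_vec n" by (simp add: z_def obs_vec_def)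
  have Lz: "L *\<^sub>v z = Matrix.vec n (\<lambda>i. y (Suc i) - (if i = 0 then 0 else b * y i))"
  proof (rule eq_vecI)
    fix i assume "i < dim_vec (Matrix.vec n (\<lambda>i. y (Suc i) - (if i = 0 then 0 else b * y i)))"
    then have i: "i < n" by simp
    have "(L *\<^sub>v z) $ i = (\<Sum>k<n. (if k = i then 1 else if Suc k = i then - b else 0) * y (Suc k))"
      using i by (simp add: L_def z_def obs_vec_def mult_mat_vec_def scalar_prod_def atLeast0LessThan)
    also have "\<dots> = y (Suc i) - (if i = 0 then 0 else b * y i)"
      by (subst rowL[OF i]) auto
    finally show "(L *\<^sub>v z) $ i = Matrix.vec n (\<lambda>i. y (Suc i) - (if i = 0 then 0 else b * y i)) $ i"
      using i by simp
  qed (simp add: L_def)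
  have "quad_form n y a = z \<bullet> (B *\<^sub>v z)"
    by (simp add: quad_form_def inv[unfolded R_def] z_def)
  also have "B *\<^sub>v z = transpose_mat L *\<^sub>v (E *\<^sub>v (L *\<^sub>v z))"
    unfolding B_def using carr E z by (simp add: assoc_mult_mat_vec[of _ n n _ n])
  also have "z \<bullet> \<dots> = (L *\<^sub>v z) \<bullet> (E *\<^sub>v (L *\<^sub>v z))"
    using transpose_vec_mult_scalar[of "transpose_mat L" n n "E *\<^sub>v (L *\<^sub>v z)" z] carr E z by simp
  also have "E *\<^sub>v (L *\<^sub>v z) = Matrix.vec n (\<lambda>i. (L *\<^sub>v z) $ i / d i)"
  proof (rule eq_vecI)
    fix i assume "i < dim_vec (Matrix.vec n (\<lambda>i. (L *\<^sub>v z) $ i / d i))"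
    then have i: "i < n" by simp
    have "(E *\<^sub>v (L *\<^sub>v z)) $ i = (\<Sum>k<n. (if k = i then (L *\<^sub>v z) $ i / d i else 0))"
    proof -
      have "dim_vec (L *\<^sub>v z) = n" by (simp add: L_def)
      then have "(E *\<^sub>v (L *\<^sub>v z)) $ i = (\<Sum>k<n. (if i = k then 1 / d i else 0) * (L *\<^sub>v z) $ k)"
        using i unfolding E_def mult_mat_vec_def[of "Matrix.mat _ _ _"]
        by (simp add: scalar_prod_def atLeast0LessThan)
      also have "\<dots> = (\<Sum>k<n. (if k = i then (L *\<^sub>v z) $ i / d i else 0))"
        by (intro sum.cong) auto
      finally show ?thesis .
    qed
    then show "(E *\<^sub>v (L *\<^sub>v z)) $ i = Matrix.vec n (\<lambda>i. (L *\<^sub>v z) $ i / d i) $ i"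
      using i by (simp add: sum.delta)
  qed (simp add: E_def)
  also have "(L *\<^sub>v z) \<bullet> Matrix.vec n (\<lambda>i. (L *\<^sub>v z) $ i / d i)
     = (\<Sum>i<n. (y (Suc i) - (if i = 0 then 0 else b * y i))\<^sup>2 / d i)"
    unfolding Lz by (simp add: scalar_prod_def atLeast0LessThan power2_eq_square)
  finally have q: "quad_form n y a = (\<Sum>i<n. (y (Suc i) - (if i = 0 then 0 else b * y i))\<^sup>2 / d i)" .
  then show "quad_form n y a
      = (\<Sum>i<n. (y (Suc i) - (if i = 0 then 0 else b * y i))\<^sup>2 / (if i = 0 then 1 else 1 - b\<^sup>2))"
    by (simp add: d_def)
  show "quad_form n y a = (stat_A1 n y * b\<^sup>2 - 2 * stat_A2 n y * b + stat_A3 n y) / (1 - b\<^sup>2)"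
  proof -
    obtain k where k: "n = Suc (Suc k)" using n by (metis add_2_eq_Suc le_Suc_ex)
    define s t u where "s = (\<Sum>i<Suc k. (y (i + 2))\<^sup>2)" and "t = (\<Sum>i<Suc k. y (Suc i) * y (i + 2))"
      and "u = (\<Sum>i<Suc k. (y (Suc i))\<^sup>2)"
    have "quad_form n y a = (y 1)\<^sup>2 + (\<Sum>i<Suc k. (y (i + 2) - b * y (Suc i))\<^sup>2 / (1 - b\<^sup>2))"
      unfolding k q[unfolded k] by (subst sum.lessThan_Suc_shift) (simp add: d_def)
    also have "(\<Sum>i<Suc k. (y (i + 2) - b * y (Suc i))\<^sup>2 / (1 - b\<^sup>2)) = (s - 2 * b * t + b\<^sup>2 * u) / (1 - b\<^sup>2)"
      unfolding s_def t_def u_def sum_divide_distrib[symmetric] sum_distrib_left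
        sum_subtractf[symmetric] sum.distrib[symmetric]
      by (intro arg_cong2[where f = "(/)"] sum.cong) (auto simp: power2_eq_square algebra_simps)
    finally have Q: "quad_form n y a = (y 1)\<^sup>2 + (s - 2 * b * t + b\<^sup>2 * u) / (1 - b\<^sup>2)" .
    have A3: "stat_A3 n y = (y 1)\<^sup>2 + s"
      unfolding stat_A3_def s_def k One_nat_def sum.atLeast1_atMost_eq
      by (subst sum.lessThan_Suc_shift) simp
    have A2: "stat_A2 n y = t"
      unfolding stat_A2_def t_def k One_nat_def sum.atLeast1_atMost_eq diff_Suc_1 by (simp del: sum.lessThan_Suc)
    have A1: "stat_A1 n y = u - (y 1)\<^sup>2"
    proof -
      have "u = (\<Sum>i=1..n - 1. (y i)\<^sup>2)"
        unfolding u_def k One_nat_def sum.atLeast1_atMost_eq by simp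
      also have "\<dots> = (y 1)\<^sup>2 + stat_A1 n y"
        unfolding stat_A1_def using n by (subst sum.atLeast_Suc_atMost) (auto simp: numeral_2_eq_2)
      finally show ?thesis by simp
    qed
    \<comment> \<open>The first innovation has weight
      \<open>1 = (1 - b\<^sup>2) / (1 - b\<^sup>2)\<close>. Over the common denominator its square
      completes \<open>s\<close> to \<open>A3\<close>, and the remaining
      \<open>- b\<^sup>2 * (y 1)\<^sup>2\<close> turns \<open>u\<close> into
      \<open>A1\<close>.\<close>
    show ?thesis unfolding Q A1 A2 A3 using c0 by (simp add: field_simps)
  qed
qed

section \<open>Gaussian moments of the sample\<close>

text \<open>The degenerate law \<open>v = 0\<close> is a point mass and is treated apart. The small
  ball estimate is the maximum of the density times the length \<open>2 * d\<close>.\<close>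

lemma (in prob_space) gaussian_moments:
  fixes Z :: "'a \<Rightarrow> real"
  assumes Z[measurable]: "Z \<in> borel_measurable M"
    and distr: "distr M borel Z = normal_measure m v" and v: "v \<ge> 0"
    and mean: "expectation Z = 0"
  shows "integrable M (\<lambda>w. Z w ^ k)"
    and "expectation (\<lambda>w. (Z w)\<^sup>2) = v"
    and "expectation (\<lambda>w. Z w ^ 4) = 3 * v\<^sup>2"
    and "v > 0 \<Longrightarrow> d \<ge> 0 \<Longrightarrow> prob {w \<in> space M. \<bar>Z w\<bar> \<le> d} \<le> d / sqrt v"
proof -
  have ik: "integrable (normal_measure m v) (\<lambda>x. x ^ k) \<Longrightarrow> integrable M (\<lambda>w. Z w ^ k)" for k
    unfolding distr[symmetric] by (simp add: integrable_distr_eq)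
  have Ek: "expectation (\<lambda>w. Z w ^ k) = (\<integral>x. x ^ k \<partial>normal_measure m v)" for k
    unfolding distr[symmetric] by (simp add: integral_distr)
  have dens: "integral\<^sup>L (normal_measure m v) f = (\<integral>x. normal_density m (sqrt v) x * f x \<partial>lborel)"
      "integrable (normal_measure m v) f \<longleftrightarrow> integrable lborel (\<lambda>x. normal_density m (sqrt v) x * f x)"
    if "v > 0" "f \<in> borel_measurable borel" for f :: "real \<Rightarrow> real"
    using that v by (auto simp: normal_measure_def integral_density integrable_density)
  \<comment> \<open>\<open>gaussian_process\<close> provides some mean parameter only; the vanishing
    expectation identifies it.\<close>
  have m0: "m = 0"
  proof (cases "v = 0")
    case True
    then show ?thesis using mean Ek[of 1] by (simp add: normal_measure_def integral_return)
  next
    case False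
    then show ?thesis
      using mean Ek[of 1] v dens(1)[of "\<lambda>x. x"] integral_normal_moment_nz_1[of "sqrt v" m] by simp
  qed
  show "integrable M (\<lambda>w. Z w ^ k)"
  proof (rule ik, cases "v = 0")
    case True
    then show "integrable (normal_measure m v) (\<lambda>x. x ^ k)"
      by (auto simp: normal_measure_def integrable_iff_bounded nn_integral_return)
  next
    case False
    then have "v > 0" using v by simp
    then show "integrable (normal_measure m v) (\<lambda>x. x ^ k)"
      using m0 integrable_normal_moment[of "sqrt v" 0 k] by (simp add: dens[unfolded m0])
  qed
  have "expectation (\<lambda>w. (Z w)\<^sup>2) = v \<and> expectation (\<lambda>w. Z w ^ 4) = 3 * v\<^sup>2"
  proof (cases "v = 0")
    case True
    then show ?thesis using m0 by (simp add: normal_measure_def integral_return Ek)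
  next
    case False
    with v have "v > 0" by simp
    then show ?thesis
      using m0 integral_normal_moment_even[of "sqrt v" 0 1] integral_normal_moment_even[of "sqrt v" 0 2]
      by (simp add: Ek dens[unfolded m0] fact_numeral power_divide)
  qed
  then show "expectation (\<lambda>w. (Z w)\<^sup>2) = v" "expectation (\<lambda>w. Z w ^ 4) = 3 * v\<^sup>2" by auto
  assume "v > 0" "d \<ge> 0"
  have "{w \<in> space M. \<bar>Z w\<bar> \<le> d} = Z -` {-d..d} \<inter> space M" by auto
  then have "emeasure M {w \<in> space M. \<bar>Z w\<bar> \<le> d} = emeasure (distr M borel Z) {-d..d}"
    by (simp add: emeasure_distr)
  also have "\<dots> = (\<integral>\<^sup>+x. ennreal (normal_density m (sqrt v) x) * indicator {-d..d} x \<partial>lborel)"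
    using \<open>v > 0\<close> by (simp add: distr normal_measure_def emeasure_density)
  also have "\<dots> \<le> (\<integral>\<^sup>+x. ennreal (1 / (2 * sqrt v)) * indicator {-d..d} x \<partial>lborel)"
  proof (intro nn_integral_mono mult_right_mono ennreal_leI)
    fix x
    have "normal_density m (sqrt v) x \<le> 1 / sqrt (2 * pi * v)"
      using \<open>v > 0\<close> by (simp add: normal_density_def divide_right_mono)
    \<comment> \<open>This amounts to \<open>4 \<le> 2 * pi\<close>, and makes the final constant
      equal to 1.\<close>
    also have "2 * sqrt v \<le> sqrt (2 * pi * v)"
      using \<open>v > 0\<close> pi_gt3 by (intro real_le_rsqrt) (simp add: power_mult_distrib)
    then have "1 / sqrt (2 * pi * v) \<le> 1 / (2 * sqrt v)"
      using \<open>v > 0\<close> by (intro divide_left_mono) auto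
    finally show "normal_density m (sqrt v) x \<le> 1 / (2 * sqrt v)" .
  qed simp
  also have "\<dots> = ennreal (1 / (2 * sqrt v)) * ennreal (d - (-d))"
    using \<open>d \<ge> 0\<close> by (subst nn_integral_cmult_indicator) auto
  also have "\<dots> = ennreal (d / sqrt v)"
    using \<open>d \<ge> 0\<close> \<open>v > 0\<close> by (subst ennreal_mult[symmetric]) (auto simp: field_simps)
  finally show "prob {w \<in> space M. \<bar>Z w\<bar> \<le> d} \<le> d / sqrt v"
    using \<open>d \<ge> 0\<close> \<open>v > 0\<close> by (simp add: emeasure_eq_measure)
qed

lemma integrable_mult_of_squares:
  fixes f g :: "'a \<Rightarrow> real"
  assumes [measurable]: "f \<in> borel_measurable M" "g \<in> borel_measurable M"
    and f: "integrable M (\<lambda>w. (f w)\<^sup>2)" and g: "integrable M (\<lambda>w. (g w)\<^sup>2)"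
  shows "integrable M (\<lambda>w. f w * g w)"
proof (rule Bochner_Integration.integrable_bound)
  show "integrable M (\<lambda>w. (f w)\<^sup>2 + (g w)\<^sup>2)" using f g by simp
  have "\<bar>x * y\<bar> \<le> x\<^sup>2 + y\<^sup>2" for x y :: real
  proof -
    have "2 * (\<bar>x\<bar> * \<bar>y\<bar>) \<le> x\<^sup>2 + y\<^sup>2" using sum_squares_bound[of "\<bar>x\<bar>" "\<bar>y\<bar>"] by simp
    moreover have "0 \<le> \<bar>x\<bar> * \<bar>y\<bar>" by simp
    ultimately show ?thesis unfolding abs_mult by linarith
  qed
  then show "AE w in M. norm (f w * g w) \<le> norm ((f w)\<^sup>2 + (g w)\<^sup>2)" by auto
qed simp

section \<open>Linear combinations of the observations and the variance of the estimator\<close>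

locale ou_sample = prob_space M for M :: "'w measure" +
  fixes X :: "real \<Rightarrow> 'w \<Rightarrow> real" and s2 a :: real
  assumes ou: "ou_process M {0..1} s2 a X" and s2: "s2 > 0" and a: "a > 0"
begin

abbreviation Y :: "nat \<Rightarrow> 'w \<Rightarrow> nat \<Rightarrow> real" where "Y n w i \<equiv> X (grid n i) w"

definition lincomb :: "nat \<Rightarrow> (nat \<Rightarrow> real) \<Rightarrow> 'w \<Rightarrow> real" where
  "lincomb n c w = (\<Sum>i=1..n. c i * Y n w i)"

lemma grid_mem: "i \<le> n \<Longrightarrow> grid n i \<in> {0..1}"
  by (cases "n = 0") (auto simp: grid_def)

lemma measurable_Y [measurable]: "i \<le> n \<Longrightarrow> X (grid n i) \<in> borel_measurable M"
  using ou grid_mem unfolding ou_process_def gaussian_process_def by blast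

lemma measurable_lincomb [measurable]: "lincomb n c \<in> borel_measurable M"
  unfolding lincomb_def by (intro borel_measurable_sum borel_measurable_times) auto

text \<open>\<open>gaussian_process\<close> speaks of sums over sets of times, so the coefficients
  are transported along \<open>grid n\<close>, which is injective on \<open>{1..n}\<close>.\<close>

lemma lincomb_normal:
  obtains m v where "v \<ge> 0" "distr M borel (lincomb n c) = normal_measure m v"
proof -
  let ?h = "\<lambda>t. c (the_inv_into {1..n} (grid n) t)"
  have inj: "inj_on (grid n) {1..n}" by (auto simp: inj_on_def grid_def)
  have "lincomb n c w = (\<Sum>t\<in>grid n ` {1..n}. ?h t * X t w)" for w
    unfolding lincomb_def sum.reindex[OF inj] o_def
    by (intro sum.cong refl) (use the_inv_into_f_f[OF inj] in simp)
  then have "lincomb n c = (\<lambda>w. \<Sum>t\<in>grid n ` {1..n}. ?h t * X t w)" by auto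
  moreover have "finite (grid n ` {1..n})" "grid n ` {1..n} \<subseteq> {0..1}" using grid_mem by auto
  ultimately show ?thesis
    using ou that unfolding ou_process_def gaussian_process_def by metis
qed

lemma Y_lincomb: "1 \<le> i \<Longrightarrow> i \<le> n \<Longrightarrow> Y n w i = lincomb n (\<lambda>k. if k = i then 1 else 0) w"
  by (simp add: lincomb_def if_distrib[of "\<lambda>x. x * _"] sum.delta cong: if_cong)

lemma expectation_Y:
  "i \<le> n \<Longrightarrow> expectation (\<lambda>w. Y n w i) = 0"
  "i \<le> n \<Longrightarrow> j \<le> n \<Longrightarrow>
     expectation (\<lambda>w. Y n w i * Y n w j) = s2 * exp (- a * \<bar>real i - real j\<bar> / real n)"
proof -
  show "i \<le> n \<Longrightarrow> expectation (\<lambda>w. Y n w i) = 0"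
    using ou grid_mem unfolding ou_process_def by blast
  assume "i \<le> n" "j \<le> n"
  have "\<bar>grid n i - grid n j\<bar> = \<bar>real i - real j\<bar> / real n"
    by (simp add: grid_def diff_divide_distrib[symmetric])
  then show "expectation (\<lambda>w. Y n w i * Y n w j) = s2 * exp (- a * \<bar>real i - real j\<bar> / real n)"
    using \<open>i \<le> n\<close> \<open>j \<le> n\<close> ou grid_mem unfolding ou_process_def by fastforce
qed

text \<open>The moments in \<open>ou_process\<close> are Bochner integrals, whose values do not by
  themselves imply integrability; it is derived from normality.\<close>

lemma square_integrable_Y:
  assumes "1 \<le> i" "i \<le> n" shows "integrable M (\<lambda>w. (Y n w i)\<^sup>2)" "integrable M (\<lambda>w. Y n w i)"
proof -
  obtain m v where "v \<ge> 0" "distr M borel (lincomb n (\<lambda>k. if k = i then 1 else 0)) = normal_measure m v"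
    by (rule lincomb_normal)
  moreover have "lincomb n (\<lambda>k. if k = i then 1 else 0) = (\<lambda>w. Y n w i)"
    using assms by (auto simp: Y_lincomb)
  ultimately have "integrable M (\<lambda>w. Y n w i ^ k)" for k
    using gaussian_moments(1)[of "\<lambda>w. Y n w i" m v k] assms by (simp add: expectation_Y)
  from this[of 1] this[of 2] show "integrable M (\<lambda>w. (Y n w i)\<^sup>2)" "integrable M (\<lambda>w. Y n w i)" by auto
qed

lemma lincomb_moments:
  shows "expectation (lincomb n c) = 0"
    and "integrable M (\<lambda>w. lincomb n c w ^ k)"
    and "expectation (\<lambda>w. lincomb n c w ^ 4) = 3 * (expectation (\<lambda>w. (lincomb n c w)\<^sup>2))\<^sup>2"
    and "expectation (\<lambda>w. (lincomb n c w)\<^sup>2) > 0 \<Longrightarrow> d \<ge> 0 \<Longrightarrow>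
      prob {w \<in> space M. \<bar>lincomb n c w\<bar> \<le> d} \<le> d / sqrt (expectation (\<lambda>w. (lincomb n c w)\<^sup>2))"
proof -
  show E: "expectation (lincomb n c) = 0"
    unfolding lincomb_def by (simp add: square_integrable_Y expectation_Y Bochner_Integration.integral_sum)
  obtain m v where "v \<ge> 0" "distr M borel (lincomb n c) = normal_measure m v"
    by (rule lincomb_normal)
  note mom = gaussian_moments[OF measurable_lincomb this(2,1) E]
  show "integrable M (\<lambda>w. lincomb n c w ^ k)" by (rule mom)
  show "expectation (\<lambda>w. lincomb n c w ^ 4) = 3 * (expectation (\<lambda>w. (lincomb n c w)\<^sup>2))\<^sup>2"
    by (simp add: mom)
  show "expectation (\<lambda>w. (lincomb n c w)\<^sup>2) > 0 \<Longrightarrow> d \<ge> 0 \<Longrightarrow>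
      prob {w \<in> space M. \<bar>lincomb n c w\<bar> \<le> d} \<le> d / sqrt (expectation (\<lambda>w. (lincomb n c w)\<^sup>2))"
    by (simp add: mom)
qed

lemma integrable_lincomb_products:
  "integrable M (\<lambda>w. lincomb n c w * lincomb n d w)"
  "integrable M (\<lambda>w. (lincomb n c w)\<^sup>2 * (lincomb n d w)\<^sup>2)"
proof -
  show "integrable M (\<lambda>w. lincomb n c w * lincomb n d w)"
    by (intro integrable_mult_of_squares lincomb_moments) auto
  have "integrable M (\<lambda>w. ((lincomb n c w)\<^sup>2)\<^sup>2)" for c
    using lincomb_moments(2)[of n c 4] by (simp add: power_mult[symmetric])
  then show "integrable M (\<lambda>w. (lincomb n c w)\<^sup>2 * (lincomb n d w)\<^sup>2)"
    by (intro integrable_mult_of_squares) auto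
qed

text \<open>Polarisation of the fourth moment.\<close>

lemma isserlis:
  "expectation (\<lambda>w. (lincomb n c w)\<^sup>2 * (lincomb n d w)\<^sup>2)
     = expectation (\<lambda>w. (lincomb n c w)\<^sup>2) * expectation (\<lambda>w. (lincomb n d w)\<^sup>2)
       + 2 * (expectation (\<lambda>w. lincomb n c w * lincomb n d w))\<^sup>2"
proof -
  let ?c = "lincomb n c" and ?d = "lincomb n d"
  define p where "p = lincomb n (\<lambda>i. c i + d i)"
  define m where "m = lincomb n (\<lambda>i. c i - d i)"
  have p: "p w = ?c w + ?d w" and m: "m w = ?c w - ?d w" for w
    by (simp_all add: p_def m_def lincomb_def sum.distrib sum_subtractf algebra_simps)
  have I: "integrable M (\<lambda>w. (lincomb n e w)\<^sup>2)" "integrable M (\<lambda>w. lincomb n e w ^ 4)" for e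
    by (rule lincomb_moments)+
  note I = I integrable_lincomb_products
  have p2: "expectation (\<lambda>w. (p w)\<^sup>2) = expectation (\<lambda>w. (?c w)\<^sup>2) + 2 * expectation (\<lambda>w. ?c w * ?d w)
      + expectation (\<lambda>w. (?d w)\<^sup>2)"
    using I by (simp add: p power2_sum mult.assoc)
  have m2: "expectation (\<lambda>w. (m w)\<^sup>2) = expectation (\<lambda>w. (?c w)\<^sup>2) - 2 * expectation (\<lambda>w. ?c w * ?d w)
      + expectation (\<lambda>w. (?d w)\<^sup>2)"
    using I by (simp add: m power2_diff mult.assoc)
  have "(\<lambda>w. p w ^ 4 + m w ^ 4) = (\<lambda>w. 2 * ?c w ^ 4 + 12 * ((?c w)\<^sup>2 * (?d w)\<^sup>2) + 2 * ?d w ^ 4)"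
    unfolding p m by (rule ext) (simp add: eval_nat_numeral algebra_simps)
  then have "expectation (\<lambda>w. p w ^ 4) + expectation (\<lambda>w. m w ^ 4)
     = 2 * expectation (\<lambda>w. ?c w ^ 4) + 12 * expectation (\<lambda>w. (?c w)\<^sup>2 * (?d w)\<^sup>2)
       + 2 * expectation (\<lambda>w. ?d w ^ 4)"
    (is "?l = ?r")
  proof -
    have "?l = expectation (\<lambda>w. p w ^ 4 + m w ^ 4)" using I by (simp add: p_def m_def)
    moreover have "?r = expectation (\<lambda>w. 2 * ?c w ^ 4 + 12 * ((?c w)\<^sup>2 * (?d w)\<^sup>2) + 2 * ?d w ^ 4)"
      using I by simp
    ultimately show ?thesis using \<open>(\<lambda>w. p w ^ 4 + m w ^ 4) = _\<close> by simp
  qed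
  moreover have "expectation (\<lambda>w. p w ^ 4) = 3 * (expectation (\<lambda>w. (p w)\<^sup>2))\<^sup>2"
    "expectation (\<lambda>w. m w ^ 4) = 3 * (expectation (\<lambda>w. (m w)\<^sup>2))\<^sup>2"
    unfolding p_def m_def by (rule lincomb_moments)+
  ultimately show ?thesis
    unfolding p2 m2 lincomb_moments(3) by (simp add: power2_eq_square algebra_simps)
qed

text \<open>The estimator is a multiple of the sum of the squared standardized innovations
  \<open>(e i)\<^sup>2 / d i\<close>. The innovations are pairwise uncorrelated, so by
  \<open>isserlis\<close> their centred squares \<open>f i\<close> are pairwise orthogonal with
  second moment \<open>2 * s2\<^sup>2\<close>, and only the \<open>n\<close> diagonal terms of the
  double sum survive.\<close>

lemma variance_theta_tilde:
  assumes n: "n \<ge> 2"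
  shows "integrable M (\<lambda>w. (theta_tilde n (Y n w) a - s2 * a)\<^sup>2)"
    and "expectation (\<lambda>w. (theta_tilde n (Y n w) a - s2 * a)\<^sup>2) = 2 * (s2 * a)\<^sup>2 / real n"
proof -
  define b where "b = exp (- a / real n)"
  have b0: "0 < b" by (simp add: b_def)
  have b1: "b < 1" using n a by (simp add: b_def)
  have c0: "1 - b\<^sup>2 > 0" using b0 b1 by (simp add: power_less_one_iff abs_square_less_1)
  define d where "d i = (if i = 0 then 1 else 1 - b\<^sup>2)" for i :: nat
  have d0: "d i > 0" for i using c0 by (simp add: d_def)
  \<comment> \<open>For \<open>i = 0\<close> the entry \<open>- b\<close> sits at index 0, outside
    the range of summation of \<open>lincomb\<close>, so that \<open>e 0\<close> is the first
    observation itself.\<close>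
  define c where "c i k = (if k = Suc i then 1 else 0) + (if k = i then - b else 0)" for i k :: nat
  define e where "e i = lincomb n (c i)" for i
  have e: "e i w = Y n w (Suc i) - (if i = 0 then 0 else b * Y n w i)" if "i < n" for i w
    using that
    by (simp add: e_def lincomb_def c_def distrib_right sum.distrib if_distrib[of "\<lambda>x. x * _"] sum.delta cong: if_cong)
  have EY: "expectation (\<lambda>w. Y n w i * Y n w j) = s2 * b ^ (j - i)" if "i \<le> j" "j \<le> n" for i j
  proof -
    have "b ^ (j - i) = exp (real (j - i) * (- a / real n))" by (simp only: b_def exp_of_nat_mult)
    then show ?thesis using that by (simp add: expectation_Y of_nat_diff)
  qed
  have IY: "integrable M (\<lambda>w. Y n w i * Y n w j)" if "1 \<le> i" "i \<le> n" "1 \<le> j" "j \<le> n" for i j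
    using that by (intro integrable_mult_of_squares square_integrable_Y) auto
  have orth: "expectation (\<lambda>w. e i w * e j w) = 0" if "i < j" "j < n" for i j
  proof -
    let ?z = "if i = 0 then 0 else 1 :: real"
    have "e i w * e j w = Y n w (Suc i) * Y n w (Suc j) - b * (Y n w (Suc i) * Y n w j)
        - ?z * b * (Y n w i * Y n w (Suc j)) + ?z * b\<^sup>2 * (Y n w i * Y n w j)" for w
      using that by (simp add: e algebra_simps power2_eq_square)
    then have "expectation (\<lambda>w. e i w * e j w) = expectation (\<lambda>w. Y n w (Suc i) * Y n w (Suc j) - b * (Y n w (Suc i) * Y n w j)
        - ?z * b * (Y n w i * Y n w (Suc j)) + ?z * b\<^sup>2 * (Y n w i * Y n w j))" by simp
    also have "\<dots> = expectation (\<lambda>w. Y n w (Suc i) * Y n w (Suc j)) - b * expectation (\<lambda>w. Y n w (Suc i) * Y n w j)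
        - ?z * b * expectation (\<lambda>w. Y n w i * Y n w (Suc j)) + ?z * b\<^sup>2 * expectation (\<lambda>w. Y n w i * Y n w j)"
      using that IY by (cases "i = 0") auto
    \<comment> \<open>The covariance is geometric in the lag: multiplying the covariance of an
      earlier observation with \<open>Y n w j\<close> by \<open>b\<close> gives that with
      \<open>Y n w (Suc j)\<close>. Hence \<open>e j\<close> is uncorrelated with everything before
      it.\<close>
    also have "\<dots> = 0"
    proof -
      from less_imp_Suc_add[OF that(1)] obtain k where k: "j = Suc (i + k)" by auto
      show ?thesis using that unfolding k by (simp add: EY power2_eq_square algebra_simps)
    qed
    finally show ?thesis .
  qed
  have var: "expectation (\<lambda>w. (e i w)\<^sup>2) = s2 * d i" if "i < n" for i
  proof (cases "i = 0")
    case True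
    then show ?thesis using that EY[of 1 1] by (simp add: e d_def power2_eq_square)
  next
    case False
    have "expectation (\<lambda>w. (e i w)\<^sup>2) = expectation (\<lambda>w. Y n w (Suc i) * Y n w (Suc i) - 2 * b * (Y n w i * Y n w (Suc i))
        + b\<^sup>2 * (Y n w i * Y n w i))"
      using that False by (intro Bochner_Integration.integral_cong) (auto simp: e power2_eq_square algebra_simps)
    also have "\<dots> = expectation (\<lambda>w. Y n w (Suc i) * Y n w (Suc i)) - 2 * b * expectation (\<lambda>w. Y n w i * Y n w (Suc i))
        + b\<^sup>2 * expectation (\<lambda>w. Y n w i * Y n w i)"
      using that False IY by simp
    also have "\<dots> = s2 * d i"
      using that False by (simp add: EY d_def power2_eq_square algebra_simps)
    finally show ?thesis .
  qed
  have ip: "expectation (\<lambda>w. e i w * e j w) = (if i = j then s2 * d i else 0)" if "i < n" "j < n" for i j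
    using that orth[of i j] orth[of j i] var[of i]
    by (cases i j rule: linorder_cases) (auto simp: power2_eq_square mult.commute)
  define f where "f i w = (e i w)\<^sup>2 / d i - s2" for i w
  have I2: "integrable M (\<lambda>w. (e i w)\<^sup>2)" for i unfolding e_def by (rule lincomb_moments)
  have I4: "integrable M (\<lambda>w. (e i w)\<^sup>2 * (e j w)\<^sup>2)" for i j
    unfolding e_def by (rule integrable_lincomb_products)
  have fexp: "f i w * f j w = (e i w)\<^sup>2 * (e j w)\<^sup>2 / (d i * d j) - s2 * (e i w)\<^sup>2 / d i
      - s2 * (e j w)\<^sup>2 / d j + s2\<^sup>2" for i j w
    using d0[of i] d0[of j] by (simp add: f_def field_simps power2_eq_square)
  have ff: "integrable M (\<lambda>w. f i w * f j w)" for i j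
    unfolding fexp using I2 I4 by simp
  have Eff: "expectation (\<lambda>w. f i w * f j w) = (if i = j then 2 * s2\<^sup>2 else 0)" if "i < n" "j < n" for i j
  proof -
    have "expectation (\<lambda>w. f i w * f j w)
        = expectation (\<lambda>w. (e i w)\<^sup>2 * (e j w)\<^sup>2) / (d i * d j) - s2 * expectation (\<lambda>w. (e i w)\<^sup>2) / d i
          - s2 * expectation (\<lambda>w. (e j w)\<^sup>2) / d j + s2\<^sup>2"
      unfolding fexp using I2 I4 by (simp add: prob_space)
    also have "expectation (\<lambda>w. (e i w)\<^sup>2 * (e j w)\<^sup>2)
        = expectation (\<lambda>w. (e i w)\<^sup>2) * expectation (\<lambda>w. (e j w)\<^sup>2) + 2 * (expectation (\<lambda>w. e i w * e j w))\<^sup>2"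
      unfolding e_def by (rule isserlis)
    finally have "expectation (\<lambda>w. f i w * f j w)
        = (s2 * d i * (s2 * d j) + 2 * (if i = j then s2 * d i else 0)\<^sup>2) / (d i * d j)
          - s2 * (s2 * d i) / d i - s2 * (s2 * d j) / d j + s2\<^sup>2"
      unfolding var[OF that(1)] var[OF that(2)] ip[OF that] .
    then show ?thesis
      using d0[of i] d0[of j] by (auto simp: field_simps power2_eq_square)
  qed
  have th: "theta_tilde n (Y n w) a - s2 * a = a / real n * (\<Sum>i<n. f i w)" for w
  proof -
    have "quad_form n (Y n w) a = (\<Sum>i<n. (e i w)\<^sup>2 / d i)"
      unfolding det_corr_mat_and_quad_form(2)[OF n a, folded b_def]
      by (intro sum.cong) (auto simp: e d_def)
    then show ?thesis
      using n by (simp add: theta_tilde_def f_def sum_subtractf field_simps)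
  qed
  have th2: "(theta_tilde n (Y n w) a - s2 * a)\<^sup>2 = (a / real n)\<^sup>2 * (\<Sum>i<n. \<Sum>j<n. f i w * f j w)" for w
    unfolding th power_mult_distrib by (simp add: power2_eq_square sum_product)
  show "integrable M (\<lambda>w. (theta_tilde n (Y n w) a - s2 * a)\<^sup>2)"
    unfolding th2 using ff by simp
  have "expectation (\<lambda>w. (theta_tilde n (Y n w) a - s2 * a)\<^sup>2)
      = (a / real n)\<^sup>2 * (\<Sum>i<n. \<Sum>j<n. if i = j then 2 * s2\<^sup>2 else 0)"
    unfolding th2 using ff by (simp add: Eff)
  also have "\<dots> = 2 * (s2 * a)\<^sup>2 / real n"
    using n by (simp add: sum.delta power2_eq_square field_simps)
  finally show "expectation (\<lambda>w. (theta_tilde n (Y n w) a - s2 * a)\<^sup>2) = 2 * (s2 * a)\<^sup>2 / real n" .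
qed

text \<open>The Gaussian variable is the sum of the inner observations over \<open>n\<close>. All
  covariances are at least \<open>s2 * exp (- a)\<close>, since grid distances are at most 1, and
  \<open>n - 2\<close> is at least half of \<open>n\<close>. So the variance is at least a quarter
  of \<open>s2 * exp (- a)\<close>, which accounts for the 2 in the bound.\<close>

lemma small_ball_A1:
  assumes n: "n \<ge> 4" and d: "d \<ge> 0"
  shows "prob {w \<in> space M. stat_A1 n (Y n w) / real n \<le> d\<^sup>2} \<le> d * (2 / sqrt (s2 * exp (- a)))"
proof -
  define c where "c i = (if i \<in> {2..n - 1} then 1 / real n else 0)" for i
  have Z: "lincomb n c w = (\<Sum>i=2..n - 1. Y n w i) / real n" for w
  proof -
    have "lincomb n c w = (\<Sum>i=2..n - 1. c i * Y n w i)"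
      unfolding lincomb_def by (rule sum.mono_neutral_right) (auto simp: c_def)
    also have "\<dots> = (\<Sum>i=2..n - 1. Y n w i / real n)" by (intro sum.cong) (auto simp: c_def)
    finally show ?thesis by (simp add: sum_divide_distrib)
  qed
  have le: "(lincomb n c w)\<^sup>2 \<le> stat_A1 n (Y n w) / real n" for w
  proof -
    have "(\<Sum>i=2..n - 1. Y n w i)\<^sup>2 \<le> real (card {2..n - 1}) * stat_A1 n (Y n w)"
      using Cauchy_Schwarz_ineq_sum[of "\<lambda>_. 1" "Y n w" "{2..n - 1}"] by (simp add: stat_A1_def)
    also have "\<dots> \<le> real n * stat_A1 n (Y n w)"
      by (intro mult_right_mono) (auto simp: stat_A1_def intro!: sum_nonneg)
    finally show ?thesis using n unfolding Z by (simp add: power_divide divide_simps power2_eq_square mult_ac)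
  qed
  define V where "V = expectation (\<lambda>w. (lincomb n c w)\<^sup>2)"
  have V: "V \<ge> s2 * exp (- a) / 4"
  proof -
    have "V = expectation (\<lambda>w. (\<Sum>i=2..n - 1. \<Sum>j=2..n - 1. Y n w i * Y n w j) / (real n)\<^sup>2)"
      unfolding V_def Z power_divide by (simp add: power2_eq_square sum_product)
    also have "\<dots> = (\<Sum>i=2..n - 1. \<Sum>j=2..n - 1. expectation (\<lambda>w. Y n w i * Y n w j)) / (real n)\<^sup>2"
    proof -
      have I: "integrable M (\<lambda>w. Y n w i * Y n w j)" if "i \<in> {2..n - 1}" "j \<in> {2..n - 1}" for i j
        using that by (intro integrable_mult_of_squares square_integrable_Y) auto
      show ?thesis
        unfolding integral_divide_zero
        by (subst Bochner_Integration.integral_sum, rule Bochner_Integration.integrable_sum, rule I, assumption+,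
            intro arg_cong2[where f = "(/)"] sum.cong refl, subst Bochner_Integration.integral_sum)
           (auto intro!: I)
    qed
    also have "\<dots> \<ge> (\<Sum>i=2..n - 1. \<Sum>j=2..n - 1. s2 * exp (- a)) / (real n)\<^sup>2"
    proof (intro divide_right_mono sum_mono)
      fix i j assume ij: "i \<in> {2..n - 1}" "j \<in> {2..n - 1}"
      have "real i \<le> real n" "real j \<le> real n" using ij by auto
      then have "\<bar>real i - real j\<bar> \<le> real n" by linarith
      then have "a * \<bar>real i - real j\<bar> / real n \<le> a * 1"
        using ij a by (simp add: divide_le_eq)
      then have "exp (- a) \<le> exp (- a * \<bar>real i - real j\<bar> / real n)" by simp
      then show "s2 * exp (- a) \<le> expectation (\<lambda>w. Y n w i * Y n w j)"
        using ij s2 by (subst expectation_Y) auto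
    qed simp
    also have "(\<Sum>i=2..n - 1. \<Sum>j=2..n - 1. s2 * exp (- a)) = (real n - 2)\<^sup>2 * (s2 * exp (- a))"
      using n by (simp add: of_nat_diff power2_eq_square)
    finally have "V \<ge> (real n - 2)\<^sup>2 * (s2 * exp (- a)) / (real n)\<^sup>2" .
    moreover have "(real n - 2)\<^sup>2 * (s2 * exp (- a)) / (real n)\<^sup>2 \<ge> s2 * exp (- a) / 4"
    proof -
      have "(1 / 2)\<^sup>2 \<le> ((real n - 2) / real n)\<^sup>2"
        using n by (intro power_mono) (auto simp: field_simps)
      from mult_left_mono[OF this, of "s2 * exp (- a)"] s2 show ?thesis
        by (simp add: power_divide mult_ac)
    qed
    ultimately show ?thesis by (rule order_trans[rotated])
  qed
  have pos: "s2 * exp (- a) > 0" using s2 by simp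
  then have V0: "V > 0" using V by linarith
  have "prob {w \<in> space M. stat_A1 n (Y n w) / real n \<le> d\<^sup>2} \<le> prob {w \<in> space M. \<bar>lincomb n c w\<bar> \<le> d}"
  proof (rule finite_measure_mono, safe)
    fix w assume "stat_A1 n (Y n w) / real n \<le> d\<^sup>2"
    then have "(lincomb n c w)\<^sup>2 \<le> d\<^sup>2" using le[of w] by linarith
    then show "\<bar>lincomb n c w\<bar> \<le> d" using d by (simp add: power2_le_iff_abs_le)
  qed simp
  also have "\<dots> \<le> d / sqrt V"
    using lincomb_moments(4)[of n c d] V0 d by (simp add: V_def)
  also have "\<dots> \<le> d / sqrt (s2 * exp (- a) / 4)"
    using d V pos by (intro divide_left_mono real_sqrt_le_mono mult_pos_pos) (auto simp: V0)
  also have "\<dots> = d * (2 / sqrt (s2 * exp (- a)))"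
    by (simp add: real_sqrt_divide)
  finally show ?thesis .
qed

end

section \<open>Stochastic bounds for the sample statistics\<close>

lemma outer_measure_of_subadditive:
  assumes A: "A \<subseteq> space M" and B: "B \<subseteq> space M"
  shows "outer_measure_of M (A \<union> B) \<le> outer_measure_of M A + outer_measure_of M B"
proof -
  obtain A' where A': "A' \<in> sets M" "A \<subseteq> A'" "outer_measure_of M A = emeasure M A'"
    using outer_measure_of_attain[OF A] by auto
  obtain B' where B': "B' \<in> sets M" "B \<subseteq> B'" "outer_measure_of M B = emeasure M B'"
    using outer_measure_of_attain[OF B] by auto
  have "outer_measure_of M (A \<union> B) \<le> outer_measure_of M (A' \<union> B')"
    using A' B' by (intro outer_measure_of_mono) auto
  also have "\<dots> \<le> emeasure M A' + emeasure M B'"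
    using A' B' by (simp add: emeasure_subadditive)
  finally show ?thesis using A' B' by simp
qed

lemma bounded_in_prob_abs_add:
  assumes "bounded_in_prob M Z" "bounded_in_prob M Z'"
  shows "bounded_in_prob M (\<lambda>n w. \<bar>Z n w\<bar> + \<bar>Z' n w\<bar>)"
  unfolding bounded_in_prob_def
proof (intro allI impI)
  fix e :: real assume "e > 0"
  then have e2: "e / 2 > 0" by simp
  obtain K where K: "\<forall>\<^sub>F n in sequentially. outer_measure_of M {w \<in> space M. \<bar>Z n w\<bar> > K} < ennreal (e / 2)"
    using assms(1) e2 unfolding bounded_in_prob_def by blast
  obtain K' where K': "\<forall>\<^sub>F n in sequentially. outer_measure_of M {w \<in> space M. \<bar>Z' n w\<bar> > K'} < ennreal (e / 2)"
    using assms(2) e2 unfolding bounded_in_prob_def by blast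
  have "\<forall>\<^sub>F n in sequentially. outer_measure_of M {w \<in> space M. \<bar>\<bar>Z n w\<bar> + \<bar>Z' n w\<bar>\<bar> > K + K'} < ennreal e"
    using K K'
  proof eventually_elim
    case (elim n)
    have "outer_measure_of M {w \<in> space M. \<bar>\<bar>Z n w\<bar> + \<bar>Z' n w\<bar>\<bar> > K + K'}
        \<le> outer_measure_of M ({w \<in> space M. \<bar>Z n w\<bar> > K} \<union> {w \<in> space M. \<bar>Z' n w\<bar> > K'})"
      by (intro outer_measure_of_mono) force
    also have "\<dots> \<le> outer_measure_of M {w \<in> space M. \<bar>Z n w\<bar> > K} + outer_measure_of M {w \<in> space M. \<bar>Z' n w\<bar> > K'}"
      by (intro outer_measure_of_subadditive) auto
    also have "\<dots> < ennreal (e / 2) + ennreal (e / 2)"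
      using elim by (rule add_strict_mono)
    also have "\<dots> = ennreal e" using \<open>e > 0\<close> by (simp add: ennreal_plus[symmetric] del: ennreal_plus)
    finally show ?case .
  qed
  then show "\<exists>K. \<forall>\<^sub>F n in sequentially. outer_measure_of M {w \<in> space M. \<bar>\<bar>Z n w\<bar> + \<bar>Z' n w\<bar>\<bar> > K} < ennreal e" ..
qed

lemma bounded_in_prob_of_expectation:
  assumes "\<forall>\<^sub>F n in sequentially. integrable M (Z n) \<and> (\<forall>w. 0 \<le> Z n w) \<and> (\<integral>w. Z n w \<partial>M) \<le> C"
  shows "bounded_in_prob M Z"
  unfolding bounded_in_prob_def
proof (intro allI impI)
  fix e :: real assume "e > 0"
  \<comment> \<open>Doubling and adding 1 gives \<open>K > 0\<close> and a strict inequality even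
    for \<open>C = 0\<close>.\<close>
  define K where "K = (2 * \<bar>C\<bar> + 1) / e"
  have "K > 0" using \<open>e > 0\<close> by (simp add: K_def add_nonneg_pos)
  have "\<forall>\<^sub>F n in sequentially. outer_measure_of M {w \<in> space M. \<bar>Z n w\<bar> > K} < ennreal e"
    using assms
  proof eventually_elim
    case (elim n)
    then have [measurable]: "Z n \<in> borel_measurable M" by auto
    have "outer_measure_of M {w \<in> space M. \<bar>Z n w\<bar> > K} \<le> outer_measure_of M {w \<in> space M. Z n w \<ge> K}"
      using elim by (intro outer_measure_of_mono) (auto simp: abs_of_nonneg)
    also have "\<dots> = emeasure M {w \<in> space M. Z n w \<ge> K}" by simp
    also have "\<dots> \<le> ennreal (1 / K * (\<integral>w. Z n w \<partial>M))"
      using elim \<open>K > 0\<close> by (intro integral_Markov_inequality) auto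
    also have "\<dots> < ennreal e"
    proof (rule ennreal_lessI[OF \<open>e > 0\<close>])
      have "1 / K * (\<integral>w. Z n w \<partial>M) \<le> 1 / K * \<bar>C\<bar>"
        using elim \<open>K > 0\<close> by (intro mult_left_mono) auto
      also have "\<dots> = e * (\<bar>C\<bar> / (2 * \<bar>C\<bar> + 1))" using \<open>e > 0\<close> by (simp add: K_def)
      also have "\<dots> < e * 1"
        using \<open>e > 0\<close> by (intro mult_strict_left_mono) (auto simp: divide_less_eq)
      finally show "1 / K * (\<integral>w. Z n w \<partial>M) < e" by simp
    qed
    finally show ?case .
  qed
  then show "\<exists>K. \<forall>\<^sub>F n in sequentially. outer_measure_of M {w \<in> space M. \<bar>Z n w\<bar> > K} < ennreal e" ..
qed

text \<open>Both rest on \<open>A3 = (y 1)\<^sup>2 + A1 + (y n)\<^sup>2\<close>. The second is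
  arranged in powers of \<open>1 - b\<close>, which is of order \<open>1 / n\<close>: with
  \<open>A1\<close> of order \<open>n\<close>, the terms beside \<open>D * b\<close> are of order
  \<open>1 / n\<close>.\<close>

lemma stat_identities:
  fixes y :: "nat \<Rightarrow> real"
  assumes "n \<ge> 2"
  defines "D \<equiv> stat_A1 n y - 2 * stat_A2 n y + stat_A3 n y"
  shows "2 * (stat_A1 n y - stat_A2 n y) = D - (y 1)\<^sup>2 - (y n)\<^sup>2"
    and "stat_A1 n y * b\<^sup>2 - 2 * stat_A2 n y * b + stat_A3 n y
       = D * b + ((y 1)\<^sup>2 + (y n)\<^sup>2) * (1 - b) + stat_A1 n y * (1 - b)\<^sup>2"
proof -
  have "stat_A3 n y = (y 1)\<^sup>2 + stat_A1 n y + (y n)\<^sup>2"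
  proof -
    obtain k where k: "n = Suc (Suc k)" using assms(1) by (metis add_2_eq_Suc le_Suc_ex)
    have "stat_A3 n y = (y 1)\<^sup>2 + (\<Sum>i=2..n. (y i)\<^sup>2)"
      unfolding stat_A3_def using assms(1) by (subst sum.atLeast_Suc_atMost) (auto simp: numeral_2_eq_2)
    also have "(\<Sum>i=2..n. (y i)\<^sup>2) = stat_A1 n y + (y n)\<^sup>2"
      unfolding stat_A1_def k by (simp add: numeral_2_eq_2)
    finally show ?thesis by simp
  qed
  then show eq: "2 * (stat_A1 n y - stat_A2 n y) = D - (y 1)\<^sup>2 - (y n)\<^sup>2"
    by (simp add: D_def)
  have "stat_A1 n y * b\<^sup>2 - 2 * stat_A2 n y * b + stat_A3 n y
     = D - 2 * (stat_A1 n y - stat_A2 n y) * (1 - b) + stat_A1 n y * (1 - b)\<^sup>2"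
    by (simp add: D_def power2_eq_square algebra_simps)
  then show "stat_A1 n y * b\<^sup>2 - 2 * stat_A2 n y * b + stat_A3 n y
       = D * b + ((y 1)\<^sup>2 + (y n)\<^sup>2) * (1 - b) + stat_A1 n y * (1 - b)\<^sup>2"
    unfolding eq by (simp add: algebra_simps)
qed

context ou_sample begin

text \<open>The maximum with \<open>1\<close> in the last term excludes the junk value \<open>n / 0 = 0\<close>: boundedness of
  the term forces \<open>A\<^sub>1 / n\<close> away from \<open>0\<close>.\<close>

definition control :: "nat \<Rightarrow> 'w \<Rightarrow> real" where
  "control n w = \<bar>(Y n w 1)\<^sup>2 + (Y n w n)\<^sup>2 + stat_A1 n (Y n w) / real n
       + real n * (theta_tilde n (Y n w) a - s2 * a)\<^sup>2\<bar> + \<bar>real n / max (stat_A1 n (Y n w)) 1\<bar>"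

lemma bounded_in_prob_control: "bounded_in_prob M control"
proof -
  let ?Z = "\<lambda>n w. (Y n w 1)\<^sup>2 + (Y n w n)\<^sup>2 + stat_A1 n (Y n w) / real n
       + real n * (theta_tilde n (Y n w) a - s2 * a)\<^sup>2"
  have "bounded_in_prob M ?Z"
  proof (rule bounded_in_prob_of_expectation)
    \<comment> \<open>One \<open>s2\<close> for each of the two end observations and one for the
      average; the rest is \<open>n\<close> times the variance of the estimator.\<close>
    have "integrable M (?Z n) \<and> expectation (?Z n) \<le> 3 * s2 + 2 * (s2 * a)\<^sup>2" if n: "n \<ge> 2" for n
    proof -
      have EY: "expectation (\<lambda>w. (Y n w i)\<^sup>2) = s2" if "i \<le> n" for i
        using expectation_Y(2)[OF that that] by (simp add: power2_eq_square)
      have I1: "integrable M (\<lambda>w. stat_A1 n (Y n w))"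
        unfolding stat_A1_def by (intro Bochner_Integration.integrable_sum square_integrable_Y) auto
      have "expectation (\<lambda>w. stat_A1 n (Y n w)) = (\<Sum>i=2..n - 1. expectation (\<lambda>w. (Y n w i)\<^sup>2))"
        unfolding stat_A1_def
        by (subst Bochner_Integration.integral_sum) (auto intro!: square_integrable_Y)
      also have "\<dots> = (\<Sum>i=2..n - 1. s2)" by (intro sum.cong EY) auto
      also have "\<dots> \<le> real n * s2" using n s2 by (simp add: of_nat_diff)
      finally have "expectation (\<lambda>w. stat_A1 n (Y n w)) / real n \<le> s2" using n by (simp add: field_simps)
      then show ?thesis
        using variance_theta_tilde[OF n] I1 n
        by (simp add: square_integrable_Y EY)
    qed
    moreover have "0 \<le> ?Z n w" for n w
      by (auto simp: stat_A1_def intro!: add_nonneg_nonneg divide_nonneg_nonneg sum_nonneg)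
    ultimately show "\<forall>\<^sub>F n in sequentially. integrable M (?Z n) \<and> (\<forall>w. 0 \<le> ?Z n w) \<and>
      expectation (?Z n) \<le> 3 * s2 + 2 * (s2 * a)\<^sup>2"
      unfolding eventually_sequentially by blast
  qed
  moreover have "bounded_in_prob M (\<lambda>n w. real n / max (stat_A1 n (Y n w)) 1)"
    unfolding bounded_in_prob_def
  proof (intro allI impI)
    fix e :: real assume "e > 0"
    define q where "q = 2 / sqrt (s2 * exp (- a))"
    have "q > 0" using s2 by (simp add: q_def)
    \<comment> \<open>Chosen so that the bound \<open>d * q\<close> of \<open>small_ball_A1\<close>
      equals \<open>e / 2\<close>.\<close>
    define d where "d = e / (2 * q)"
    have d: "d > 0" using \<open>e > 0\<close> \<open>q > 0\<close> by (simp add: d_def)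
    have "outer_measure_of M {w \<in> space M. \<bar>real n / max (stat_A1 n (Y n w)) 1\<bar> > 1 / d\<^sup>2} < ennreal e"
      if n: "n \<ge> 4" for n
    proof -
      have [measurable]: "(\<lambda>w. stat_A1 n (Y n w)) \<in> borel_measurable M"
        unfolding stat_A1_def by (intro borel_measurable_sum borel_measurable_power) auto
      have "stat_A1 n (Y n w) / real n \<le> d\<^sup>2" if "\<bar>real n / max (stat_A1 n (Y n w)) 1\<bar> > 1 / d\<^sup>2" for w
      proof -
        have "max (stat_A1 n (Y n w)) 1 / real n < d\<^sup>2"
          using that d n by (simp add: field_simps)
        moreover have "stat_A1 n (Y n w) / real n \<le> max (stat_A1 n (Y n w)) 1 / real n"
          by (intro divide_right_mono) auto
        ultimately show ?thesis by linarith
      qed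
      then have "outer_measure_of M {w \<in> space M. \<bar>real n / max (stat_A1 n (Y n w)) 1\<bar> > 1 / d\<^sup>2}
          \<le> outer_measure_of M {w \<in> space M. stat_A1 n (Y n w) / real n \<le> d\<^sup>2}"
        by (intro outer_measure_of_mono) auto
      also have "\<dots> = ennreal (prob {w \<in> space M. stat_A1 n (Y n w) / real n \<le> d\<^sup>2})"
        by (simp add: emeasure_eq_measure)
      also have "\<dots> \<le> ennreal (d * q)"
        using small_ball_A1[OF n, of d] d by (intro ennreal_leI) (simp add: q_def)
      also have "d * q = e / 2" using \<open>q > 0\<close> by (simp add: d_def)
      also have "ennreal (e / 2) < ennreal e" using \<open>e > 0\<close> by (intro ennreal_lessI) auto
      finally show ?thesis .
    qed
    then show "\<exists>K. \<forall>\<^sub>F n in sequentially.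
        outer_measure_of M {w \<in> space M. \<bar>real n / max (stat_A1 n (Y n w)) 1\<bar> > K} < ennreal e"
      unfolding eventually_sequentially by blast
  qed
  ultimately show ?thesis
    using bounded_in_prob_abs_add unfolding control_def by blast
qed

end

section \<open>Regular samples, to which all the randomness is confined\<close>

text \<open>For \<open>n \<ge> 2\<close> this is the sum of the squared increments
  \<open>y (i + 1) - y i\<close>: inner observations are counted in both \<open>A1\<close> and
  \<open>A3\<close>, the two end ones in \<open>A3\<close> only.\<close>

definition quad_var :: "nat \<Rightarrow> (nat \<Rightarrow> real) \<Rightarrow> real" where
  "quad_var n y = stat_A1 n y - 2 * stat_A2 n y + stat_A3 n y"

text \<open>Over the unit interval the process has quadratic variation \<open>2 * \<theta>\<close>.
  The last condition, at the rate \<open>n powr (- 1 / 2)\<close>, places the centre of the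
  likelihood well inside the window used in the Laplace approximation.\<close>

definition regular_sample :: "real \<Rightarrow> real \<Rightarrow> nat \<Rightarrow> (nat \<Rightarrow> real) \<Rightarrow> bool" where
  "regular_sample \<theta> K n y \<longleftrightarrow>
     \<bar>u_star n y\<bar> \<le> K \<and> 0 < v_star n y \<and> 1 / v_star n y \<le> K \<and> v_star n y \<le> K
     \<and> sqrt (real n) * \<bar>quad_var n y - 2 * \<theta>\<bar> \<le> K"

lemma one_minus_exp_bounds:
  fixes z :: real
  assumes "z \<ge> 0"
  shows "z - z\<^sup>2 / 2 \<le> 1 - exp (- z)" and "1 - exp (- z) \<le> z"
proof -
  show "1 - exp (- z) \<le> z" using exp_ge_add_one_self[of "- z"] by linarith
  have "1 - exp (- z) - (z - z\<^sup>2 / 2) \<ge> 1 - exp (- 0) - (0 - 0\<^sup>2 / 2 :: real)"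
  proof (rule DERIV_nonneg_imp_nondecreasing[OF assms])
    fix x :: real assume "0 \<le> x" "x \<le> z"
    have "((\<lambda>z. 1 - exp (- z) - (z - z\<^sup>2 / 2)) has_real_derivative exp (- x) - 1 + x) (at x)"
      by (auto intro!: derivative_eq_intros)
    moreover have "exp (- x) - 1 + x \<ge> 0" using exp_ge_add_one_self[of "- x"] by linarith
    ultimately show "\<exists>y. ((\<lambda>z. 1 - exp (- z) - (z - z\<^sup>2 / 2)) has_real_derivative y) (at x) \<and> 0 \<le> y"
      by blast
  qed
  then show "z - z\<^sup>2 / 2 \<le> 1 - exp (- z)" by simp
qed

text \<open>The explicit form of \<open>theta_tilde\<close> is solved for the quadratic variation
  \<open>D\<close>. Since \<open>theta_tilde\<close> is within order \<open>n powr (- 1 / 2)\<close>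
  of \<theta> and the corrections are of order \<open>1 / n\<close>, \<open>D\<close> is close to
  \<open>2 * \<theta>\<close>. With \<open>S = A1 / n\<close> and \<open>c\<close> the sum of the
  squared end observations, \<open>v_star = D / S\<close> and
  \<open>u_star = (D - c) / (2 * S)\<close>, so bounds on \<open>D\<close>, \<open>c\<close>,
  \<open>S\<close> and \<open>1 / S\<close> suffice.\<close>

lemma eventually_regular_sample:
  fixes a s2 K :: real
  assumes a: "a > 0" and s2: "s2 > 0"
  shows "\<exists>K'>0. \<forall>\<^sub>F n in sequentially. \<forall>y :: nat \<Rightarrow> real.
     (y 1)\<^sup>2 + (y n)\<^sup>2 + stat_A1 n y / real n + real n * (theta_tilde n y a - s2 * a)\<^sup>2 \<le> K \<and>
     real n / max (stat_A1 n y) 1 \<le> K \<longrightarrow> regular_sample (s2 * a) K' n y"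
proof -
  define \<theta> where "\<theta> = s2 * a"
  have th: "\<theta> > 0" using a s2 by (simp add: \<theta>_def)
  define L where "L = \<bar>K\<bar> + 1"
  have L: "L \<ge> 1" "K \<le> L" by (auto simp: L_def)
  \<comment> \<open>Gathers the terms of the estimate of
    \<open>r * \<bar>D - 2 * \<theta>\<bar>\<close> below, after \<open>r * z \<le> a\<close> and
    \<open>r * \<bar>t - \<theta>\<bar> \<le> L\<close>; the outer 2 pays for dividing by
    \<open>b \<ge> 1 / 2\<close>. The further terms of \<open>K'\<close> bound
    \<open>1 / v_star\<close>, \<open>v_star\<close> and \<open>u_star\<close>, in this
    order.\<close>
  define K1 where "K1 = 2 * (2 * (\<theta> + L) * a + 2 * L + L * a + L * a\<^sup>2 + 2 * \<theta> * a)"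
  have K1: "K1 \<ge> 0" using th a L by (simp add: K1_def)
  define K' where "K' = K1 + L / \<theta> + 3 * \<theta> * L + (3 * \<theta> + L) * L"
  have "K' > 0" using th a L K1 by (simp add: K'_def add_nonneg_pos)
  have "regular_sample \<theta> K' n y"
    if n: "n \<ge> 2" "real n > L" "real n \<ge> 2 * a" "sqrt (real n) * \<theta> \<ge> K1"
      and y1: "(y 1)\<^sup>2 + (y n)\<^sup>2 + stat_A1 n y / real n + real n * (theta_tilde n y a - \<theta>)\<^sup>2 \<le> K"
      and y2: "real n / max (stat_A1 n y) 1 \<le> K" for n and y :: "nat \<Rightarrow> real"
  proof -
    define c where "c = (y 1)\<^sup>2 + (y n)\<^sup>2"
    define S where "S = stat_A1 n y / real n"
    define t where "t = theta_tilde n y a"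
    define D where "D = quad_var n y"
    define z where "z = a / real n"
    define b where "b = exp (- z)"
    have npos: "real n > 0" using n by simp
    have A1S: "stat_A1 n y = real n * S" using npos by (simp add: S_def)
    have S0: "S \<ge> 0" by (simp add: S_def stat_A1_def sum_nonneg)
    have c0: "c \<ge> 0" by (simp add: c_def)
    have bounds: "c \<le> L" "S \<le> L" "real n * (t - \<theta>)\<^sup>2 \<le> L"
    proof -
      have "real n * (t - \<theta>)\<^sup>2 \<ge> 0" by simp
      then show "c \<le> L" "S \<le> L" "real n * (t - \<theta>)\<^sup>2 \<le> L"
        using y1 S0 c0 L unfolding c_def[symmetric] S_def[symmetric] t_def[symmetric] by linarith+
    qed
    have Sl: "S \<ge> 1 / L"
    proof -
      have "real n / max (stat_A1 n y) 1 \<le> L" using y2 L by linarith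
      then have "real n \<le> L * max (stat_A1 n y) 1" by (simp add: divide_le_eq)
      \<comment> \<open>Otherwise the maximum would be 1 and the controlled quotient would be
        \<open>n\<close> itself, against \<open>n > L\<close>.\<close>
      moreover have "stat_A1 n y \<ge> 1"
      proof (rule ccontr)
        assume "\<not> stat_A1 n y \<ge> 1"
        then have "max (stat_A1 n y) 1 = 1" by simp
        with \<open>real n \<le> L * max (stat_A1 n y) 1\<close> n show False by simp
      qed
      ultimately have "real n \<le> L * stat_A1 n y" by simp
      then show ?thesis using npos L by (simp add: A1S divide_le_eq mult.commute mult.left_commute)
    qed
    have Spos: "S > 0" using Sl L by (smt (verit) divide_pos_pos)
    have z: "0 < z" "z \<le> 1 / 2" using a npos n by (auto simp: z_def field_simps)
    have b: "1 - b \<le> z" "b \<ge> 1 / 2" "b < 1" "b > 0"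
      using one_minus_exp_bounds[of z] z by (auto simp: b_def)
    have b2: "b\<^sup>2 = exp (- (2 * z))" by (simp add: b_def exp_double[symmetric])
    have b2b: "1 - b\<^sup>2 \<le> 2 * z" "1 - b\<^sup>2 \<ge> 2 * z - 2 * z\<^sup>2"
      using one_minus_exp_bounds[of "2 * z"] z by (auto simp: b2 power_mult_distrib)
    have b2p: "1 - b\<^sup>2 > 0" using z by (simp add: b2)
    have "t = z * ((D * b + c * (1 - b) + stat_A1 n y * (1 - b)\<^sup>2) / (1 - b\<^sup>2))"
      using det_corr_mat_and_quad_form(3)[OF n(1) a, of y] stat_identities(2)[OF n(1), of y b]
      by (simp add: t_def theta_tilde_def z_def b_def c_def D_def quad_var_def)
    then have Db: "D * b = t * ((1 - b\<^sup>2) / z) - c * (1 - b) - stat_A1 n y * (1 - b)\<^sup>2"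
      using z b2p by (simp add: field_simps)
    define r where "r = sqrt (real n)"
    have r: "r \<ge> 1" "r * r = real n" using n by (auto simp: r_def)
    have tth: "r * \<bar>t - \<theta>\<bar> \<le> L"
    proof -
      have "(r * \<bar>t - \<theta>\<bar>)\<^sup>2 \<le> L" using bounds(3) r(2) by (simp add: power_mult_distrib power2_eq_square[of r])
      also have "L \<le> L\<^sup>2" using L by (simp add: power2_eq_square)
      finally show ?thesis using L by (simp add: power2_le_iff_abs_le)
    qed
    have tle: "\<bar>t - \<theta>\<bar> \<le> L" using tth r mult_right_mono[of 1 r "\<bar>t - \<theta>\<bar>"] by simp
    have rz: "r * z \<le> a"
    proof -
      have "r * z = a / r" using r npos by (simp add: z_def field_simps)
      also have "\<dots> \<le> a / 1" using a r by (intro divide_left_mono) auto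
      finally show ?thesis by simp
    qed
    have e1: "\<bar>t * ((1 - b\<^sup>2) / z) - 2 * \<theta>\<bar> \<le> (\<theta> + L) * (2 * z) + 2 * \<bar>t - \<theta>\<bar>"
    proof -
      have "\<bar>(1 - b\<^sup>2) / z - 2\<bar> \<le> 2 * z"
        using b2b z by (auto simp: abs_le_iff field_simps power2_eq_square)
      then have "\<bar>t * ((1 - b\<^sup>2) / z - 2)\<bar> \<le> (\<theta> + L) * (2 * z)"
        unfolding abs_mult using tle th by (intro mult_mono) auto
      moreover have "t * ((1 - b\<^sup>2) / z) - 2 * \<theta> = t * ((1 - b\<^sup>2) / z - 2) + 2 * (t - \<theta>)"
        by (simp only: right_diff_distrib)
      moreover have "\<bar>2 * (t - \<theta>)\<bar> = 2 * \<bar>t - \<theta>\<bar>" by (subst abs_mult) simp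
      ultimately show ?thesis
        using abs_triangle_ineq[of "t * ((1 - b\<^sup>2) / z - 2)" "2 * (t - \<theta>)"] by simp
    qed
    have e2: "c * (1 - b) \<le> L * z" "c * (1 - b) \<ge> 0"
      using bounds c0 b by (auto intro!: mult_mono)
    have e3: "stat_A1 n y * (1 - b)\<^sup>2 \<le> L * a * z" "stat_A1 n y * (1 - b)\<^sup>2 \<ge> 0"
    proof -
      have "stat_A1 n y * (1 - b)\<^sup>2 \<le> (real n * L) * z\<^sup>2"
        using bounds S0 b npos by (auto simp: A1S intro!: mult_mono power_mono)
      also have "\<dots> = L * a * z" using npos by (simp add: z_def power2_eq_square)
      finally show "stat_A1 n y * (1 - b)\<^sup>2 \<le> L * a * z" .
    qed (use S0 npos A1S in simp)
    have "\<bar>D - 2 * \<theta>\<bar> * b \<le> (\<theta> + L) * (2 * z) + 2 * \<bar>t - \<theta>\<bar> + L * z + L * a * z + 2 * \<theta> * z"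
    proof -
      have "\<bar>D - 2 * \<theta>\<bar> * b = \<bar>D * b - 2 * \<theta> * b\<bar>" using b by (simp add: abs_mult left_diff_distrib[symmetric])
      moreover have "2 * \<theta> * (1 - b) \<le> 2 * \<theta> * z" "2 * \<theta> * (1 - b) \<ge> 0"
        using b th by (auto intro!: mult_left_mono)
      moreover have "2 * \<theta> * b = 2 * \<theta> - 2 * \<theta> * (1 - b)" by (simp add: algebra_simps)
      ultimately show ?thesis using Db e1 e2 e3 by (simp add: abs_le_iff) 
    qed
    moreover have "\<bar>D - 2 * \<theta>\<bar> * (1 / 2) \<le> \<bar>D - 2 * \<theta>\<bar> * b" using b by (intro mult_left_mono) auto
    ultimately have "\<bar>D - 2 * \<theta>\<bar> \<le> 2 * (2 * (\<theta> + L) * z + 2 * \<bar>t - \<theta>\<bar> + L * z + L * a * z + 2 * \<theta> * z)"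
      by (simp add: algebra_simps)
    then have "r * \<bar>D - 2 * \<theta>\<bar> \<le> r * (2 * (2 * (\<theta> + L) * z + 2 * \<bar>t - \<theta>\<bar> + L * z + L * a * z + 2 * \<theta> * z))"
      using r by (intro mult_left_mono) auto
    also have "\<dots> = 2 * (2 * (\<theta> + L) * (r * z) + 2 * (r * \<bar>t - \<theta>\<bar>) + L * (r * z) + L * a * (r * z) + 2 * \<theta> * (r * z))"
      by (simp add: algebra_simps)
    also have "\<dots> \<le> K1"
      unfolding K1_def power2_eq_square mult.assoc[symmetric, of L a a]
      using rz tth th L a by (intro mult_left_mono add_mono) auto
    finally have D1: "r * \<bar>D - 2 * \<theta>\<bar> \<le> K1" .
    have "r * \<bar>D - 2 * \<theta>\<bar> \<le> r * \<theta>" using D1 n(4) by (simp add: r_def)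
    then have "\<bar>D - 2 * \<theta>\<bar> \<le> \<theta>" using r by simp
    then have D: "\<theta> \<le> D" "D \<le> 3 * \<theta>" by auto
    have v: "v_star n y = D / S" using npos by (simp add: v_star_def S_def D_def quad_var_def)
    have u: "u_star n y = (D - c) / (2 * S)"
    proof -
      have "stat_A1 n y - stat_A2 n y = (D - c) / 2"
        using stat_identities(1)[OF n(1), of y] by (simp add: D_def quad_var_def c_def)
      then have "u_star n y = real n * ((D - c) / 2) / (real n * S)"
        by (simp only: u_star_def A1S[symmetric])
      then show ?thesis using npos by simp
    qed
    have iS: "1 / S \<le> L" using Sl Spos L by (simp add: field_simps)
    have "\<bar>u_star n y\<bar> = \<bar>D - c\<bar> * (1 / S) / 2" using Spos by (simp add: u abs_mult)
    also have "\<dots> \<le> (3 * \<theta> + L) * L / 2"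
      using D c0 bounds th iS Spos L by (intro divide_right_mono mult_mono) auto
    also have "\<dots> \<le> K'" using th L K1 by (simp add: K'_def add_nonneg_nonneg algebra_simps)
    finally have 1: "\<bar>u_star n y\<bar> \<le> K'" .
    have 2: "0 < v_star n y" using D th Spos by (simp add: v)
    have "1 / v_star n y = S / D" by (simp add: v)
    also have "\<dots> \<le> L / \<theta>" using D th S0 bounds by (intro frac_le) auto
    also have "\<dots> \<le> K'" using th L K1 by (simp add: K'_def add_nonneg_nonneg)
    finally have 3: "1 / v_star n y \<le> K'" .
    have "v_star n y = D * (1 / S)" by (simp add: v)
    also have "\<dots> \<le> 3 * \<theta> * L" using D th iS Spos by (intro mult_mono) auto
    also have "\<dots> \<le> K'" using th L K1 by (simp add: K'_def add_nonneg_nonneg)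
    finally have 4: "v_star n y \<le> K'" .
    have "K1 \<le> K'" using th L by (simp add: K'_def)
    with D1 have 5: "sqrt (real n) * \<bar>quad_var n y - 2 * \<theta>\<bar> \<le> K'" by (simp add: D_def r_def)
    show ?thesis using 1 2 3 4 5 by (simp add: regular_sample_def)
  qed
  moreover have "\<forall>\<^sub>F n in sequentially. n \<ge> 2 \<and> real n > L \<and> real n \<ge> 2 * a \<and> sqrt (real n) * \<theta> \<ge> K1"
  proof (intro eventually_conj)
    show "\<forall>\<^sub>F n in sequentially. real n > L"
      using filterlim_real_sequentially by (simp add: filterlim_at_top_dense)
    show "\<forall>\<^sub>F n in sequentially. real n \<ge> 2 * a"
      using filterlim_real_sequentially by (simp add: filterlim_at_top)
    have "filterlim (\<lambda>n. sqrt (real n)) at_top sequentially"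
      by (rule filterlim_compose[OF sqrt_at_top filterlim_real_sequentially])
    then have "\<forall>\<^sub>F n in sequentially. sqrt (real n) \<ge> K1 / \<theta>" by (simp add: filterlim_at_top)
    then show "\<forall>\<^sub>F n in sequentially. sqrt (real n) * \<theta> \<ge> K1"
      by eventually_elim (use th in \<open>simp add: field_simps\<close>)
  qed (rule eventually_ge_at_top)
  ultimately have "\<forall>\<^sub>F n in sequentially. \<forall>y :: nat \<Rightarrow> real.
     (y 1)\<^sup>2 + (y n)\<^sup>2 + stat_A1 n y / real n + real n * (theta_tilde n y a - \<theta>)\<^sup>2 \<le> K \<and>
     real n / max (stat_A1 n y) 1 \<le> K \<longrightarrow> regular_sample \<theta> K' n y"
    by (auto elim: eventually_mono)
  then show ?thesis using \<open>K' > 0\<close> unfolding \<theta>_def by blast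
qed

context ou_sample begin

lemma eventually_regular_in_prob:
  assumes "e > 0"
  shows "\<exists>K>0. \<forall>\<^sub>F n in sequentially.
     outer_measure_of M {w \<in> space M. \<not> regular_sample (s2 * a) K n (Y n w)} < ennreal e"
proof -
  obtain K where K: "\<forall>\<^sub>F n in sequentially. outer_measure_of M {w \<in> space M. \<bar>control n w\<bar> > K} < ennreal e"
    using bounded_in_prob_control assms unfolding bounded_in_prob_def by blast
  obtain K' where K': "K' > 0" "\<forall>\<^sub>F n in sequentially. \<forall>y :: nat \<Rightarrow> real.
     (y 1)\<^sup>2 + (y n)\<^sup>2 + stat_A1 n y / real n + real n * (theta_tilde n y a - s2 * a)\<^sup>2 \<le> K \<and>
     real n / max (stat_A1 n y) 1 \<le> K \<longrightarrow> regular_sample (s2 * a) K' n y"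
    using eventually_regular_sample[OF a s2] by blast
  have "\<forall>\<^sub>F n in sequentially.
     outer_measure_of M {w \<in> space M. \<not> regular_sample (s2 * a) K' n (Y n w)} < ennreal e"
    using K K'(2)
  proof eventually_elim
    case (elim n)
    have "{w \<in> space M. \<not> regular_sample (s2 * a) K' n (Y n w)} \<subseteq> {w \<in> space M. \<bar>control n w\<bar> > K}"
    proof safe
      fix w assume "\<not> regular_sample (s2 * a) K' n (Y n w)"
      then have "\<not> ((Y n w 1)\<^sup>2 + (Y n w n)\<^sup>2 + stat_A1 n (Y n w) / real n
          + real n * (theta_tilde n (Y n w) a - s2 * a)\<^sup>2 \<le> K
        \<and> real n / max (stat_A1 n (Y n w)) 1 \<le> K)"
        using spec[OF elim(2), of "Y n w"] by blast
      then show "\<bar>control n w\<bar> > K" unfolding control_def by linarith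
    qed
    from outer_measure_of_mono[OF this] elim(1) show ?case by (rule le_less_trans)
  qed
  then show ?thesis using K'(1) by blast
qed

text \<open>Bridges from deterministic to stochastic statements: first \<open>K\<close> is taken so
  large that irregular samples have outer probability below the prescribed level, then the
  deterministic statement is used for this \<open>K\<close>.\<close>

lemma tendsto_in_prob_of_regular:
  assumes "\<And>K. K > 0 \<Longrightarrow> \<forall>\<^sub>F n in sequentially. \<forall>w\<in>space M.
     regular_sample (s2 * a) K n (Y n w) \<longrightarrow> \<not> P n w"
  shows "(\<lambda>n. outer_measure_of M {w \<in> space M. P n w}) \<longlonglongrightarrow> 0"
proof (rule order_tendstoI)
  fix d :: ennreal assume "0 < d"
  obtain d' where d': "d' > 0" "ennreal d' < d"
  proof (cases d)
    case (real r)
    with \<open>0 < d\<close> that[of "r / 2"] show ?thesis by (auto simp: ennreal_less_iff)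
  next
    case top
    with that[of 1] show ?thesis by auto
  qed
  obtain K where K: "K > 0" "\<forall>\<^sub>F n in sequentially.
     outer_measure_of M {w \<in> space M. \<not> regular_sample (s2 * a) K n (Y n w)} < ennreal d'"
    using eventually_regular_in_prob[OF d'(1)] by blast
  show "\<forall>\<^sub>F n in sequentially. outer_measure_of M {w \<in> space M. P n w} < d"
    using K(2) assms[OF K(1)]
  proof eventually_elim
    case (elim n)
    have "outer_measure_of M {w \<in> space M. P n w}
        \<le> outer_measure_of M {w \<in> space M. \<not> regular_sample (s2 * a) K n (Y n w)}"
      using elim(2) by (intro outer_measure_of_mono) auto
    also have "\<dots> < d" using elim(1) d'(2) by (rule less_trans)
    finally show ?case .
  qed
qed simp

lemma bounded_in_prob_of_regular:
  assumes "\<And>K n w. regular_sample (s2 * a) K n (Y n w) \<Longrightarrow> \<bar>Z n w\<bar> \<le> K"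
  shows "bounded_in_prob M Z"
  unfolding bounded_in_prob_def
proof (intro allI impI)
  fix e :: real assume "e > 0"
  then obtain K where K: "K > 0" "\<forall>\<^sub>F n in sequentially.
     outer_measure_of M {w \<in> space M. \<not> regular_sample (s2 * a) K n (Y n w)} < ennreal e"
    using eventually_regular_in_prob by blast
  have "\<forall>\<^sub>F n in sequentially. outer_measure_of M {w \<in> space M. \<bar>Z n w\<bar> > K} < ennreal e"
    using K(2)
  proof eventually_elim
    case (elim n)
    have "outer_measure_of M {w \<in> space M. \<bar>Z n w\<bar> > K}
        \<le> outer_measure_of M {w \<in> space M. \<not> regular_sample (s2 * a) K n (Y n w)}"
      using assms[of K n] by (intro outer_measure_of_mono) force
    also note elim
    finally show ?case .
  qed
  then show "\<exists>K. \<forall>\<^sub>F n in sequentially. outer_measure_of M {w \<in> space M. \<bar>Z n w\<bar> > K} < ennreal e" ..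
qed

end

section \<open>Total variation between normalized densities\<close>

lemma measure_normalized:
  assumes [measurable]: "f \<in> borel_measurable M" and f: "\<And>x. f x \<ge> 0" "integrable M f"
    and F: "(\<integral>x. f x \<partial>M) > 0" and A[measurable]: "A \<in> sets M"
  shows "emeasure (normalized M f) A = ennreal ((\<integral>x. f x * indicator A x \<partial>M) / (\<integral>x. f x \<partial>M))"
    and "measure (normalized M f) A = (\<integral>x. f x * indicator A x \<partial>M) / (\<integral>x. f x \<partial>M)"
proof -
  have nn: "(\<integral>\<^sup>+x. ennreal (f x) \<partial>M) = ennreal (\<integral>x. f x \<partial>M)"
    using f by (simp add: nn_integral_eq_integral)
  have "emeasure (normalized M f) A
      = (\<integral>\<^sup>+x. ennreal (f x) / ennreal (\<integral>x. f x \<partial>M) * indicator A x \<partial>M)"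
    unfolding normalized_def nn by (rule emeasure_density) auto
  also have "\<dots> = (\<integral>\<^sup>+x. ennreal (f x * indicator A x / (\<integral>x. f x \<partial>M)) \<partial>M)"
    using f F by (intro nn_integral_cong) (auto simp: divide_ennreal split: split_indicator)
  also have "\<dots> = ennreal (\<integral>x. f x * indicator A x / (\<integral>x. f x \<partial>M) \<partial>M)"
    using f F by (intro nn_integral_eq_integral) (auto intro!: integrable_real_mult_indicator)
  also have "\<dots> = ennreal ((\<integral>x. f x * indicator A x \<partial>M) / (\<integral>x. f x \<partial>M))" by simp
  finally show *: "emeasure (normalized M f) A = ennreal ((\<integral>x. f x * indicator A x \<partial>M) / (\<integral>x. f x \<partial>M))" .
  show "measure (normalized M f) A = (\<integral>x. f x * indicator A x \<partial>M) / (\<integral>x. f x \<partial>M)"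
    unfolding measure_def * using f F
    by (intro enn2real_ennreal divide_nonneg_pos integral_nonneg_AE) auto
qed

lemma sets_normalized [simp]: "sets (normalized M f) = sets M"
  and space_normalized [simp]: "space (normalized M f) = space M"
  by (simp_all add: normalized_def)

lemma prob_space_normalized:
  assumes "f \<in> borel_measurable M" "\<And>x. f x \<ge> 0" "integrable M f" "(\<integral>x. f x \<partial>M) > 0"
  shows "prob_space (normalized M f)"
proof
  have "(\<integral>x. f x * indicator (space M) x \<partial>M) = (\<integral>x. f x \<partial>M)"
    by (intro Bochner_Integration.integral_cong) auto
  then show "emeasure (normalized M f) (space (normalized M f)) = 1"
    using measure_normalized(1)[OF assms, of "space M"] assms(4) by simp
qed

lemma normalized_scale:
  assumes "k > 0" and [measurable]: "f \<in> borel_measurable M" and f: "\<And>x. f x \<ge> 0"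
  shows "normalized M (\<lambda>x. k * f x) = normalized M f"
proof -
  have "(\<integral>\<^sup>+x. ennreal (k * f x) \<partial>M) = ennreal k * (\<integral>\<^sup>+x. ennreal (f x) \<partial>M)"
    using \<open>k > 0\<close> by (simp add: ennreal_mult' nn_integral_cmult)
  moreover have "ennreal (k * f x) = ennreal k * ennreal (f x)" for x
    using \<open>k > 0\<close> by (simp add: ennreal_mult')
  moreover have "ennreal k * p / (ennreal k * q) = p / q" for p q :: ennreal
    using \<open>k > 0\<close> divide_mult_eq[of "ennreal k" p q] by (simp add: mult.commute)
  ultimately show ?thesis by (simp add: normalized_def)
qed

lemma integrable_of_nn_close:
  fixes f g :: "'a \<Rightarrow> real"
  assumes [measurable]: "f \<in> borel_measurable M" and g: "integrable M g"
    and e: "(\<integral>\<^sup>+x. ennreal \<bar>f x - g x\<bar> \<partial>M) \<le> ennreal e" and "e \<ge> 0"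
  shows "integrable M f" and "(\<integral>x. \<bar>f x - g x\<bar> \<partial>M) \<le> e"
proof -
  have "integrable M (\<lambda>x. f x - g x)"
    using e g by (intro integrableI_bounded) (auto simp: le_less_trans[OF _ ennreal_less_top])
  from Bochner_Integration.integrable_add[OF this g] show "integrable M f" by simp
  have "(\<integral>x. \<bar>f x - g x\<bar> \<partial>M) = enn2real (\<integral>\<^sup>+x. ennreal \<bar>f x - g x\<bar> \<partial>M)"
    using g by (intro integral_eq_nn_integral) auto
  also have "\<dots> \<le> e" using enn2real_mono[OF e] \<open>e \<ge> 0\<close> by simp
  finally show "(\<integral>x. \<bar>f x - g x\<bar> \<partial>M) \<le> e" .
qed

text \<open>Integrability and positive mass of \<open>f\<close> are inherited from \<open>g\<close>.
  This is how the joint posterior is later seen to be proper, without integrating the likelihood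
  directly.\<close>

lemma normalized_close:
  assumes [measurable]: "f \<in> borel_measurable M" "g \<in> borel_measurable M"
    and f: "\<And>x. f x \<ge> 0" and g: "\<And>x. g x \<ge> 0" "integrable M g"
    and e: "(\<integral>\<^sup>+x. ennreal \<bar>f x - g x\<bar> \<partial>M) \<le> ennreal e" and "e \<ge> 0" and c: "e < c" "c \<le> (\<integral>x. g x \<partial>M)"
  shows "integrable M f" "(\<integral>x. f x \<partial>M) > 0"
    and "A \<in> sets M \<Longrightarrow> \<bar>measure (normalized M f) A - measure (normalized M g) A\<bar> \<le> 2 * e / c"
    and "\<bar>tv_dist (normalized M f) (normalized M g)\<bar> \<le> 2 * e / c"
proof -
  note close = integrable_of_nn_close[OF assms(1) g(2) e \<open>e \<ge> 0\<close>]
  show fi: "integrable M f" by (rule close)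
  let ?F = "\<integral>x. f x \<partial>M" and ?G = "\<integral>x. g x \<partial>M"
  have fg: "\<bar>(\<integral>x. f x * indicator A x \<partial>M) - (\<integral>x. g x * indicator A x \<partial>M)\<bar> \<le> e"
    if [measurable]: "A \<in> sets M" for A
  proof -
    have "(\<integral>x. f x * indicator A x \<partial>M) - (\<integral>x. g x * indicator A x \<partial>M)
        = (\<integral>x. (f x - g x) * indicator A x \<partial>M)"
      using fi g by (subst Bochner_Integration.integral_diff[symmetric])
        (auto simp: left_diff_distrib intro!: integrable_real_mult_indicator)
    also have "\<bar>\<dots>\<bar> \<le> (\<integral>x. \<bar>(f x - g x) * indicator A x\<bar> \<partial>M)" by (rule integral_abs_bound)
    also have "\<dots> \<le> (\<integral>x. \<bar>f x - g x\<bar> \<partial>M)"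
      using fi g by (intro integral_mono) (auto simp: abs_mult intro!: integrable_abs integrable_real_mult_indicator split: split_indicator)
    also have "\<dots> \<le> e" by (rule close)
    finally show ?thesis .
  qed
  have sp: "(\<integral>x. h x * indicator (space M) x \<partial>M) = (\<integral>x. h x \<partial>M)" for h :: "'a \<Rightarrow> real"
    by (intro Bochner_Integration.integral_cong) auto
  have FG: "\<bar>?F - ?G\<bar> \<le> e" using fg[of "space M"] by (simp add: sp)
  then show F: "?F > 0" using c by linarith
  have G: "?G > 0" using c \<open>e \<ge> 0\<close> by linarith
  show close': "\<bar>measure (normalized M f) A - measure (normalized M g) A\<bar> \<le> 2 * e / c"
    if A[measurable]: "A \<in> sets M" for A
  proof -
    define a where "a = (\<integral>x. f x * indicator A x \<partial>M)"
    define b where "b = (\<integral>x. g x * indicator A x \<partial>M)"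
    have a: "0 \<le> a" "a \<le> ?F"
      unfolding a_def using f fi
      by (auto intro!: integral_nonneg_AE integral_mono integrable_real_mult_indicator split: split_indicator)
    \<comment> \<open>Splits the error into that of the numerator and that of the normalizing
      constant. As \<open>a / ?F\<close> is at most 1, each costs at most
      \<open>e / c\<close>.\<close>
    have "a / ?F - b / ?G = (a - b) / ?G + a / ?F * ((?G - ?F) / ?G)"
      using F G by (simp add: field_simps)
    also have "\<bar>\<dots>\<bar> \<le> \<bar>a - b\<bar> / ?G + a / ?F * (\<bar>?G - ?F\<bar> / ?G)"
      using F G a by (intro order_trans[OF abs_triangle_ineq]) (simp add: abs_mult)
    also have "\<dots> \<le> e / c + 1 * (e / c)"
      using fg[OF A] FG a F G c \<open>e \<ge> 0\<close> unfolding a_def[symmetric] b_def[symmetric]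
      by (intro add_mono mult_mono frac_le) (auto simp: abs_minus_commute)
    finally have "\<bar>a / ?F - b / ?G\<bar> \<le> 2 * e / c" by simp
    then show ?thesis
      using measure_normalized(2)[OF assms(1) f fi F A] measure_normalized(2)[OF assms(2) g G A]
      by (simp add: a_def b_def)
  qed
  \<comment> \<open>A supremum of reals is meaningful only for bounded families; the bound is the
    estimate just proved.\<close>
  have "0 \<le> (SUP A\<in>sets M. \<bar>measure (normalized M f) A - measure (normalized M g) A\<bar>)"
    by (intro cSUP_upper2[where x = "{}"] bdd_aboveI2[OF close']) auto
  moreover have "(SUP A\<in>sets M. \<bar>measure (normalized M f) A - measure (normalized M g) A\<bar>) \<le> 2 * e / c"
    using close' by (intro cSUP_least) auto
  ultimately show "\<bar>tv_dist (normalized M f) (normalized M g)\<bar> \<le> 2 * e / c"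
    by (simp add: tv_dist_def)
qed

abbreviation lborel2 :: "(real \<times> real) measure" where "lborel2 \<equiv> lborel \<Otimes>\<^sub>M lborel"

text \<open>The normal factor has mass 1, so the product density has the same normalizing constant
  as \<open>h\<close> alone.\<close>

lemma normal_measure_pair_normalized:
  assumes v: "v > 0" and [measurable]: "h \<in> borel_measurable lborel"
    and h: "\<And>x. h x \<ge> 0" "integrable lborel h" "(\<integral>x. h x \<partial>lborel) > 0"
  shows "normal_measure m v \<Otimes>\<^sub>M normalized lborel h
      = normalized lborel2 (\<lambda>(x, a). normal_density m (sqrt v) x * h a)"
proof -
  interpret H: prob_space "normalized lborel h"
    by (rule prob_space_normalized) (use h in auto)
  let ?C = "\<integral>\<^sup>+a. ennreal (h a) \<partial>lborel"
  have C: "?C = ennreal (\<integral>x. h x \<partial>lborel)" using h by (simp add: nn_integral_eq_integral)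
  have phi: "(\<integral>\<^sup>+x. ennreal (normal_density m (sqrt v) x) \<partial>lborel) = 1"
    using v by (subst nn_integral_eq_integral) auto
  have "(\<integral>\<^sup>+z. ennreal (case z of (x, a) \<Rightarrow> normal_density m (sqrt v) x * h a) \<partial>lborel2)
      = (\<integral>\<^sup>+x. \<integral>\<^sup>+a. ennreal (normal_density m (sqrt v) x) * ennreal (h a) \<partial>lborel \<partial>lborel)"
    by (subst lborel.nn_integral_fst[symmetric]) (auto simp: ennreal_mult' case_prod_beta)
  also have "\<dots> = ?C" by (simp add: nn_integral_cmult nn_integral_multc phi)
  finally have tot: "(\<integral>\<^sup>+z. ennreal (case z of (x, a) \<Rightarrow> normal_density m (sqrt v) x * h a) \<partial>lborel2) = ?C" .
  have "normal_measure m v \<Otimes>\<^sub>M normalized lborel h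
      = density lborel (\<lambda>x. ennreal (normal_density m (sqrt v) x)) \<Otimes>\<^sub>M density lborel (\<lambda>a. ennreal (h a) / ?C)"
    using v by (simp add: normal_measure_def normalized_def)
  also have "\<dots> = density lborel2
      (\<lambda>(x, a). ennreal (normal_density m (sqrt v) x) * (ennreal (h a) / ?C))"
    using H.sigma_finite_measure_axioms
    by (intro pair_measure_density) (auto simp: normalized_def intro: lborel.sigma_finite_measure_axioms)
  also have "(\<lambda>(x, a). ennreal (normal_density m (sqrt v) x) * (ennreal (h a) / ?C))
      = (\<lambda>z. ennreal (case z of (x, a) \<Rightarrow> normal_density m (sqrt v) x * h a) / ?C)"
    by (auto simp: ennreal_mult' ennreal_times_divide)
  finally show ?thesis unfolding normalized_def tot .
qed

section \<open>Laplace approximation in the microergodic parameter\<close>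

text \<open>Quadratic near 0 and linear at infinity, hence usable on the whole domain. Each sign of
  \<open>y\<close> is a monotonicity argument from 0; for negative \<open>y\<close> even
  \<open>- (y\<^sup>2 / 2)\<close> is an upper bound.\<close>

lemma ln_add_one_minus_le:
  fixes y :: real
  assumes "y > -1"
  shows "ln (1 + y) - y \<le> - (y\<^sup>2 / (2 * (1 + \<bar>y\<bar>)))"
proof (cases "y \<ge> 0")
  case True
  have "y - y\<^sup>2 / (2 * (1 + y)) - ln (1 + y) \<ge> 0 - 0\<^sup>2 / (2 * (1 + 0)) - ln (1 + 0 :: real)"
  proof (rule DERIV_nonneg_imp_nondecreasing[OF True])
    fix x :: real assume "0 \<le> x" "x \<le> y"
    then have "((\<lambda>y. y - y\<^sup>2 / (2 * (1 + y)) - ln (1 + y)) has_real_derivative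
        1 - (2 * x * (2 * (1 + x)) - x\<^sup>2 * 2) / (2 * (1 + x))\<^sup>2 - 1 / (1 + x)) (at x)"
      by (auto intro!: derivative_eq_intros simp: power2_eq_square)
    moreover have "1 - (2 * x * (2 * (1 + x)) - x\<^sup>2 * 2) / (2 * (1 + x))\<^sup>2 - 1 / (1 + x) = x\<^sup>2 / (2 * (1 + x)\<^sup>2)"
      using \<open>0 \<le> x\<close> by (simp add: divide_simps power2_eq_square) (simp add: algebra_simps)
    moreover have "x\<^sup>2 / (2 * (1 + x)\<^sup>2) \<ge> 0" by simp
    ultimately show "\<exists>d. ((\<lambda>y. y - y\<^sup>2 / (2 * (1 + y)) - ln (1 + y)) has_real_derivative d) (at x) \<and> 0 \<le> d"
      by auto
  qed
  then show ?thesis using True by simp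
next
  case False
  have "y - ln (1 + y) - y\<^sup>2 / 2 \<ge> 0 - ln (1 + 0) - 0\<^sup>2 / (2 :: real)"
  proof (rule DERIV_nonpos_imp_nonincreasing[of y 0])
    fix x :: real assume "y \<le> x" "x \<le> 0"
    then have "((\<lambda>y. y - ln (1 + y) - y\<^sup>2 / 2) has_real_derivative 1 - 1 / (1 + x) - x) (at x)"
      using assms by (auto intro!: derivative_eq_intros)
    moreover have "1 - 1 / (1 + x) - x = - x\<^sup>2 / (1 + x)"
      using \<open>y \<le> x\<close> assms by (simp add: divide_simps power2_eq_square) (simp add: algebra_simps)
    moreover have "- x\<^sup>2 / (1 + x) \<le> 0" using \<open>y \<le> x\<close> assms by simp
    ultimately show "\<exists>d. ((\<lambda>y. y - ln (1 + y) - y\<^sup>2 / 2) has_real_derivative d) (at x) \<and> d \<le> 0"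
      by auto
  qed (use False in simp)
  then have "ln (1 + y) - y \<le> - (y\<^sup>2 / 2)" by simp
  moreover have "y\<^sup>2 / (2 * (1 + \<bar>y\<bar>)) \<le> y\<^sup>2 / 2"
    by (intro divide_left_mono) auto
  ultimately show ?thesis by linarith
qed

text \<open>Mean value inequality: the remainder has derivative \<open>x\<^sup>2 / (1 + x)\<close>,
  which is at most \<open>2 * y\<^sup>2\<close> as long as \<open>1 + x \<ge> 1 / 2\<close>.\<close>

lemma ln_add_one_third_order:
  fixes y :: real
  assumes "\<bar>y\<bar> \<le> 1 / 2"
  shows "\<bar>ln (1 + y) - y + y\<^sup>2 / 2\<bar> \<le> 2 * \<bar>y\<bar> ^ 3"
proof -
  define f where "f = (\<lambda>y :: real. ln (1 + y) - y + y\<^sup>2 / 2)"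
  have "norm (f y - f 0) \<le> 2 * y\<^sup>2 * norm (y - 0)"
  proof (rule field_differentiable_bound[where S = "{- \<bar>y\<bar>..\<bar>y\<bar>}" and f' = "\<lambda>x. x\<^sup>2 / (1 + x)"])
    fix x assume x: "x \<in> {- \<bar>y\<bar>..\<bar>y\<bar>}"
    then have x1: "1 + x \<ge> 1 / 2" using assms by auto
    have "(f has_real_derivative 1 / (1 + x) - 1 + x) (at x within {- \<bar>y\<bar>..\<bar>y\<bar>})"
      unfolding f_def using x1 by (auto intro!: derivative_eq_intros)
    moreover have "1 / (1 + x) - 1 + x = x\<^sup>2 / (1 + x)"
      using x1 by (simp add: divide_simps power2_eq_square) (simp add: algebra_simps)
    ultimately show "(f has_real_derivative x\<^sup>2 / (1 + x)) (at x within {- \<bar>y\<bar>..\<bar>y\<bar>})" by simp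
    have "x\<^sup>2 / (1 + x) \<le> y\<^sup>2 / (1 / 2)"
      using x x1 by (intro frac_le) (auto simp: abs_le_square_iff[symmetric])
    then show "norm (x\<^sup>2 / (1 + x)) \<le> 2 * y\<^sup>2" using x1 by (simp add: abs_of_nonneg)
  qed auto
  also have "2 * y\<^sup>2 * norm (y - 0) = 2 * \<bar>y\<bar> ^ 3" by (simp add: power3_eq_cube power2_eq_square)
  finally show ?thesis by (simp add: f_def)
qed

text \<open>The likelihood as a function of \<open>\<theta>\<close> for fixed \<open>\<alpha>\<close>, with \<open>t\<close> the value of \<^const>\<open>theta_tilde\<close> at \<open>\<alpha>\<close>,
  scaled so that its maximum over \<open>\<theta>\<close> is that of the normal density with variance \<open>2 \<theta>\<^sub>0\<^sup>2 / n\<close>,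
  whatever \<open>t\<close> is.\<close>

definition theta_kernel :: "real \<Rightarrow> nat \<Rightarrow> real \<Rightarrow> real \<Rightarrow> real" where
  "theta_kernel \<theta>\<^sub>0 n t \<theta> = sqrt (real n / (4 * pi * \<theta>\<^sub>0\<^sup>2)) * exp (real n / 2 * (1 + ln (t / \<theta>) - t / \<theta>))"

lemma theta_kernel_nonneg [simp]: "theta_kernel \<theta>\<^sub>0 n t \<theta> \<ge> 0"
  by (simp add: theta_kernel_def)

lemma measurable_theta_kernel [measurable]:
  assumes [measurable]: "f \<in> borel_measurable M" "g \<in> borel_measurable M"
  shows "(\<lambda>x. theta_kernel \<theta>\<^sub>0 n (f x) (g x)) \<in> borel_measurable M"
  unfolding theta_kernel_def by measurable

text \<open>In terms of \<open>y = t / \<theta> - 1\<close> the exponent is \<open>n / 2\<close>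
  times \<open>ln (1 + y) - y\<close>. The condition \<open>d \<le> 1\<close> absorbs the linear
  growth of the denominator \<open>1 + \<bar>y\<bar>\<close>.\<close>

lemma theta_kernel_tail:
  assumes t: "t > 0" and th: "\<theta> > 0" and d: "0 \<le> d" "d \<le> 1" "d \<le> \<bar>t / \<theta> - 1\<bar>"
  shows "theta_kernel \<theta>\<^sub>0 n t \<theta> \<le> sqrt (real n / (4 * pi * \<theta>\<^sub>0\<^sup>2)) * exp (- (real n * d\<^sup>2 / 8))"
proof -
  define y where "y = t / \<theta> - 1"
  have y: "y > -1" "d \<le> \<bar>y\<bar>" using t th d by (auto simp: y_def)
  have "1 + ln (t / \<theta>) - t / \<theta> = ln (1 + y) - y" by (simp add: y_def)
  also have "\<dots> \<le> - (y\<^sup>2 / (2 * (1 + \<bar>y\<bar>)))" using y by (intro ln_add_one_minus_le)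
  also have "\<dots> \<le> - (d\<^sup>2 / 4)"
  proof -
    have "d\<^sup>2 * (1 + \<bar>y\<bar>) \<le> 2 * y\<^sup>2"
    proof -
      have "d\<^sup>2 \<le> \<bar>y\<bar>\<^sup>2" using y d by (intro power_mono) auto
      moreover have "d * (d * \<bar>y\<bar>) \<le> 1 * (\<bar>y\<bar> * \<bar>y\<bar>)" using y d by (intro mult_mono) auto
      ultimately show ?thesis by (simp add: power2_eq_square algebra_simps)
    qed
    then have "d\<^sup>2 / 4 \<le> y\<^sup>2 / (2 * (1 + \<bar>y\<bar>))" by (subst pos_le_divide_eq) (auto simp: algebra_simps)
    then show ?thesis by simp
  qed
  finally have "real n / 2 * (1 + ln (t / \<theta>) - t / \<theta>) \<le> real n / 2 * (- (d\<^sup>2 / 4))"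
    by (intro mult_left_mono) auto
  then have "exp (real n / 2 * (1 + ln (t / \<theta>) - t / \<theta>)) \<le> exp (- (real n * d\<^sup>2 / 8))" by simp
  then show ?thesis unfolding theta_kernel_def by (intro mult_left_mono) auto
qed

lemma theta_kernel_le:
  assumes "t > 0" "\<theta> > 0"
  shows "theta_kernel \<theta>\<^sub>0 n t \<theta> \<le> sqrt (real n / (4 * pi * \<theta>\<^sub>0\<^sup>2))"
  using theta_kernel_tail[OF assms, of 0] by simp

lemma normal_density_scaled:
  assumes "\<theta>\<^sub>0 > 0" "n > 0"
  shows "normal_density m (sqrt (2 * \<theta>\<^sub>0\<^sup>2 / real n)) \<theta>
     = sqrt (real n / (4 * pi * \<theta>\<^sub>0\<^sup>2)) * exp (- (real n * (\<theta> - m)\<^sup>2 / (4 * \<theta>\<^sub>0\<^sup>2)))"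
  using assms by (simp add: normal_density_def real_sqrt_divide real_sqrt_mult field_simps)

text \<open>Second order expansion of the logarithm in \<open>y = (t - \<theta>) / \<theta>\<close>.
  The remainder \<open>x1\<close> is cubic. The quadratic term is then compared with the normal
  exponent, in which \<open>m\<close> stands for \<open>t\<close> and
  \<open>\<theta>\<^sub>0\<close> for the \<theta> in the denominator; the difference is
  \<open>x2\<close>.\<close>

lemma theta_kernel_near:
  assumes th0: "\<theta>\<^sub>0 > 0" and n: "n > 0" and d: "d \<le> \<theta>\<^sub>0 / 8"
    and near: "\<bar>\<theta> - \<theta>\<^sub>0\<bar> \<le> d" "\<bar>t - \<theta>\<^sub>0\<bar> \<le> d" "\<bar>m - \<theta>\<^sub>0\<bar> \<le> d" and tm: "\<bar>t - m\<bar> \<le> w"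
  shows "\<exists>x. theta_kernel \<theta>\<^sub>0 n t \<theta> = normal_density m (sqrt (2 * \<theta>\<^sub>0\<^sup>2 / real n)) \<theta> * exp x
     \<and> \<bar>x\<bar> \<le> real n * (31 * d ^ 3 / \<theta>\<^sub>0 ^ 3 + w * d / \<theta>\<^sub>0\<^sup>2)"
proof -
  have d0: "d \<ge> 0" using near by linarith
  have w0: "w \<ge> 0" using tm by linarith
  have th: "\<theta> \<ge> 7 / 8 * \<theta>\<^sub>0" "\<theta> \<le> 9 / 8 * \<theta>\<^sub>0" using near d by auto
  then have thp: "\<theta> > 0" using th0 by linarith
  define y where "y = (t - \<theta>) / \<theta>"
  have td: "\<bar>t - \<theta>\<bar> \<le> 2 * d" using near by linarith
  have "\<bar>y\<bar> \<le> 2 * d / (7 / 8 * \<theta>\<^sub>0)"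
    unfolding y_def abs_divide using td th th0 thp by (intro frac_le) auto
  then have y: "\<bar>y\<bar> \<le> 16 / 7 * (d / \<theta>\<^sub>0)" by simp
  have dth: "d / \<theta>\<^sub>0 \<le> 1 / 8" "0 \<le> d / \<theta>\<^sub>0" using d d0 th0 by (auto simp: field_simps)
  define P where "P = d ^ 3 / \<theta>\<^sub>0 ^ 3"
  define R where "R = w * d / \<theta>\<^sub>0\<^sup>2"
  have PR: "P \<ge> 0" "R \<ge> 0" using d0 w0 th0 by (auto simp: P_def R_def)
  define x1 where "x1 = ln (1 + y) - y + y\<^sup>2 / 2"
  have "\<bar>x1\<bar> \<le> 2 * \<bar>y\<bar> ^ 3"
    unfolding x1_def by (rule ln_add_one_third_order) (use y dth in linarith)
  also have "\<dots> \<le> 2 * (16 / 7 * (d / \<theta>\<^sub>0)) ^ 3" using y by (intro mult_left_mono power_mono) auto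
  also have "\<dots> = 8192 / 343 * (d / \<theta>\<^sub>0) ^ 3" unfolding power_mult_distrib by (simp add: power_divide)
  \<comment> \<open>\<open>8192 / 343\<close> is below 24.\<close>
  also have "\<dots> \<le> 27 * (d / \<theta>\<^sub>0) ^ 3" using dth by (intro mult_right_mono) auto
  finally have x1: "\<bar>x1\<bar> \<le> 27 * P" by (simp add: P_def power_divide)
  define x2 where "x2 = (\<theta> - m)\<^sup>2 / \<theta>\<^sub>0\<^sup>2 - y\<^sup>2"
  \<comment> \<open>The first summand is the price of replacing \<open>t\<close> by
    \<open>m\<close>, the second that of replacing \<theta> by \<open>\<theta>\<^sub>0\<close> in
    the denominator.\<close>
  have "x2 = ((\<theta> - m)\<^sup>2 - (t - \<theta>)\<^sup>2) / \<theta>\<^sub>0\<^sup>2 + (t - \<theta>)\<^sup>2 * (1 / \<theta>\<^sub>0\<^sup>2 - 1 / \<theta>\<^sup>2)"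
  proof -
    have "y\<^sup>2 = (t - \<theta>)\<^sup>2 / \<theta>\<^sup>2" by (simp only: y_def power_divide)
    then show ?thesis by (simp add: x2_def diff_divide_distrib right_diff_distrib)
  qed
  moreover have "\<bar>((\<theta> - m)\<^sup>2 - (t - \<theta>)\<^sup>2) / \<theta>\<^sub>0\<^sup>2\<bar> \<le> 4 * R"
  proof -
    have "(\<theta> - m)\<^sup>2 - (t - \<theta>)\<^sup>2 = (t - m) * ((\<theta> - m) - (t - \<theta>))"
      by (simp add: power2_eq_square algebra_simps)
    moreover have "\<bar>(\<theta> - m) - (t - \<theta>)\<bar> \<le> 4 * d" using near by linarith
    ultimately have "\<bar>(\<theta> - m)\<^sup>2 - (t - \<theta>)\<^sup>2\<bar> \<le> w * (4 * d)"
      using tm w0 by (auto simp: abs_mult intro!: mult_mono)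
    then have "\<bar>(\<theta> - m)\<^sup>2 - (t - \<theta>)\<^sup>2\<bar> / \<theta>\<^sub>0\<^sup>2 \<le> w * (4 * d) / \<theta>\<^sub>0\<^sup>2"
      by (rule divide_right_mono) simp
    then show ?thesis by (simp add: R_def mult.left_commute)
  qed
  moreover have "\<bar>(t - \<theta>)\<^sup>2 * (1 / \<theta>\<^sub>0\<^sup>2 - 1 / \<theta>\<^sup>2)\<bar> \<le> 16 * P"
  proof -
    have "1 / \<theta>\<^sub>0\<^sup>2 - 1 / \<theta>\<^sup>2 = (\<theta> - \<theta>\<^sub>0) * (\<theta> + \<theta>\<^sub>0) / (\<theta>\<^sub>0\<^sup>2 * \<theta>\<^sup>2)"
      using th0 thp by (simp add: field_simps power2_eq_square)
    also have "\<bar>\<dots>\<bar> \<le> d * (17 / 8 * \<theta>\<^sub>0) / (\<theta>\<^sub>0\<^sup>2 * (7 / 8 * \<theta>\<^sub>0)\<^sup>2)"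
      unfolding abs_divide abs_mult using near th th0 thp d0
      by (intro frac_le mult_mono) (auto intro!: power_mono)
    also have "\<dots> \<le> 4 * d / \<theta>\<^sub>0 ^ 3"
      using th0 d0 by (simp add: power2_eq_square power3_eq_cube divide_simps)
    finally have "\<bar>1 / \<theta>\<^sub>0\<^sup>2 - 1 / \<theta>\<^sup>2\<bar> \<le> 4 * d / \<theta>\<^sub>0 ^ 3" .
    moreover have "(t - \<theta>)\<^sup>2 \<le> (2 * d)\<^sup>2" using power_mono[OF td, of 2] by simp
    ultimately have "\<bar>(t - \<theta>)\<^sup>2 * (1 / \<theta>\<^sub>0\<^sup>2 - 1 / \<theta>\<^sup>2)\<bar> \<le> (2 * d)\<^sup>2 * (4 * d / \<theta>\<^sub>0 ^ 3)"
      unfolding abs_mult using d0 th0 by (intro mult_mono) auto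
    also have "\<dots> = 16 * P" by (simp add: P_def power2_eq_square power3_eq_cube)
    finally show ?thesis .
  qed
  ultimately have x2: "\<bar>x2\<bar> \<le> 4 * R + 16 * P" by linarith
  define x where "x = real n / 2 * (x1 + x2 / 2)"
  have "1 + ln (t / \<theta>) - t / \<theta> = x1 - y\<^sup>2 / 2"
  proof -
    have "t / \<theta> = 1 + y" using thp by (simp add: y_def diff_divide_distrib)
    then show ?thesis by (simp add: x1_def)
  qed
  moreover have "real n / 2 * (x1 - y\<^sup>2 / 2) = - (real n * (\<theta> - m)\<^sup>2 / (4 * \<theta>\<^sub>0\<^sup>2)) + x"
  proof -
    have "real n * (\<theta> - m)\<^sup>2 / (4 * \<theta>\<^sub>0\<^sup>2) = real n * (x2 + y\<^sup>2) / 4" by (simp add: x2_def)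
    then show ?thesis by (simp add: x_def algebra_simps add_divide_distrib)
  qed
  ultimately have E: "real n / 2 * (1 + ln (t / \<theta>) - t / \<theta>) = - (real n * (\<theta> - m)\<^sup>2 / (4 * \<theta>\<^sub>0\<^sup>2)) + x"
    by simp
  have "theta_kernel \<theta>\<^sub>0 n t \<theta> = normal_density m (sqrt (2 * \<theta>\<^sub>0\<^sup>2 / real n)) \<theta> * exp x"
    unfolding theta_kernel_def normal_density_scaled[OF th0 n] E exp_add by simp
  moreover have "\<bar>x\<bar> \<le> real n * (31 * d ^ 3 / \<theta>\<^sub>0 ^ 3 + w * d / \<theta>\<^sub>0\<^sup>2)"
  proof -
    \<comment> \<open>The multiples of \<open>P\<close> add up to \<open>27 + 16 / 2 = 35\<close>,
      which fits into 62.\<close>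
    have "\<bar>x1 + x2 / 2\<bar> \<le> 2 * (31 * P + R)"
      using abs_triangle_ineq[of x1 "x2 / 2"] x1 x2 PR by simp
    then have "real n / 2 * \<bar>x1 + x2 / 2\<bar> \<le> real n / 2 * (2 * (31 * P + R))"
      by (intro mult_left_mono) auto
    moreover have "\<bar>x\<bar> = real n / 2 * \<bar>x1 + x2 / 2\<bar>" by (simp add: x_def abs_mult)
    ultimately have "\<bar>x\<bar> \<le> real n * (31 * P + R)" by (simp add: algebra_simps)
    then show ?thesis by (simp add: P_def R_def)
  qed
  ultimately show ?thesis by blast
qed

lemma abs_exp_minus_one_le:
  fixes x y :: real
  assumes "\<bar>x\<bar> \<le> y" shows "\<bar>exp x - 1\<bar> \<le> exp y - 1"
proof -
  have "1 - exp (- y) \<le> exp y - 1"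
    using exp_ge_add_one_self[of "- y"] exp_ge_add_one_self[of y] by linarith
  moreover have "exp (- y) \<le> exp x" "exp x \<le> exp y" using assms by auto
  ultimately show ?thesis by linarith
qed

text \<open>The summands are, in order: the relative error on the window of half-width
  \<open>d\<close>; the normal mass outside it, by Chebyshev with distance \<open>d / 2\<close> from
  the mean; the kernel on the rest of the interval from \<open>\<theta>\<^sub>0 / 2\<close> to
  \<open>2 * \<theta>\<^sub>0\<close>, whose length is \<open>3 / 2 * \<theta>\<^sub>0\<close>; the
  kernel beyond that interval. Here \<open>w\<close> bounds the shift of the centre,
  \<open>b\<close> the slope of the log prior, \<open>R\<close> the prior ratio on the interval and
  \<open>P\<close> its total integral.\<close>

definition laplace_error :: "real \<Rightarrow> nat \<Rightarrow> real \<Rightarrow> real \<Rightarrow> real \<Rightarrow> real \<Rightarrow> real \<Rightarrow> real" where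
  "laplace_error \<theta>\<^sub>0 n d w b R P =
     (exp (real n * (31 * d ^ 3 / \<theta>\<^sub>0 ^ 3 + w * d / \<theta>\<^sub>0\<^sup>2) + b * d) - 1)
     + 8 * \<theta>\<^sub>0\<^sup>2 / (real n * d\<^sup>2)
     + sqrt (real n / (4 * pi * \<theta>\<^sub>0\<^sup>2)) * (exp (- (real n * (d / (4 * \<theta>\<^sub>0))\<^sup>2 / 8)) * R * (3 / 2 * \<theta>\<^sub>0)
         + exp (- (real n / 128)) * P)"

text \<open>The function \<open>r\<close> will be the prior density of \<theta> relative to its
  value at \<open>\<theta>\<^sub>0\<close>. The integrand is bounded pointwise by four nonnegative
  functions, which take care of the four summands of \<open>laplace_error\<close> and are integrated
  separately.\<close>

lemma laplace_approximation:
  fixes r :: "real \<Rightarrow> real"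
  assumes th0: "\<theta>\<^sub>0 > 0" and n: "n > 0" and d: "0 < d" "d \<le> \<theta>\<^sub>0 / 8" and nonneg: "b \<ge> 0" "R \<ge> 0" "P \<ge> 0"
    and t: "\<bar>t - \<theta>\<^sub>0\<bar> \<le> d / 2" and m: "\<bar>m - \<theta>\<^sub>0\<bar> \<le> d / 2" and tm: "\<bar>t - m\<bar> \<le> w"
    and meas[measurable]: "(\<lambda>\<theta>. indicator {0<..} \<theta> * r \<theta>) \<in> borel_measurable borel"
    and r0: "\<And>\<theta>. \<theta> > 0 \<Longrightarrow> r \<theta> \<ge> 0"
    and rP: "(\<integral>\<^sup>+\<theta>. ennreal (indicator {0<..} \<theta> * r \<theta>) \<partial>lborel) \<le> ennreal P"
    and rR: "\<And>\<theta>. \<theta>\<^sub>0 / 2 < \<theta> \<Longrightarrow> \<theta> < 2 * \<theta>\<^sub>0 \<Longrightarrow> r \<theta> \<le> R"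
    and rb: "\<And>\<theta>. \<theta>\<^sub>0 / 2 < \<theta> \<Longrightarrow> \<theta> < 2 * \<theta>\<^sub>0 \<Longrightarrow> r \<theta> > 0 \<and> \<bar>ln (r \<theta>)\<bar> \<le> b * \<bar>\<theta> - \<theta>\<^sub>0\<bar>"
  shows "(\<integral>\<^sup>+\<theta>. ennreal \<bar>theta_kernel \<theta>\<^sub>0 n t \<theta> * (indicator {0<..} \<theta> * r \<theta>)
            - normal_density m (sqrt (2 * \<theta>\<^sub>0\<^sup>2 / real n)) \<theta>\<bar> \<partial>lborel)
         \<le> ennreal (laplace_error \<theta>\<^sub>0 n d w b R P)"
proof -
  define c where "c = sqrt (real n / (4 * pi * \<theta>\<^sub>0\<^sup>2))"
  define s where "s = sqrt (2 * \<theta>\<^sub>0\<^sup>2 / real n)"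
  define \<phi> where "\<phi> = normal_density m s"
  define \<xi> where "\<xi> = real n * (31 * d ^ 3 / \<theta>\<^sub>0 ^ 3 + w * d / \<theta>\<^sub>0\<^sup>2) + b * d"
  define B where "B = c * exp (- (real n * (d / (4 * \<theta>\<^sub>0))\<^sup>2 / 8)) * R"
  define E where "E = c * exp (- (real n / 128))"
  have s: "s > 0" using th0 n by (simp add: s_def)
  have w: "w \<ge> 0" using tm by linarith
  have xi: "\<xi> \<ge> 0" using d w th0 nonneg by (simp add: \<xi>_def)
  have c: "c \<ge> 0" by (simp add: c_def)
  have tp: "t > 0" using t d th0 by linarith
  have phi0: "\<phi> \<theta> \<ge> 0" for \<theta> by (simp add: \<phi>_def)
  have BE: "B \<ge> 0" "E \<ge> 0" using c nonneg by (auto simp: B_def E_def)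
  have key: "\<bar>theta_kernel \<theta>\<^sub>0 n t \<theta> * (indicator {0<..} \<theta> * r \<theta>) - \<phi> \<theta>\<bar>
      \<le> (exp \<xi> - 1) * \<phi> \<theta> + 4 / d\<^sup>2 * (\<phi> \<theta> * (\<theta> - m)\<^sup>2) + B * indicator {\<theta>\<^sub>0 / 2<..<2 * \<theta>\<^sub>0} \<theta>
        + E * (indicator {0<..} \<theta> * r \<theta>)"
    (is "?l \<le> ?x1 + ?x2 + ?x3 + ?x4") for \<theta>
  proof -
    have x: "?x1 \<ge> 0" "?x2 \<ge> 0" "?x3 \<ge> 0" "?x4 \<ge> 0"
      using phi0 xi BE r0 by (auto split: split_indicator)
    show ?thesis
    proof (cases "\<bar>\<theta> - \<theta>\<^sub>0\<bar> \<le> d")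
      case True
      then have th: "\<theta>\<^sub>0 / 2 < \<theta>" "\<theta> < 2 * \<theta>\<^sub>0" "\<theta> > 0" using d th0 by auto
      obtain x where x: "theta_kernel \<theta>\<^sub>0 n t \<theta> = \<phi> \<theta> * exp x"
        "\<bar>x\<bar> \<le> real n * (31 * d ^ 3 / \<theta>\<^sub>0 ^ 3 + w * d / \<theta>\<^sub>0\<^sup>2)"
        using theta_kernel_near[OF th0 n d(2) True _ _ tm] t m d unfolding \<phi>_def s_def by force
      have "r \<theta> = exp (ln (r \<theta>))" using rb[OF th(1,2)] by simp
      then have "?l = \<bar>\<phi> \<theta> * (exp (x + ln (r \<theta>)) - 1)\<bar>"
        using th x(1) by (simp add: exp_add right_diff_distrib mult.assoc)
      also have "\<dots> = \<phi> \<theta> * \<bar>exp (x + ln (r \<theta>)) - 1\<bar>" using phi0 by (simp add: abs_mult)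
      also have "\<dots> \<le> \<phi> \<theta> * (exp \<xi> - 1)"
      proof (intro mult_left_mono abs_exp_minus_one_le phi0)
        have "b * \<bar>\<theta> - \<theta>\<^sub>0\<bar> \<le> b * d" using True nonneg by (intro mult_left_mono) auto
        then show "\<bar>x + ln (r \<theta>)\<bar> \<le> \<xi>" using x(2) rb[OF th(1,2)] unfolding \<xi>_def by linarith
      qed
      finally show ?thesis using \<open>?x2 \<ge> 0\<close> \<open>?x3 \<ge> 0\<close> \<open>?x4 \<ge> 0\<close> by (simp add: mult.commute)
    next
      case False
      have "\<phi> \<theta> \<le> ?x2"
      proof -
        have "d / 2 \<le> \<bar>\<theta> - m\<bar>" using False m by linarith
        then have "(d / 2)\<^sup>2 \<le> (\<theta> - m)\<^sup>2" using d by (simp add: abs_le_square_iff[symmetric])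
        then have "1 \<le> 4 / d\<^sup>2 * (\<theta> - m)\<^sup>2" using d by (simp add: field_simps)
        from mult_left_mono[OF this phi0[of \<theta>]] show ?thesis by (simp add: mult_ac)
      qed
      moreover have "theta_kernel \<theta>\<^sub>0 n t \<theta> * (indicator {0<..} \<theta> * r \<theta>) \<le> ?x3 + ?x4"
      proof -
        consider "\<theta> \<le> 0" | "\<theta> > 0" "\<theta>\<^sub>0 / 2 < \<theta>" "\<theta> < 2 * \<theta>\<^sub>0" | "0 < \<theta>" "\<theta> \<le> \<theta>\<^sub>0 / 2" | "\<theta> \<ge> 2 * \<theta>\<^sub>0"
          by linarith
        then show ?thesis
        proof cases
          case 1
          then show ?thesis using x by simp
        next
          case 2
          have "t / \<theta> - 1 = (t - \<theta>) / \<theta>" using 2 by (simp add: diff_divide_distrib)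
          then have "\<bar>t / \<theta> - 1\<bar> = \<bar>t - \<theta>\<bar> / \<theta>" using 2 by simp
          \<comment> \<open>Outside the window \<theta> is at least \<open>d / 2\<close> away from
            \<open>t\<close>, and it is less than \<open>2 * \<theta>\<^sub>0\<close>; hence the
            \<open>d / (4 * \<theta>\<^sub>0)\<close> in the error.\<close>
          moreover have "d / 2 / (2 * \<theta>\<^sub>0) \<le> \<bar>t - \<theta>\<bar> / \<theta>"
          proof (rule frac_le)
            show "d / 2 \<le> \<bar>t - \<theta>\<bar>" using False t by linarith
          qed (use 2 d in auto)
          ultimately have "d / (4 * \<theta>\<^sub>0) \<le> \<bar>t / \<theta> - 1\<bar>" by simp
          then have "theta_kernel \<theta>\<^sub>0 n t \<theta> \<le> c * exp (- (real n * (d / (4 * \<theta>\<^sub>0))\<^sup>2 / 8))"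
            unfolding c_def using tp 2 d th0 by (intro theta_kernel_tail) simp_all
          then have "theta_kernel \<theta>\<^sub>0 n t \<theta> * r \<theta> \<le> B"
            unfolding B_def using rR[OF 2(2,3)] r0[OF 2(1)] nonneg c by (intro mult_mono) auto
          then show ?thesis using 2 x by simp
        next
          case 3
          \<comment> \<open>\<open>t\<close> lies within a sixteenth of
            \<open>\<theta>\<^sub>0\<close>, so \<open>t / \<theta>\<close> is far above 1 here and,
            in the next case, below \<open>3 / 4\<close>. A distance of \<open>1 / 4\<close> from 1
            serves both, and \<open>(1 / 4)\<^sup>2 / 8\<close> is the \<open>1 / 128\<close> of the
            error.\<close>
          have "7 / 4 * \<theta> \<le> t" using 3 t d by linarith
          then have "7 / 4 \<le> t / \<theta>" using 3 by (simp add: pos_le_divide_eq)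
          then have "1 / 4 \<le> \<bar>t / \<theta> - 1\<bar>" by linarith
          then have "theta_kernel \<theta>\<^sub>0 n t \<theta> \<le> c * exp (- (real n * (1 / 4)\<^sup>2 / 8))"
            unfolding c_def using tp 3 by (intro theta_kernel_tail) auto
          then have "theta_kernel \<theta>\<^sub>0 n t \<theta> * r \<theta> \<le> E * r \<theta>"
            using r0[OF 3(1)] by (intro mult_right_mono) (auto simp: E_def power2_eq_square)
          then show ?thesis using 3 x by simp
        next
          case 4
          then have "\<theta> > 0" using th0 by linarith
          have "t \<le> 3 / 4 * \<theta>" using 4 t d by linarith
          then have "t / \<theta> \<le> 3 / 4" using \<open>\<theta> > 0\<close> by (simp add: pos_divide_le_eq)
          then have "1 / 4 \<le> \<bar>t / \<theta> - 1\<bar>" by linarith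
          then have "theta_kernel \<theta>\<^sub>0 n t \<theta> \<le> c * exp (- (real n * (1 / 4)\<^sup>2 / 8))"
            unfolding c_def using tp \<open>\<theta> > 0\<close> by (intro theta_kernel_tail) auto
          then have "theta_kernel \<theta>\<^sub>0 n t \<theta> * r \<theta> \<le> E * r \<theta>"
            using r0[OF \<open>\<theta> > 0\<close>] by (intro mult_right_mono) (auto simp: E_def power2_eq_square)
          then show ?thesis using \<open>\<theta> > 0\<close> x by simp
        qed
      qed
      moreover have "0 \<le> theta_kernel \<theta>\<^sub>0 n t \<theta> * (indicator {0<..} \<theta> * r \<theta>)"
        using r0 by (auto split: split_indicator)
      ultimately show ?thesis using phi0[of \<theta>] x by linarith
    qed
  qed
  have I1: "(\<integral>\<^sup>+\<theta>. ennreal ((exp \<xi> - 1) * \<phi> \<theta>) \<partial>lborel) = ennreal (exp \<xi> - 1)"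
    using s xi by (subst nn_integral_eq_integral) (auto simp: \<phi>_def)
  have I2: "(\<integral>\<^sup>+\<theta>. ennreal (4 / d\<^sup>2 * (\<phi> \<theta> * (\<theta> - m)\<^sup>2)) \<partial>lborel) = ennreal (8 * \<theta>\<^sub>0\<^sup>2 / (real n * d\<^sup>2))"
  proof -
    have hb: "has_bochner_integral lborel (\<lambda>\<theta>. \<phi> \<theta> * (\<theta> - m)\<^sup>2) (2 * \<theta>\<^sub>0\<^sup>2 / real n)"
      using normal_moment_even[OF s, of m 1] by (simp add: \<phi>_def fact_numeral s_def)
    then have "(\<integral>\<^sup>+\<theta>. ennreal (4 / d\<^sup>2 * (\<phi> \<theta> * (\<theta> - m)\<^sup>2)) \<partial>lborel) = ennreal (4 / d\<^sup>2 * (2 * \<theta>\<^sub>0\<^sup>2 / real n))"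
      using phi0 
        has_bochner_integral_integral_eq[OF has_bochner_integral_mult_right[OF hb, of "4 / d\<^sup>2"]]
        integrable.intros[OF has_bochner_integral_mult_right[OF hb, of "4 / d\<^sup>2"]]
      by (subst nn_integral_eq_integral) simp_all
    then show ?thesis by (simp add: mult.commute)
  qed
  have I3: "(\<integral>\<^sup>+\<theta>. ennreal (B * indicator {\<theta>\<^sub>0 / 2<..<2 * \<theta>\<^sub>0} \<theta>) \<partial>lborel) = ennreal (B * (3 / 2 * \<theta>\<^sub>0))"
  proof -
    have "(\<integral>\<^sup>+\<theta>. ennreal (B * indicator {\<theta>\<^sub>0 / 2<..<2 * \<theta>\<^sub>0} \<theta>) \<partial>lborel)
        = (\<integral>\<^sup>+\<theta>. ennreal B * indicator {\<theta>\<^sub>0 / 2<..<2 * \<theta>\<^sub>0} \<theta> \<partial>lborel)"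
      by (intro nn_integral_cong) (auto split: split_indicator)
    also have "\<dots> = ennreal B * ennreal (3 / 2 * \<theta>\<^sub>0)"
      using th0 by (subst nn_integral_cmult_indicator) (auto simp: algebra_simps)
    finally show ?thesis using BE th0 by (subst ennreal_mult) auto
  qed
  have I4: "(\<integral>\<^sup>+\<theta>. ennreal (E * (indicator {0<..} \<theta> * r \<theta>)) \<partial>lborel) \<le> ennreal (E * P)"
  proof -
    have eq: "ennreal (E * x) = ennreal E * ennreal x" for x by (rule ennreal_mult'[OF BE(2)])
    have "(\<integral>\<^sup>+\<theta>. ennreal (E * (indicator {0<..} \<theta> * r \<theta>)) \<partial>lborel)
        = ennreal E * (\<integral>\<^sup>+\<theta>. ennreal (indicator {0<..} \<theta> * r \<theta>) \<partial>lborel)"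
      unfolding eq by (rule nn_integral_cmult) measurable
    also have "\<dots> \<le> ennreal E * ennreal P" by (intro mult_left_mono rP) simp
    finally show ?thesis using BE nonneg by (subst ennreal_mult) auto
  qed
  have nn: "0 \<le> (exp \<xi> - 1) * \<phi> \<theta>" "0 \<le> 4 / d\<^sup>2 * (\<phi> \<theta> * (\<theta> - m)\<^sup>2)"
    "0 \<le> B * indicator {\<theta>\<^sub>0 / 2<..<2 * \<theta>\<^sub>0} \<theta>" "0 \<le> E * (indicator {0<..} \<theta> * r \<theta>)" for \<theta>
    using phi0 xi BE r0 by (auto split: split_indicator)
  have [measurable]: "\<phi> \<in> borel_measurable borel" by (simp add: \<phi>_def)
  have "(\<integral>\<^sup>+\<theta>. ennreal \<bar>theta_kernel \<theta>\<^sub>0 n t \<theta> * (indicator {0<..} \<theta> * r \<theta>) - \<phi> \<theta>\<bar> \<partial>lborel)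
      \<le> (\<integral>\<^sup>+\<theta>. ennreal ((exp \<xi> - 1) * \<phi> \<theta>) + ennreal (4 / d\<^sup>2 * (\<phi> \<theta> * (\<theta> - m)\<^sup>2))
          + ennreal (B * indicator {\<theta>\<^sub>0 / 2<..<2 * \<theta>\<^sub>0} \<theta>) + ennreal (E * (indicator {0<..} \<theta> * r \<theta>)) \<partial>lborel)"
    using nn by (intro nn_integral_mono order_trans[OF ennreal_leI[OF key]]) (simp add: ennreal_plus[symmetric] del: ennreal_plus)
  also have "\<dots> = (\<integral>\<^sup>+\<theta>. ennreal ((exp \<xi> - 1) * \<phi> \<theta>) \<partial>lborel) + (\<integral>\<^sup>+\<theta>. ennreal (4 / d\<^sup>2 * (\<phi> \<theta> * (\<theta> - m)\<^sup>2)) \<partial>lborel)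
      + (\<integral>\<^sup>+\<theta>. ennreal (B * indicator {\<theta>\<^sub>0 / 2<..<2 * \<theta>\<^sub>0} \<theta>) \<partial>lborel)
      + (\<integral>\<^sup>+\<theta>. ennreal (E * (indicator {0<..} \<theta> * r \<theta>)) \<partial>lborel)"
    by (simp add: nn_integral_add)
  also have "\<dots> \<le> ennreal (exp \<xi> - 1) + ennreal (8 * \<theta>\<^sub>0\<^sup>2 / (real n * d\<^sup>2)) + ennreal (B * (3 / 2 * \<theta>\<^sub>0)) + ennreal (E * P)"
    unfolding I1 I2 I3 by (intro add_mono I4 order_refl)
  also have "\<dots> = ennreal ((exp \<xi> - 1) + 8 * \<theta>\<^sub>0\<^sup>2 / (real n * d\<^sup>2) + B * (3 / 2 * \<theta>\<^sub>0) + E * P)"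
    using xi BE th0 nonneg by (simp add: ennreal_plus[symmetric] del: ennreal_plus)
  also have "(exp \<xi> - 1) + 8 * \<theta>\<^sub>0\<^sup>2 / (real n * d\<^sup>2) + B * (3 / 2 * \<theta>\<^sub>0) + E * P = laplace_error \<theta>\<^sub>0 n d w b R P"
    by (simp add: laplace_error_def \<xi>_def B_def E_def c_def algebra_simps)
  finally show ?thesis by (simp add: \<phi>_def s_def)
qed

text \<open>With \<open>d = n powr (e - 1 / 2)\<close> the terms of the exponent have orders
  \<open>3 * e - 1 / 2\<close>, \<open>e - 2 / 5\<close> and \<open>C1 + e - 1 / 2\<close>, all
  negative. Moreover \<open>n * d\<^sup>2 = n powr (2 * e)\<close> tends to infinity and its
  exponential beats any power of \<open>n\<close>, while \<open>C3 < 1\<close> lets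
  \<open>exp (- (n / 128))\<close> beat the prior mass term.\<close>

lemma laplace_error_tendsto_0:
  fixes \<theta>\<^sub>0 e K C1 C2 C3 :: real
  assumes th0: "\<theta>\<^sub>0 > 0" and e: "0 < e" "e \<le> 1 / 10" and C1: "C1 + e < 1 / 2" and C3: "0 < C3" "C3 < 1"
  shows "(\<lambda>n. laplace_error \<theta>\<^sub>0 n (real n powr (e - 1 / 2)) (K * real n powr (- 9 / 10)) (real n powr C1)
            (real n powr C2) (exp (real n powr C3))) \<longlonglongrightarrow> 0"
proof -
  have a1: "(\<lambda>n. real n * (real n powr (e - 1 / 2)) ^ 3) \<longlonglongrightarrow> 0" using e by real_asymp
  have a2: "(\<lambda>n. real n * (real n powr (- 9 / 10) * real n powr (e - 1 / 2))) \<longlonglongrightarrow> 0" using e by real_asymp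
  have a3: "(\<lambda>n. real n powr C1 * real n powr (e - 1 / 2)) \<longlonglongrightarrow> 0" using C1 by real_asymp
  have a4: "(\<lambda>n. 1 / (real n * (real n powr (e - 1 / 2))\<^sup>2)) \<longlonglongrightarrow> 0" using e by real_asymp
  have a5: "(\<lambda>n. sqrt (real n) * (exp (- (c * real n powr (2 * e))) * real n powr C2)) \<longlonglongrightarrow> 0" if "c > 0" for c
    using e that by real_asymp
  have a6: "(\<lambda>n. sqrt (real n) * (exp (- (real n / 128)) * exp (real n powr C3))) \<longlonglongrightarrow> 0"
    using C3 by real_asymp
  define k where "k = 1 / sqrt (4 * pi * \<theta>\<^sub>0\<^sup>2)"
  define c where "c = 1 / (128 * \<theta>\<^sub>0\<^sup>2)"
  have c: "c > 0" using th0 by (simp add: c_def)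
  let ?F = "\<lambda>n. (exp (31 / \<theta>\<^sub>0 ^ 3 * (real n * (real n powr (e - 1 / 2)) ^ 3)
        + K / \<theta>\<^sub>0\<^sup>2 * (real n * (real n powr (- 9 / 10) * real n powr (e - 1 / 2)))
        + real n powr C1 * real n powr (e - 1 / 2)) - 1)
      + 8 * \<theta>\<^sub>0\<^sup>2 * (1 / (real n * (real n powr (e - 1 / 2))\<^sup>2))
      + (k * (3 / 2 * \<theta>\<^sub>0) * (sqrt (real n) * (exp (- (c * real n powr (2 * e))) * real n powr C2))
       + k * (sqrt (real n) * (exp (- (real n / 128)) * exp (real n powr C3))))"
  have "?F
    \<longlonglongrightarrow> (exp (31 / \<theta>\<^sub>0 ^ 3 * 0 + K / \<theta>\<^sub>0\<^sup>2 * 0 + 0) - 1) + 8 * \<theta>\<^sub>0\<^sup>2 * 0 + (k * (3 / 2 * \<theta>\<^sub>0) * 0 + k * 0)"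
    by (intro tendsto_add tendsto_diff tendsto_exp tendsto_mult tendsto_const a1 a2 a3 a4 a5[OF c] a6)
  also have "(exp (31 / \<theta>\<^sub>0 ^ 3 * 0 + K / \<theta>\<^sub>0\<^sup>2 * 0 + 0) - 1) + 8 * \<theta>\<^sub>0\<^sup>2 * 0 + (k * (3 / 2 * \<theta>\<^sub>0) * 0 + k * 0) = 0"
    by simp
  finally show ?thesis
  proof (rule Lim_transform_eventually)
    show "\<forall>\<^sub>F n in sequentially. ?F n
     = laplace_error \<theta>\<^sub>0 n (real n powr (e - 1 / 2)) (K * real n powr (- 9 / 10)) (real n powr C1)
            (real n powr C2) (exp (real n powr C3))"
      using eventually_gt_at_top[of 0]
    proof eventually_elim
      case (elim n)
      have "real n * (real n powr (e - 1 / 2) / (4 * \<theta>\<^sub>0))\<^sup>2 / 8 = c * (real n powr 1 * (real n powr (e - 1 / 2) * real n powr (e - 1 / 2)))"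
        using elim by (simp add: c_def power2_eq_square)
      also have "real n powr 1 * (real n powr (e - 1 / 2) * real n powr (e - 1 / 2)) = real n powr (2 * e)"
        unfolding powr_add[symmetric] by simp
      finally have *: "real n * (real n powr (e - 1 / 2) / (4 * \<theta>\<^sub>0))\<^sup>2 / 8 = c * real n powr (2 * e)" .
      have k: "sqrt (real n / (4 * pi * \<theta>\<^sub>0\<^sup>2)) = k * sqrt (real n)" by (simp add: k_def real_sqrt_divide)
      show ?case
        unfolding laplace_error_def * k by (simp add: algebra_simps)
    qed
  qed
qed

section \<open>The profile likelihood and its limit\<close>

text \<open>With \<open>x = n (1 - exp (- \<alpha> / n))\<close> and \<open>D = A\<^sub>1 - 2 A\<^sub>2 + A\<^sub>3\<close>, the argument of the logarithm in
  \<^const>\<open>log_lik_tilde\<close> is \<open>D (1 + (x\<^sup>2 - 2 u x) / (n v))\<close>, where \<open>u\<close>, \<open>v\<close> are the values of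
  \<^const>\<open>u_star\<close>, \<^const>\<open>v_star\<close>. This is where the two statistics come from.\<close>

definition lag :: "nat \<Rightarrow> real \<Rightarrow> real" where
  "lag n \<alpha> = real n * (1 - exp (- \<alpha> / real n))"

text \<open>The profile likelihood up to a factor free of \<alpha>, chosen such that the logarithm
  vanishes at \<open>\<alpha> = 0\<close> and the square root tends to
  \<open>sqrt \<alpha>\<close>.\<close>

definition profile_weight :: "nat \<Rightarrow> real \<Rightarrow> real \<Rightarrow> real \<Rightarrow> real" where
  "profile_weight n u v \<alpha> = sqrt (real n / 2 * (1 - exp (- 2 * \<alpha> / real n)))
     * exp (- (real n / 2 * ln (1 + ((lag n \<alpha>)\<^sup>2 - 2 * u * lag n \<alpha>) / (real n * v))))"

text \<open>The weight in \<open>star_posterior\<close> times the constant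
  \<open>exp (u\<^sup>2 / (2 * v))\<close>, which makes it the limit of
  \<open>profile_weight\<close> without rescaling.\<close>

definition limit_weight :: "real \<Rightarrow> real \<Rightarrow> real \<Rightarrow> real" where
  "limit_weight u v \<alpha> = sqrt \<alpha> * exp (- ((\<alpha>\<^sup>2 - 2 * u * \<alpha>) / (2 * v)))"

lemma measurable_weights [measurable]:
  "profile_weight n u v \<in> borel_measurable borel" "limit_weight u v \<in> borel_measurable borel"
  unfolding profile_weight_def limit_weight_def lag_def by measurable

lemma lag_bounds:
  assumes "n > 0" "\<alpha> \<ge> 0"
  shows "0 \<le> lag n \<alpha>" "lag n \<alpha> \<le> \<alpha>" "\<alpha> - lag n \<alpha> \<le> \<alpha>\<^sup>2 / (2 * real n)"
proof -
  have z: "\<alpha> / real n \<ge> 0" using assms by simp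
  show "0 \<le> lag n \<alpha>" using assms by (simp add: lag_def)
  have "real n * (1 - exp (- (\<alpha> / real n))) \<le> real n * (\<alpha> / real n)"
    using one_minus_exp_bounds(2)[OF z] by (intro mult_left_mono) auto
  then show "lag n \<alpha> \<le> \<alpha>" using assms by (simp add: lag_def)
  have "real n * (1 - exp (- (\<alpha> / real n))) \<ge> real n * (\<alpha> / real n - (\<alpha> / real n)\<^sup>2 / 2)"
    using one_minus_exp_bounds(1)[OF z] by (intro mult_left_mono) auto
  also have "real n * (\<alpha> / real n - (\<alpha> / real n)\<^sup>2 / 2) = \<alpha> - \<alpha>\<^sup>2 / (2 * real n)"
    using assms by (simp add: field_simps power2_eq_square)
  finally show "\<alpha> - lag n \<alpha> \<le> \<alpha>\<^sup>2 / (2 * real n)" by (simp add: lag_def)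
qed

lemma square_div_le_cube:
  fixes u v K :: real
  assumes "K > 0" "\<bar>u\<bar> \<le> K" "v > 0" "1 / v \<le> K"
  shows "u\<^sup>2 / v \<le> K ^ 3"
proof -
  have "\<bar>u\<bar>\<^sup>2 * (1 / v) \<le> K\<^sup>2 * K" using assms by (intro mult_mono power_mono) auto
  then show ?thesis by (simp add: power3_eq_cube power2_eq_square)
qed

lemma quadratic_lower_bound:
  fixes u v x :: real
  assumes "v > 0" "N > 0"
  shows "- (u\<^sup>2 / v / N) \<le> (x\<^sup>2 - 2 * u * x) / (N * v)"
proof -
  have "0 \<le> (x - u)\<^sup>2" by simp
  then have "- u\<^sup>2 \<le> x\<^sup>2 - 2 * u * x" by (simp add: power2_eq_square algebra_simps)
  then have "- u\<^sup>2 / (N * v) \<le> (x\<^sup>2 - 2 * u * x) / (N * v)" using assms by (intro divide_right_mono) auto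
  then show ?thesis by (simp add: mult.commute)
qed

text \<open>From \<open>n \<ge> 2 * K ^ 3\<close> on, the argument of the logarithm is at least
  \<open>1 / 2\<close> for every lag and all \<open>u\<close>, \<open>v\<close> bounded by
  \<open>K\<close>. This is the origin of the threshold that recurs below.\<close>

lemma profile_argument_pos:
  fixes u v K x :: real
  assumes "K > 0" "\<bar>u\<bar> \<le> K" "v > 0" "1 / v \<le> K" "real n \<ge> 2 * K ^ 3" "n > 0"
  shows "1 + (x\<^sup>2 - 2 * u * x) / (real n * v) \<ge> 1 - u\<^sup>2 / v / real n" "u\<^sup>2 / v / real n \<le> 1 / 2"
proof -
  show "1 + (x\<^sup>2 - 2 * u * x) / (real n * v) \<ge> 1 - u\<^sup>2 / v / real n"
    using quadratic_lower_bound[of v "real n" u x] assms by simp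
  have "u\<^sup>2 / v / real n \<le> K ^ 3 / (2 * K ^ 3)"
    using square_div_le_cube[OF assms(1-4)] assms by (intro frac_le) auto
  then show "u\<^sup>2 / v / real n \<le> 1 / 2" using assms by simp
qed

text \<open>The minimum of the quadratic over the lag gives \<open>1 - s\<close> with
  \<open>s = u\<^sup>2 / v / n \<le> 1 / 2\<close>. There \<open>ln (1 - s) \<ge> - (2 * s)\<close>,
  so the exponent is at most \<open>n * s = u\<^sup>2 / v \<le> K ^ 3\<close>, for every
  \<alpha>.\<close>

lemma profile_weight_bounds:
  assumes K: "K > 0" "\<bar>u\<bar> \<le> K" "v > 0" "1 / v \<le> K" "real n \<ge> 2 * K ^ 3" "n > 0" and a: "\<alpha> \<ge> 0"
  shows "0 \<le> profile_weight n u v \<alpha>" "profile_weight n u v \<alpha> \<le> exp (K ^ 3) * sqrt \<alpha>"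
proof -
  let ?q = "((lag n \<alpha>)\<^sup>2 - 2 * u * lag n \<alpha>) / (real n * v)"
  define s where "s = u\<^sup>2 / v / real n"
  have e1: "exp (- 2 * \<alpha> / real n) \<le> 1" using a by simp
  then show "0 \<le> profile_weight n u v \<alpha>" unfolding profile_weight_def
    by (intro mult_nonneg_nonneg) auto
  have "1 - exp (- (2 * \<alpha> / real n)) \<le> 2 * \<alpha> / real n"
    using a by (intro one_minus_exp_bounds) simp
  from mult_left_mono[OF this, of "real n / 2"] K(6)
  have "real n / 2 * (1 - exp (- 2 * \<alpha> / real n)) \<le> \<alpha>" by simp
  then have 1: "sqrt (real n / 2 * (1 - exp (- 2 * \<alpha> / real n))) \<le> sqrt \<alpha>" by simp
  have pos: "1 + ?q \<ge> 1 - s" "s \<le> 1 / 2"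
    using profile_argument_pos(1)[OF K(1-6), where x = "lag n \<alpha>"] profile_argument_pos(2)[OF K(1-6)]
    by (simp_all add: s_def)
  have s0: "s \<ge> 0" using K by (simp add: s_def)
  have "- s - 2 * s\<^sup>2 \<le> ln (1 - s)" by (rule ln_one_minus_pos_lower_bound) (use pos s0 in auto)
  moreover have "2 * s\<^sup>2 \<le> s"
    using mult_left_mono[OF pos(2) s0] by (simp add: power2_eq_square)
  moreover have "ln (1 - s) \<le> ln (1 + ?q)" using pos by (subst ln_le_cancel_iff) auto
  ultimately have "- (2 * s) \<le> ln (1 + ?q)" by linarith
  then have "real n / 2 * (- (2 * s)) \<le> real n / 2 * ln (1 + ?q)" by (intro mult_left_mono) auto
  moreover have "real n / 2 * (- (2 * s)) = - (u\<^sup>2 / v)" using K by (simp add: s_def)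
  ultimately have "- (real n / 2 * ln (1 + ?q)) \<le> K ^ 3" using square_div_le_cube[OF K(1-4)] by linarith
  then have "exp (- (real n / 2 * ln (1 + ?q))) \<le> exp (K ^ 3)" by simp
  from mult_mono[OF 1 this] a show "profile_weight n u v \<alpha> \<le> exp (K ^ 3) * sqrt \<alpha>"
    unfolding profile_weight_def by (simp add: mult.commute)
qed

text \<open>The upper bound serves domination. The lower bound contains neither \<open>u\<close> nor
  \<open>v\<close>, so it bounds the mass of the limit uniformly over regular samples.\<close>

lemma limit_weight_bounds:
  assumes K: "K > 0" "\<bar>u\<bar> \<le> K" "v > 0" "1 / v \<le> K" and a: "\<alpha> \<ge> 0"
  shows "0 \<le> limit_weight u v \<alpha>" "limit_weight u v \<alpha> \<le> exp (K ^ 3) * sqrt \<alpha>"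
    and "exp (- (K * (\<alpha>\<^sup>2 + 2 * K * \<alpha>))) * sqrt \<alpha> \<le> limit_weight u v \<alpha>"
proof -
  show "0 \<le> limit_weight u v \<alpha>" using a by (simp add: limit_weight_def)
  have "- (u\<^sup>2 / v / 2) \<le> (\<alpha>\<^sup>2 - 2 * u * \<alpha>) / (2 * v)"
    using quadratic_lower_bound[of v 2 u \<alpha>] K by simp
  moreover have "u\<^sup>2 / v / 2 \<le> K ^ 3"
  proof -
    have "0 \<le> u\<^sup>2 / v" using K by simp
    moreover have "t / 2 \<le> K ^ 3" if "0 \<le> t" "t \<le> K ^ 3" for t using that by linarith
    ultimately show ?thesis using square_div_le_cube[OF K(1-4)] by blast
  qed
  ultimately have "exp (- ((\<alpha>\<^sup>2 - 2 * u * \<alpha>) / (2 * v))) \<le> exp (K ^ 3)" by simp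
  from mult_right_mono[OF this, of "sqrt \<alpha>"] a show "limit_weight u v \<alpha> \<le> exp (K ^ 3) * sqrt \<alpha>"
    by (simp add: limit_weight_def mult.commute)
  have "\<alpha>\<^sup>2 - 2 * u * \<alpha> \<le> \<alpha>\<^sup>2 + 2 * K * \<alpha>"
  proof -
    have "- u \<le> K" using K by linarith
    from mult_right_mono[OF this a] show ?thesis by (simp add: mult.commute)
  qed
  then have "(\<alpha>\<^sup>2 - 2 * u * \<alpha>) * (1 / (2 * v)) \<le> (\<alpha>\<^sup>2 + 2 * K * \<alpha>) * K"
  proof -
    have "(\<alpha>\<^sup>2 - 2 * u * \<alpha>) * (1 / (2 * v)) \<le> (\<alpha>\<^sup>2 + 2 * K * \<alpha>) * (1 / (2 * v))"
      using \<open>\<alpha>\<^sup>2 - 2 * u * \<alpha> \<le> _\<close> K by (intro mult_right_mono) auto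
    also have "\<dots> \<le> (\<alpha>\<^sup>2 + 2 * K * \<alpha>) * K"
      using K a by (intro mult_left_mono) (auto simp: field_simps)
    finally show ?thesis .
  qed
  then have "exp (- (K * (\<alpha>\<^sup>2 + 2 * K * \<alpha>))) \<le> exp (- ((\<alpha>\<^sup>2 - 2 * u * \<alpha>) / (2 * v)))"
    by (simp add: mult.commute)
  from mult_right_mono[OF this, of "sqrt \<alpha>"] a show "exp (- (K * (\<alpha>\<^sup>2 + 2 * K * \<alpha>))) * sqrt \<alpha> \<le> limit_weight u v \<alpha>"
    by (simp add: limit_weight_def mult.commute)
qed

text \<open>The truncation at \<open>1\<close> keeps the gap dominated by a constant, which dominated convergence needs.\<close>

definition weight_gap :: "real \<Rightarrow> nat \<Rightarrow> real \<Rightarrow> real" where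
  "weight_gap K n \<alpha> = exp (K ^ 3) *
     (if 2 * \<alpha> \<le> real n \<and> 2 * (K * (\<alpha>\<^sup>2 + 2 * K * \<alpha>)) \<le> real n
      then min 1 (exp ((\<alpha> + (K * (\<alpha>\<^sup>2 + 2 * K * \<alpha>))\<^sup>2 + K * (\<alpha> + K) * \<alpha>\<^sup>2) / real n) - 1) else 1)"

lemma measurable_weight_gap [measurable]: "weight_gap K n \<in> borel_measurable borel"
  unfolding weight_gap_def by measurable

lemma weight_gap_bounds:
  assumes "K > 0" "\<alpha> \<ge> 0"
  shows "0 \<le> weight_gap K n \<alpha>" "weight_gap K n \<alpha> \<le> exp (K ^ 3)"
  using assms by (auto simp: weight_gap_def)

lemma weight_gap_tendsto_0: "(\<lambda>n. weight_gap K n \<alpha>) \<longlonglongrightarrow> 0"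
proof -
  have "(\<lambda>n. exp (K ^ 3) * min 1 (exp (c / real n) - 1)) \<longlonglongrightarrow> exp (K ^ 3) * min 1 (exp 0 - 1)" for c :: real
    by (intro tendsto_mult tendsto_min tendsto_diff tendsto_exp tendsto_const lim_const_over_n)
  then have lim: "(\<lambda>n. exp (K ^ 3) * min 1 (exp (c / real n) - 1)) \<longlonglongrightarrow> 0" for c :: real by simp
  have "\<forall>\<^sub>F n in sequentially. c \<le> real n" for c
    using filterlim_real_sequentially by (simp add: filterlim_at_top)
  from eventually_conj[OF this[of "2 * \<alpha>"] this[of "2 * (K * (\<alpha>\<^sup>2 + 2 * K * \<alpha>))"]]
  have "\<forall>\<^sub>F n in sequentially. exp (K ^ 3) * min 1 (exp ((\<alpha> + (K * (\<alpha>\<^sup>2 + 2 * K * \<alpha>))\<^sup>2 + K * (\<alpha> + K) * \<alpha>\<^sup>2) / real n) - 1)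
     = weight_gap K n \<alpha>"
    by eventually_elim (simp add: weight_gap_def)
  then show ?thesis by (rule Lim_transform_eventually[OF lim])
qed

text \<open>Once \<open>n\<close> is large compared with \<alpha>, the quotient of the weights is
  \<open>exp w\<close>, where \<open>w\<close> has three sources matching the three summands of
  \<open>c\<close>: the square root factor, the linearization of the logarithm, and the replacement
  of the lag by \<alpha>. For smaller \<open>n\<close> the common upper bound of the two weights is
  used.\<close>

lemma weight_difference:
  assumes K: "K > 0" "\<bar>u\<bar> \<le> K" "v > 0" "1 / v \<le> K" "real n \<ge> 2 * K ^ 3" "n > 0" and a: "\<alpha> > 0"
  shows "\<bar>profile_weight n u v \<alpha> - limit_weight u v \<alpha>\<bar> \<le> weight_gap K n \<alpha> * sqrt \<alpha>"
proof -
  define B where "B = K * (\<alpha>\<^sup>2 + 2 * K * \<alpha>)"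
  define c where "c = \<alpha> + B\<^sup>2 + K * (\<alpha> + K) * \<alpha>\<^sup>2"
  have a0: "\<alpha> \<ge> 0" using a by simp
  note pw = profile_weight_bounds[OF K a0] and lw = limit_weight_bounds[OF K(1-4) a0]
  have le1: "\<bar>profile_weight n u v \<alpha> - limit_weight u v \<alpha>\<bar> \<le> exp (K ^ 3) * sqrt \<alpha>"
    using pw lw by linarith
  show ?thesis
  proof (cases "2 * \<alpha> \<le> real n \<and> 2 * B \<le> real n")
    case False
    then have "weight_gap K n \<alpha> = exp (K ^ 3)"
      unfolding weight_gap_def B_def by (simp only: if_False mult_1_right)
    then show ?thesis using le1 by simp
  next
    case True
    define x where "x = lag n \<alpha>"
    define z where "z = \<alpha> / real n"
    define q where "q = (x\<^sup>2 - 2 * u * x) / v"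
    define q0 where "q0 = (\<alpha>\<^sup>2 - 2 * u * \<alpha>) / v"
    have z: "0 < z" "z \<le> 1 / 2" using True a K by (auto simp: z_def field_simps)
    have x: "0 \<le> x" "x \<le> \<alpha>" "\<alpha> - x \<le> \<alpha>\<^sup>2 / (2 * real n)"
      using lag_bounds[OF K(6) a0] by (auto simp: x_def)
    have iv: "\<bar>y / v\<bar> \<le> K * \<bar>y\<bar>" for y
      using mult_right_mono[OF K(4), of "\<bar>y\<bar>"] K by (simp add: abs_of_pos)
    have qB: "\<bar>q\<bar> \<le> B"
    proof -
      have "x\<^sup>2 \<le> \<alpha>\<^sup>2" using x by (intro power_mono) auto
      moreover have "\<bar>2 * u * x\<bar> \<le> 2 * K * \<alpha>" using x K by (auto simp: abs_mult intro!: mult_mono)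
      ultimately have "\<bar>x\<^sup>2 - 2 * u * x\<bar> \<le> \<alpha>\<^sup>2 + 2 * K * \<alpha>"
        using abs_triangle_ineq4[of "x\<^sup>2" "2 * u * x"] by simp
      then have "K * \<bar>x\<^sup>2 - 2 * u * x\<bar> \<le> B" using K by (simp add: B_def)
      with iv[of "x\<^sup>2 - 2 * u * x"] show ?thesis by (simp add: q_def)
    qed
    have qn: "\<bar>q / real n\<bar> \<le> 1 / 2" using qB True K by (simp add: divide_le_eq)
    have e1: "\<bar>real n / 2 * ln (1 + q / real n) - q / 2\<bar> \<le> B\<^sup>2 / real n"
    proof -
      have "\<bar>ln (1 + q / real n) - q / real n\<bar> \<le> 2 * (q / real n)\<^sup>2"
        by (rule abs_ln_one_plus_x_minus_x_bound[OF qn])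
      then have "real n / 2 * \<bar>ln (1 + q / real n) - q / real n\<bar> \<le> real n / 2 * (2 * (q / real n)\<^sup>2)"
        by (intro mult_left_mono) auto
      also have "\<dots> = q\<^sup>2 / real n" using K by (simp add: power2_eq_square)
      also have "\<dots> \<le> B\<^sup>2 / real n"
        using qB by (intro divide_right_mono) (auto simp: power2_le_iff_abs_le)
      also have "real n / 2 * \<bar>ln (1 + q / real n) - q / real n\<bar> = \<bar>real n / 2 * (ln (1 + q / real n) - q / real n)\<bar>"
        by (simp add: abs_mult)
      finally show ?thesis using K by (simp add: right_diff_distrib)
    qed
    have e2: "\<bar>q / 2 - q0 / 2\<bar> \<le> K * (\<alpha> + K) * \<alpha>\<^sup>2 / real n"
    proof -
      have "q - q0 = ((x - \<alpha>) * (x + \<alpha> - 2 * u)) / v"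
        by (simp add: q_def q0_def diff_divide_distrib[symmetric] power2_eq_square algebra_simps)
      then have "\<bar>q - q0\<bar> \<le> K * (\<bar>x - \<alpha>\<bar> * \<bar>x + \<alpha> - 2 * u\<bar>)" using iv[of "(x - \<alpha>) * (x + \<alpha> - 2 * u)"] by (simp only: abs_mult)
      also have "\<dots> \<le> K * (\<alpha>\<^sup>2 / (2 * real n) * (2 * (\<alpha> + K)))"
        using x K a by (intro mult_left_mono mult_mono) auto
      also have "\<dots> = K * (\<alpha> + K) * \<alpha>\<^sup>2 / real n" using K by (simp add: field_simps)
      finally show ?thesis by linarith
    qed
    define y where "y = ln ((1 - exp (- (2 * z))) / (2 * z))"
    \<comment> \<open>\<open>y\<close> is the logarithm of the ratio of
      \<open>1 - exp (- (2 * z))\<close> to its linearization; it is halved because the ratio stands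
      under a square root.\<close>
    have e3: "\<bar>y / 2\<bar> \<le> z"
    proof -
      have r: "1 - z \<le> (1 - exp (- (2 * z))) / (2 * z)" "(1 - exp (- (2 * z))) / (2 * z) \<le> 1"
        using one_minus_exp_bounds[of "2 * z"] z by (auto simp: field_simps power2_eq_square)
      then have "ln (1 - z) \<le> y" "y \<le> 0"
        unfolding y_def using z by (subst ln_le_cancel_iff ln_le_zero_iff; linarith)+
      moreover have "- z - 2 * z\<^sup>2 \<le> ln (1 - z)" using z by (intro ln_one_minus_pos_lower_bound) auto
      moreover have "2 * z\<^sup>2 \<le> z" using z mult_left_mono[of z "1/2" z] by (simp add: power2_eq_square)
      ultimately show ?thesis by linarith
    qed
    define w where "w = y / 2 - (real n / 2 * ln (1 + q / real n) - q / 2) - (q / 2 - q0 / 2)"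
    have wc: "\<bar>w\<bar> \<le> c / real n"
      using e1 e2 e3 unfolding w_def c_def z_def add_divide_distrib by linarith
    have "profile_weight n u v \<alpha> = limit_weight u v \<alpha> * exp w"
    proof -
      have rp: "(1 - exp (- (2 * z))) / (2 * z) > 0" using z by simp
      have "sqrt (real n / 2 * (1 - exp (- 2 * \<alpha> / real n))) = sqrt (\<alpha> * ((1 - exp (- (2 * z))) / (2 * z)))"
        using K a by (simp add: z_def)
      also have "\<dots> = sqrt \<alpha> * exp (y / 2)"
      proof -
        have "exp (y / 2) = sqrt ((1 - exp (- (2 * z))) / (2 * z))"
          unfolding y_def ln_sqrt[OF less_imp_le[OF rp], symmetric] using rp by (intro exp_ln) simp
        then show ?thesis by (simp only: real_sqrt_mult)
      qed
      finally have 1: "sqrt (real n / 2 * (1 - exp (- 2 * \<alpha> / real n))) = sqrt \<alpha> * exp (y / 2)" .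
      have 2: "((lag n \<alpha>)\<^sup>2 - 2 * u * lag n \<alpha>) / (real n * v) = q / real n"
        by (simp add: q_def x_def mult.commute)
      have 3: "(\<alpha>\<^sup>2 - 2 * u * \<alpha>) / (2 * v) = q0 / 2" by (simp add: q0_def)
      show ?thesis
        unfolding profile_weight_def limit_weight_def 1 2 3
        by (simp add: mult.assoc exp_add[symmetric] w_def)
    qed
    then have "\<bar>profile_weight n u v \<alpha> - limit_weight u v \<alpha>\<bar> = limit_weight u v \<alpha> * \<bar>exp w - 1\<bar>"
    proof -
      have "limit_weight u v \<alpha> * exp w - limit_weight u v \<alpha> = limit_weight u v \<alpha> * (exp w - 1)"
        by (simp add: right_diff_distrib)
      then show ?thesis using lw(1) \<open>profile_weight n u v \<alpha> = _\<close> by (simp add: abs_mult)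
    qed
    also have "\<dots> \<le> (exp (K ^ 3) * sqrt \<alpha>) * (exp (c / real n) - 1)"
      using lw abs_exp_minus_one_le[OF wc] a by (intro mult_mono) auto
    finally show ?thesis using le1 True
      by (simp add: weight_gap_def B_def c_def min_def mult_ac)
  qed
qed

lemma stat_polynomial:
  assumes n: "n > 0" and v: "v_star n y > 0"
  shows "stat_A1 n y * b\<^sup>2 - 2 * stat_A2 n y * b + stat_A3 n y
     = quad_var n y * (1 + ((real n * (1 - b))\<^sup>2 - 2 * u_star n y * (real n * (1 - b))) / (real n * v_star n y))"
    and "stat_A1 n y > 0" "quad_var n y > 0"
proof -
  \<comment> \<open>Division by zero would make \<open>v_star\<close> equal to 0.\<close>
  have A1: "stat_A1 n y \<noteq> 0" using v by (auto simp: v_star_def)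
  moreover have "stat_A1 n y \<ge> 0" by (simp add: stat_A1_def sum_nonneg)
  ultimately show A1p: "stat_A1 n y > 0" by simp
  have nv: "real n * v_star n y = (real n)\<^sup>2 * quad_var n y / stat_A1 n y"
    by (simp add: v_star_def quad_var_def power2_eq_square)
  then have "(real n)\<^sup>2 * quad_var n y / stat_A1 n y > 0" using n v by (metis of_nat_0_less_iff zero_less_mult_iff)
  then show D: "quad_var n y > 0" using A1p n by (simp add: zero_less_divide_iff zero_less_mult_iff)
  have "quad_var n y * (((real n * (1 - b))\<^sup>2 - 2 * u_star n y * (real n * (1 - b))) / (real n * v_star n y))
      = stat_A1 n y * (1 - b)\<^sup>2 - 2 * (stat_A1 n y - stat_A2 n y) * (1 - b)"
    unfolding nv u_star_def using A1p D n by (simp add: field_simps power2_eq_square)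
  then show "stat_A1 n y * b\<^sup>2 - 2 * stat_A2 n y * b + stat_A3 n y
     = quad_var n y * (1 + ((real n * (1 - b))\<^sup>2 - 2 * u_star n y * (real n * (1 - b))) / (real n * v_star n y))"
    by (simp only: distrib_left mult_1_right) (simp add: quad_var_def power2_eq_square algebra_simps)
qed

text \<open>For fixed \<alpha> the likelihood in \<theta> is maximal at
  \<open>t = theta_tilde n y \<alpha>\<close>, and the kernel is the quotient by the maximum. In the
  logarithm of the maximum, \<open>- (n / 2) * ln t\<close> contributes \<open>n / 2\<close> times
  \<open>ln (1 - b\<^sup>2)\<close> and the determinant \<open>- (n - 1) / 2\<close> times it; the
  surplus of \<open>1 / 2\<close> is the last term of \<open>log_lik_tilde\<close>, while the powers
  of \<alpha> cancel.\<close>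

lemma log_lik_factorization:
  fixes \<theta> \<alpha> :: real
  assumes n: "n \<ge> 2" and v: "v_star n y > 0" and th0: "\<theta>\<^sub>0 > 0" and th: "\<theta> > 0" and a: "\<alpha> > 0"
    and pos: "1 + ((lag n \<alpha>)\<^sup>2 - 2 * u_star n y * lag n \<alpha>) / (real n * v_star n y) > 0"
  shows "exp (log_lik_tilde n y \<alpha>)
     = exp (- (real n / 2 * ln (quad_var n y))) * sqrt (2 / real n) * profile_weight n (u_star n y) (v_star n y) \<alpha>"
    and "exp (log_lik n y (\<theta> / \<alpha>) \<alpha>)
     = exp (real n / 2 * ln (real n) - real n / 2) / sqrt (real n / (4 * pi * \<theta>\<^sub>0\<^sup>2)) * exp (log_lik_tilde n y \<alpha>)
       * theta_kernel \<theta>\<^sub>0 n (theta_tilde n y \<alpha>) \<theta>"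
    and "theta_tilde n y \<alpha> > 0"
proof -
  define b where "b = exp (- \<alpha> / real n)"
  define D where "D = stat_A1 n y * b\<^sup>2 - 2 * stat_A2 n y * b + stat_A3 n y"
  have npos: "real n > 0" using n by simp
  have b2: "b\<^sup>2 = exp (- 2 * \<alpha> / real n)" by (simp add: b_def exp_double[symmetric])
  have c: "0 < 1 - b\<^sup>2" using a npos by (simp add: b2)
  have Dq: "D = quad_var n y * (1 + ((lag n \<alpha>)\<^sup>2 - 2 * u_star n y * lag n \<alpha>) / (real n * v_star n y))"
    using stat_polynomial(1)[of n y b] n v by (simp add: D_def lag_def b_def)
  have q0: "quad_var n y > 0" using stat_polynomial(3)[of n y] n v by simp
  have D0: "D > 0" using q0 pos by (simp add: Dq)
  have t: "theta_tilde n y \<alpha> = \<alpha> * (D / (1 - b\<^sup>2)) / real n"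
    using det_corr_mat_and_quad_form(3)[OF n a, of y] by (simp add: theta_tilde_def D_def b_def)
  show tp: "theta_tilde n y \<alpha> > 0" unfolding t using a D0 c npos by simp
  have lt: "log_lik_tilde n y \<alpha> = - (real n / 2) * ln D + 1 / 2 * ln (1 - b\<^sup>2)"
    unfolding log_lik_tilde_def D_def b2 unfolding b_def ..
  have "exp (1 / 2 * ln (1 - b\<^sup>2)) = sqrt (1 - b\<^sup>2)"
  proof -
    have "1 / 2 * ln (1 - b\<^sup>2) = ln (sqrt (1 - b\<^sup>2))" using c by (simp add: ln_sqrt)
    then show ?thesis using c by (simp only: exp_ln real_sqrt_gt_zero)
  qed
  also have "\<dots> = sqrt (2 / real n * (real n / 2 * (1 - b\<^sup>2)))" using npos by simp
  also have "\<dots> = sqrt (2 / real n) * sqrt (real n / 2 * (1 - b\<^sup>2))" by (rule real_sqrt_mult)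
  finally have s: "exp (1 / 2 * ln (1 - b\<^sup>2)) = sqrt (2 / real n) * sqrt (real n / 2 * (1 - b\<^sup>2))" .
  have "ln D = ln (quad_var n y) + ln (1 + ((lag n \<alpha>)\<^sup>2 - 2 * u_star n y * lag n \<alpha>) / (real n * v_star n y))"
    unfolding Dq using q0 pos by (rule ln_mult_pos)
  then have E: "exp (- (real n / 2) * ln D) = exp (- (real n / 2 * ln (quad_var n y)))
     * exp (- (real n / 2 * ln (1 + ((lag n \<alpha>)\<^sup>2 - 2 * u_star n y * lag n \<alpha>) / (real n * v_star n y))))"
    by (simp add: exp_add[symmetric] algebra_simps)
  show "exp (log_lik_tilde n y \<alpha>)
     = exp (- (real n / 2 * ln (quad_var n y))) * sqrt (2 / real n) * profile_weight n (u_star n y) (v_star n y) \<alpha>"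
    unfolding lt exp_add s profile_weight_def b2[symmetric] E by (simp only: mult_ac)
  have "log_lik n y (\<theta> / \<alpha>) \<alpha> = - (real n / 2) * (theta_tilde n y \<alpha> / \<theta>) - real n / 2 * (ln \<theta> - ln \<alpha>)
      - 1 / 2 * ((real n - 1) * ln (1 - b\<^sup>2))"
  proof -
    have "ln (Determinant.det (corr_mat n \<alpha>)) = (real n - 1) * ln (1 - b\<^sup>2)"
      using n c unfolding det_corr_mat_and_quad_form(1)[OF n a, folded b_def] by (simp add: ln_realpow of_nat_diff)
    moreover have "1 / (2 * (\<theta> / \<alpha>)) * quad_form n y \<alpha> = real n / 2 * (theta_tilde n y \<alpha> / \<theta>)"
      using th a npos by (simp add: theta_tilde_def)
    moreover have "ln (\<theta> / \<alpha>) = ln \<theta> - ln \<alpha>" using th a by (simp add: ln_div)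
    ultimately show ?thesis by (simp add: log_lik_def)
  qed
  also have "\<dots> = real n / 2 * ln (real n) - real n / 2 + log_lik_tilde n y \<alpha>
      + real n / 2 * (1 + ln (theta_tilde n y \<alpha> / \<theta>) - theta_tilde n y \<alpha> / \<theta>)"
  proof -
    have "ln (theta_tilde n y \<alpha> / \<theta>) = ln \<alpha> + (ln D - ln (1 - b\<^sup>2)) - ln (real n) - ln \<theta>"
    proof -
      have "ln (theta_tilde n y \<alpha> / \<theta>) = ln (theta_tilde n y \<alpha>) - ln \<theta>" using tp th by (simp add: ln_div)
      also have "ln (theta_tilde n y \<alpha>) = ln \<alpha> + (ln D - ln (1 - b\<^sup>2)) - ln (real n)"
        unfolding t using a D0 c npos by (simp add: ln_div ln_mult)
      finally show ?thesis .
    qed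
    then show ?thesis unfolding lt \<open>ln (theta_tilde n y \<alpha> / \<theta>) = _\<close> by (simp add: algebra_simps add_divide_distrib diff_divide_distrib)
  qed
  finally have "exp (log_lik n y (\<theta> / \<alpha>) \<alpha>) = exp (real n / 2 * ln (real n) - real n / 2) * exp (log_lik_tilde n y \<alpha>)
      * exp (real n / 2 * (1 + ln (theta_tilde n y \<alpha> / \<theta>) - theta_tilde n y \<alpha> / \<theta>))"
    by (simp only: exp_add)
  then show "exp (log_lik n y (\<theta> / \<alpha>) \<alpha>)
     = exp (real n / 2 * ln (real n) - real n / 2) / sqrt (real n / (4 * pi * \<theta>\<^sub>0\<^sup>2)) * exp (log_lik_tilde n y \<alpha>)
       * theta_kernel \<theta>\<^sub>0 n (theta_tilde n y \<alpha>) \<theta>"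
    unfolding theta_kernel_def using th0 npos by simp
qed

text \<open>\<open>theta_tilde\<close> is \<open>D / 2\<close> times \<open>r * (1 + q)\<close>,
  where \<open>r\<close> compares \<open>2 * z\<close> with \<open>1 - exp (- (2 * z))\<close> and
  \<open>q\<close> is the correction in the argument of the logarithm. Both factors are 1 up to
  order \<open>A\<^sup>2 / n\<close>, so the maximizer hardly depends on \<alpha>.\<close>

lemma theta_tilde_near_quad_var:
  fixes \<alpha> A :: real
  assumes n: "n \<ge> 2" and v: "v_star n y > 0" "1 / v_star n y \<le> K" and u: "\<bar>u_star n y\<bar> \<le> K" and K: "K > 0"
    and a: "0 < \<alpha>" "\<alpha> \<le> A" and A: "1 \<le> A" "A \<le> real n"
  shows "\<bar>theta_tilde n y \<alpha> - quad_var n y / 2\<bar>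
     \<le> quad_var n y / 2 * ((2 + 3 * K * (1 + 2 * K)) * (A\<^sup>2 / real n))"
proof -
  define b where "b = exp (- \<alpha> / real n)"
  define q where "q = ((lag n \<alpha>)\<^sup>2 - 2 * u_star n y * lag n \<alpha>) / (real n * v_star n y)"
  define z where "z = \<alpha> / real n"
  define r where "r = 2 * z / (1 - b\<^sup>2)"
  have npos: "real n > 0" using n by simp
  have z: "0 < z" "z \<le> 1" using a A npos by (auto simp: z_def)
  have b2: "b\<^sup>2 = exp (- (2 * z))" by (simp add: b_def z_def exp_double[symmetric])
  have c: "0 < 1 - b\<^sup>2" using z by (simp add: b2)
  have q0: "quad_var n y > 0" using stat_polynomial(3)[of n y] n v by simp
  have "quad_form n y \<alpha> = quad_var n y * (1 + q) / (1 - b\<^sup>2)"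
    using n v unfolding det_corr_mat_and_quad_form(3)[OF n a(1), folded b_def]
    by (subst stat_polynomial(1)) (auto simp: q_def lag_def b_def)
  moreover have "\<alpha> * (x * s / c) / N = x / 2 * ((2 * (\<alpha> / N) / c) * s)" for x s c N :: real by (simp add: mult_ac)
  ultimately have t: "theta_tilde n y \<alpha> = quad_var n y / 2 * (r * (1 + q))"
    unfolding theta_tilde_def r_def z_def by (simp only:)
  have "1 - b\<^sup>2 \<le> 2 * z" using one_minus_exp_bounds(2)[of "2 * z"] z by (simp add: b2)
  then have r1: "1 \<le> r" using c by (simp add: r_def le_divide_eq)
  have "1 + 2 * z \<le> exp (2 * z)" by (rule exp_ge_add_one_self)
  then have "(1 + 2 * z) * b\<^sup>2 \<le> exp (2 * z) * b\<^sup>2" by (intro mult_right_mono) auto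
  also have "\<dots> = 1" by (simp add: b2 exp_add[symmetric])
  finally have "2 * z \<le> (1 + 2 * z) * (1 - b\<^sup>2)" by (simp add: algebra_simps)
  then have r2: "r \<le> 1 + 2 * z" using c by (simp add: r_def divide_le_eq)
  have A0: "A \<le> A\<^sup>2" using A mult_right_mono[of 1 A A] by (simp add: power2_eq_square)
  have qa: "\<bar>q\<bar> \<le> K * (1 + 2 * K) * (A\<^sup>2 / real n)"
  proof -
    have x: "0 \<le> lag n \<alpha>" "lag n \<alpha> \<le> A" using lag_bounds[of n \<alpha>] a n by auto
    have "(lag n \<alpha>)\<^sup>2 \<le> A\<^sup>2" using x by (intro power_mono) auto
    moreover have "\<bar>2 * u_star n y * lag n \<alpha>\<bar> \<le> 2 * K * A" using x u K by (auto simp: abs_mult intro!: mult_mono)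
    moreover have "2 * K * A \<le> 2 * K * A\<^sup>2" using A0 K by simp
    ultimately have *: "\<bar>(lag n \<alpha>)\<^sup>2 - 2 * u_star n y * lag n \<alpha>\<bar> \<le> (1 + 2 * K) * A\<^sup>2"
      using abs_triangle_ineq4[of "(lag n \<alpha>)\<^sup>2" "2 * u_star n y * lag n \<alpha>"] by (simp add: algebra_simps)
    have "\<bar>q\<bar> = \<bar>(lag n \<alpha>)\<^sup>2 - 2 * u_star n y * lag n \<alpha>\<bar> * (1 / v_star n y) / real n"
      using v npos by (simp add: q_def abs_mult)
    also have "\<dots> \<le> (1 + 2 * K) * A\<^sup>2 * K / real n"
      using * v npos K by (intro divide_right_mono mult_mono) auto
    finally show ?thesis by (simp add: mult_ac)
  qed
  have zA: "z \<le> A\<^sup>2 / real n" using a A0 npos unfolding z_def by (intro divide_right_mono) auto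
  have "r * (1 + q) - 1 = (r - 1) + r * q" by (simp add: algebra_simps)
  also have "\<bar>\<dots>\<bar> \<le> \<bar>r - 1\<bar> + \<bar>r * q\<bar>" by (rule abs_triangle_ineq)
  \<comment> \<open>\<open>z \<le> 1\<close> gives \<open>r \<le> 3\<close>.\<close>
  also have "\<dots> \<le> 2 * z + 3 * \<bar>q\<bar>"
    using r1 r2 z by (auto simp: abs_mult intro!: add_mono mult_right_mono)
  also have "\<dots> \<le> 2 * (A\<^sup>2 / real n) + 3 * (K * (1 + 2 * K) * (A\<^sup>2 / real n))"
    using zA qa by (intro add_mono mult_left_mono) auto
  also have "\<dots> = (2 + 3 * K * (1 + 2 * K)) * (A\<^sup>2 / real n)" by (simp add: algebra_simps)
  finally have "quad_var n y / 2 * \<bar>r * (1 + q) - 1\<bar> \<le> quad_var n y / 2 * ((2 + 3 * K * (1 + 2 * K)) * (A\<^sup>2 / real n))"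
    using q0 by (intro mult_left_mono) auto
  moreover have "theta_tilde n y \<alpha> - quad_var n y / 2 = quad_var n y / 2 * (r * (1 + q) - 1)"
    unfolding t by (simp add: right_diff_distrib)
  then have "\<bar>theta_tilde n y \<alpha> - quad_var n y / 2\<bar> = quad_var n y / 2 * \<bar>r * (1 + q) - 1\<bar>"
    using q0 by (simp only: abs_mult)
  ultimately show ?thesis by (simp only:)
qed

section \<open>Regularity of the prior\<close>

text \<open>At a zero of \<open>f\<close> the derivative vanishes, \<open>f\<close> being nonnegative, so \<open>\<bar>f'\<bar> \<le> B f\<close> on the
  whole interval; in particular \<open>f\<close> has no zeros there.\<close>

lemma log_derivative_bound:
  fixes f :: "real \<Rightarrow> real"
  assumes diff: "\<And>x. x \<in> {a<..<b} \<Longrightarrow> f differentiable (at x)" and nonneg: "\<And>x. x \<in> {a<..<b} \<Longrightarrow> f x \<ge> 0"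
    and c: "c \<in> {a<..<b}" "f c > 0" and bound: "\<And>x. x \<in> {a<..<b} \<Longrightarrow> \<bar>deriv (\<lambda>t. ln (f t)) x\<bar> \<le> B"
    and x: "x \<in> {a<..<b}"
  shows "f x > 0 \<and> \<bar>ln (f x / f c)\<bar> \<le> B * \<bar>x - c\<bar>"
proof -
  have d: "(f has_real_derivative deriv f t) (at t)" if "t \<in> {a<..<b}" for t
    using diff[OF that] by (simp add: DERIV_deriv_iff_real_differentiable)
  have B: "\<bar>deriv f t\<bar> \<le> B * f t" if t: "t \<in> {a<..<b}" for t
  proof (cases "f t = 0")
    case True
    define e where "e = min (t - a) (b - t)"
    have "deriv f t = 0"
    proof (rule DERIV_local_min[OF d[OF t]])
      show "0 < e" using t by (simp add: e_def)
      show "\<forall>y. \<bar>t - y\<bar> < e \<longrightarrow> f t \<le> f y" 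
      proof (intro allI impI)
        fix y assume "\<bar>t - y\<bar> < e"
        then have "y \<in> {a<..<b}" by (auto simp: e_def abs_less_iff)
        then show "f t \<le> f y" using True nonneg by simp
      qed
    qed
    then show ?thesis using True by simp
  next
    case False
    then have p: "f t > 0" using nonneg[OF t] by simp
    have "((\<lambda>t. ln (f t)) has_real_derivative (deriv f t / f t)) (at t)"
      using DERIV_chain2[OF DERIV_ln_divide[OF p] d[OF t]] by simp
    then have "deriv (\<lambda>t. ln (f t)) t = deriv f t / f t" by (rule DERIV_imp_deriv)
    then show ?thesis using bound[OF t] p by (simp add: abs_divide divide_le_eq)
  qed
  \<comment> \<open>Gronwall in both directions: \<open>\<bar>deriv f t\<bar> \<le> B * f t\<close>
    makes \<open>exp (B * t) * f t\<close> nondecreasing and \<open>exp (- (B * t)) * f t\<close>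
    nonincreasing. No logarithm is taken before positivity is known.\<close>
  have up: "exp (B * u) * f u \<le> exp (B * v) * f v"
    if "u \<le> v" "u \<in> {a<..<b}" "v \<in> {a<..<b}" for u v
  proof (rule DERIV_nonneg_imp_nondecreasing[OF \<open>u \<le> v\<close>])
    fix t assume "u \<le> t" "t \<le> v"
    then have t: "t \<in> {a<..<b}" using that by auto
    have "((\<lambda>t. exp (B * t)) has_real_derivative exp (B * t) * B) (at t)"
      by (auto intro!: derivative_eq_intros)
    then have "((\<lambda>t. exp (B * t) * f t) has_real_derivative exp (B * t) * (B * f t + deriv f t)) (at t)"
      by (rule DERIV_cong[OF DERIV_mult[OF _ d[OF t]]]) (simp add: algebra_simps)
    moreover have "exp (B * t) * (B * f t + deriv f t) \<ge> 0" using B[OF t] by (intro mult_nonneg_nonneg) auto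
    ultimately show "\<exists>y. ((\<lambda>t. exp (B * t) * f t) has_real_derivative y) (at t) \<and> 0 \<le> y" by blast
  qed
  have dn: "exp (- (B * u)) * f u \<ge> exp (- (B * v)) * f v"
    if "u \<le> v" "u \<in> {a<..<b}" "v \<in> {a<..<b}" for u v
  proof (rule DERIV_nonpos_imp_nonincreasing[OF \<open>u \<le> v\<close>])
    fix t assume "u \<le> t" "t \<le> v"
    then have t: "t \<in> {a<..<b}" using that by auto
    have "((\<lambda>t. exp (- (B * t))) has_real_derivative exp (- (B * t)) * (- B)) (at t)"
      by (auto intro!: derivative_eq_intros)
    then have "((\<lambda>t. exp (- (B * t)) * f t) has_real_derivative exp (- (B * t)) * (deriv f t - B * f t)) (at t)"
      by (rule DERIV_cong[OF DERIV_mult[OF _ d[OF t]]]) (simp add: algebra_simps)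
    moreover have "exp (- (B * t)) * (deriv f t - B * f t) \<le> 0" using B[OF t] by (intro mult_nonneg_nonpos) auto
    ultimately show "\<exists>y. ((\<lambda>t. exp (- (B * t)) * f t) has_real_derivative y) (at t) \<and> y \<le> 0" by blast
  qed
  have up': "f u * exp (- (B * (v - u))) \<le> f v" and dn': "f v \<le> f u * exp (B * (v - u))"
    if "u \<le> v" "u \<in> {a<..<b}" "v \<in> {a<..<b}" for u v
  proof -
    have "exp (- (B * v)) * (exp (B * u) * f u) \<le> exp (- (B * v)) * (exp (B * v) * f v)"
      using up[of u v] that by simp
    moreover have e1: "exp (- (B * v)) * exp (B * u) = exp (- (B * (v - u)))"
      by (simp add: exp_add[symmetric] right_diff_distrib)
    moreover have e2: "exp (- (B * v)) * exp (B * v) = 1" by (simp add: exp_add[symmetric])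
    ultimately show "f u * exp (- (B * (v - u))) \<le> f v"
      by (simp only: mult.assoc[symmetric] e1 e2) (simp add: mult.commute)
    have "exp (B * v) * (exp (- (B * v)) * f v) \<le> exp (B * v) * (exp (- (B * u)) * f u)"
      using dn[of u v] that by simp
    moreover have e1: "exp (B * v) * exp (- (B * u)) = exp (B * (v - u))"
      by (simp add: exp_add[symmetric] right_diff_distrib)
    moreover have e2: "exp (B * v) * exp (- (B * v)) = 1" by (simp add: exp_add[symmetric])
    ultimately show "f v \<le> f u * exp (B * (v - u))"
      by (simp only: mult.assoc[symmetric] e1 e2) (simp add: mult.commute)
  qed
  have le: "f c * exp (- (B * \<bar>x - c\<bar>)) \<le> f x \<and> f x \<le> f c * exp (B * \<bar>x - c\<bar>)"
  proof (cases "c \<le> x")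
    case True
    then show ?thesis using up'[of c x] dn'[of c x] c x by simp
  next
    case False
    have "f c \<le> f x * exp (B * (c - x))" "f x * exp (- (B * (c - x))) \<le> f c"
      using False up'[of x c] dn'[of x c] c x by simp_all
    then have "f c * exp (- (B * (c - x))) \<le> f x * exp (B * (c - x)) * exp (- (B * (c - x)))"
      "f x * exp (- (B * (c - x))) * exp (B * (c - x)) \<le> f c * exp (B * (c - x))"
      by (auto intro!: mult_right_mono)
    then show ?thesis using False by (simp add: mult.assoc exp_add[symmetric])
  qed
  then have fx: "f x > 0" using mult_pos_pos[OF c(2) exp_gt_zero[of "- (B * \<bar>x - c\<bar>)"]] by linarith
  have "exp (- (B * \<bar>x - c\<bar>)) \<le> f x / f c" "f x / f c \<le> exp (B * \<bar>x - c\<bar>)"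
    using le c(2) by (simp_all add: pos_le_divide_eq pos_divide_le_eq mult.commute)
  then have "ln (exp (- (B * \<bar>x - c\<bar>))) \<le> ln (f x / f c)" "ln (f x / f c) \<le> ln (exp (B * \<bar>x - c\<bar>))"
    using fx c(2) by (subst ln_le_cancel_iff; simp)+
  then show ?thesis using fx by simp
qed

text \<open>Discretizing \<theta> gives functions that are piecewise constant in \<theta> and
  continuous in \<alpha>; continuity in \<theta> gives their convergence. The grid point is taken to
  the right of \<theta>, so that it stays positive.\<close>

lemma measurable_separately_continuous:
  fixes p :: "real \<Rightarrow> real \<Rightarrow> real"
  assumes c1: "\<And>\<alpha>. \<alpha> > 0 \<Longrightarrow> continuous_on {0<..} (\<lambda>\<theta>. p \<theta> \<alpha>)"
    and c2: "\<And>\<theta>. \<theta> > 0 \<Longrightarrow> continuous_on {0<..} (\<lambda>\<alpha>. p \<theta> \<alpha>)"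
  shows "(\<lambda>(\<theta>, \<alpha>). indicator {0<..} \<theta> * (indicator {0<..} \<alpha> * p \<theta> \<alpha>)) \<in> borel_measurable lborel2"
proof (rule borel_measurable_LIMSEQ_real)
  define g where "g m i = real_of_int (i + 1) / real (Suc m)" for m :: nat and i :: int
  let ?f = "\<lambda>m (z :: real \<times> real). indicator {0<..} (fst z) *
      (indicator {0<..} (snd z) * p (g m \<lfloor>real (Suc m) * fst z\<rfloor>) (snd z))"
  have gpos: "g m \<lfloor>real (Suc m) * \<theta>\<rfloor> > 0" if "\<theta> > 0" for m \<theta>
  proof -
    have "\<lfloor>real (Suc m) * \<theta>\<rfloor> \<ge> 0" using that by (simp del: of_nat_Suc)
    then have "real_of_int (\<lfloor>real (Suc m) * \<theta>\<rfloor> + 1) > 0" by linarith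
    then show ?thesis unfolding g_def by (intro divide_pos_pos) auto
  qed
  show "?f m \<in> borel_measurable lborel2" for m
  proof -
    have m: "(\<lambda>\<alpha>. indicator {0<..} \<alpha> * p c \<alpha>) \<in> borel_measurable borel" if "c > 0" for c
      using borel_measurable_continuous_on_indicator[OF _ c2[OF that]] by simp
    \<comment> \<open>The floor takes countably many values, so one may fix it. Values that lead to
      a nonpositive grid point do not occur for positive \<theta> and are sent to 0.\<close>
    have "(\<lambda>z :: real \<times> real. if g m i > 0 then indicator {0<..} (snd z) * p (g m i) (snd z) else 0) \<in> borel_measurable (borel \<Otimes>\<^sub>M borel)" for i
      using measurable_compose[OF measurable_snd m[of "g m i"]] by (cases "g m i > 0") auto
    moreover have "(\<lambda>z :: real \<times> real. \<lfloor>real (Suc m) * fst z\<rfloor>) \<in> borel \<Otimes>\<^sub>M borel \<rightarrow>\<^sub>M count_space UNIV"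
      by measurable
    ultimately have [measurable]: "(\<lambda>z. (\<lambda>i z. if g m i > 0 then indicator {0<..} (snd z) * p (g m i) (snd z) else 0)
        \<lfloor>real (Suc m) * fst z\<rfloor> z) \<in> borel_measurable (borel \<Otimes>\<^sub>M borel)"
      by (rule measurable_compose_countable)
    have "?f m = (\<lambda>z. indicator {0<..} (fst z) * (\<lambda>i z. if g m i > 0 then indicator {0<..} (snd z) * p (g m i) (snd z) else 0)
        \<lfloor>real (Suc m) * fst z\<rfloor> z)"
      using gpos by (intro ext) (auto split: split_indicator)
    also have "\<dots> \<in> borel_measurable (borel \<Otimes>\<^sub>M borel)" by measurable
    finally show ?thesis using measurable_lborel1 by (simp only: measurable_cong_sets[OF sets_pair_measure_cong[OF sets_lborel sets_lborel] refl])
  qed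
  show "(\<lambda>m. ?f m z) \<longlonglongrightarrow> (case z of (\<theta>, \<alpha>) \<Rightarrow> indicator {0<..} \<theta> * (indicator {0<..} \<alpha> * p \<theta> \<alpha>))" for z
  proof (cases z)
    case (Pair \<theta> \<alpha>)
    show ?thesis
    proof (cases "\<theta> > 0 \<and> \<alpha> > 0")
      case True
      have "(\<lambda>m. g m \<lfloor>real (Suc m) * \<theta>\<rfloor>) \<longlonglongrightarrow> \<theta>"
      proof (rule tendsto_sandwich)
        show "\<forall>\<^sub>F m in sequentially. \<theta> \<le> g m \<lfloor>real (Suc m) * \<theta>\<rfloor>"
        proof (intro always_eventually allI)
          fix m
          have "real (Suc m) * \<theta> \<le> real_of_int (\<lfloor>real (Suc m) * \<theta>\<rfloor> + 1)" by linarith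
          then show "\<theta> \<le> g m \<lfloor>real (Suc m) * \<theta>\<rfloor>" unfolding g_def by (subst pos_le_divide_eq) (auto simp: mult.commute)
        qed
        show "\<forall>\<^sub>F m in sequentially. g m \<lfloor>real (Suc m) * \<theta>\<rfloor> \<le> \<theta> + 1 / real (Suc m)"
        proof (intro always_eventually allI)
          fix m
          have "real_of_int (\<lfloor>real (Suc m) * \<theta>\<rfloor> + 1) \<le> real (Suc m) * \<theta> + 1" by linarith
          then have "g m \<lfloor>real (Suc m) * \<theta>\<rfloor> \<le> (real (Suc m) * \<theta> + 1) / real (Suc m)"
            unfolding g_def by (intro divide_right_mono) auto
          then show "g m \<lfloor>real (Suc m) * \<theta>\<rfloor> \<le> \<theta> + 1 / real (Suc m)"
            by (simp add: add_divide_distrib del: of_nat_Suc)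
        qed
        show "(\<lambda>m. \<theta> + 1 / real (Suc m)) \<longlonglongrightarrow> \<theta>"
          using tendsto_add[OF tendsto_const LIMSEQ_Suc[OF lim_const_over_n[of 1]], of \<theta>] by simp
      qed auto
      then have "(\<lambda>m. p (g m \<lfloor>real (Suc m) * \<theta>\<rfloor>) \<alpha>) \<longlonglongrightarrow> p \<theta> \<alpha>"
        using c1[of \<alpha>] True gpos by (intro continuous_on_tendsto_compose[where f = "\<lambda>\<theta>. p \<theta> \<alpha>"]) auto
      then show ?thesis using True Pair by simp
    qed (use Pair in auto)
  qed
qed

text \<open>In both minima the entry \<open>0.01\<close> is the smallest. The range thus grows so
  slowly that \<open>(alpha_upper n)\<^sup>2 / n\<close> is
  \<open>n powr (- 99 / 100)\<close>.\<close>

lemma kappa_values: "kappa_lower 1 (1 / 2) = 1 / 200" "kappa_upper 1 (1 / 2) = 1 / 200"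
  by (simp_all add: kappa_lower_def kappa_upper_def)

lemma alpha_range_eventually:
  assumes "\<alpha> > 0"
  shows "\<forall>\<^sub>F n in sequentially. \<alpha> \<in> {alpha_lower n..alpha_upper n}"
proof -
  have "(\<lambda>n. alpha_lower n) \<longlonglongrightarrow> 0" unfolding alpha_lower_def kappa_values by real_asymp
  from order_tendstoD(2)[OF this assms] have "\<forall>\<^sub>F n in sequentially. alpha_lower n < \<alpha>" .
  moreover have "filterlim alpha_upper at_top sequentially" unfolding alpha_upper_def kappa_values by real_asymp
  then have "\<forall>\<^sub>F n in sequentially. \<alpha> \<le> alpha_upper n" by (simp add: filterlim_at_top)
  ultimately show ?thesis by eventually_elim simp
qed

section \<open>Approximation of the posterior\<close>

lemma regularD:
  assumes "regular_sample \<theta> K n y"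
  shows "\<bar>u_star n y\<bar> \<le> K" "v_star n y > 0" "1 / v_star n y \<le> K" "sqrt (real n) * \<bar>quad_var n y - 2 * \<theta>\<bar> \<le> K"
  using assms by (auto simp: regular_sample_def)

text \<open>Carries the hypotheses on the prior without the process: all estimates in it are about
  arbitrary samples \<open>y\<close>.\<close>

locale ou_posterior =
  fixes p :: "real \<Rightarrow> real \<Rightarrow> real" and q :: "real \<Rightarrow> real" and \<theta>\<^sub>0 \<alpha>\<^sub>0 C1 C2 C3 :: real
  assumes th0: "\<theta>\<^sub>0 > 0" and a0: "\<alpha>\<^sub>0 > 0"
    and p_density: "\<And>\<alpha>. \<alpha> > 0 \<Longrightarrow> proper_density (\<lambda>\<theta>. p \<theta> \<alpha>)"
    and p_C1: "\<And>\<alpha>. \<alpha> > 0 \<Longrightarrow> (\<lambda>\<theta>. p \<theta> \<alpha>) C1_differentiable_on {0<..}"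
    and p_cont: "\<And>\<theta>. \<theta> > 0 \<Longrightarrow> continuous_on {0<..} (\<lambda>\<alpha>. p \<theta> \<alpha>)"
    and p_pos: "\<And>\<alpha>. \<alpha> > 0 \<Longrightarrow> p \<theta>\<^sub>0 \<alpha> > 0"
    and C1: "C1 < 1 / 2" and C3: "0 < C3" "C3 < 1"
    and deriv_bound: "\<forall>\<^sub>F n in sequentially. \<forall>\<alpha>\<in>{alpha_lower n..alpha_upper n}. \<forall>\<theta>\<in>{\<theta>\<^sub>0 / 2<..<2 * \<theta>\<^sub>0}.
           \<bar>deriv (\<lambda>t. ln (p t \<alpha>)) \<theta>\<bar> \<le> real n powr C1"
    and ratio_bound: "\<forall>\<^sub>F n in sequentially. \<forall>\<alpha>\<in>{alpha_lower n..alpha_upper n}. \<forall>\<theta>\<in>{\<theta>\<^sub>0 / 2<..<2 * \<theta>\<^sub>0}.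
           p \<theta> \<alpha> / p \<theta>\<^sub>0 \<alpha> \<le> real n powr C2"
    and ln_bound: "\<forall>\<^sub>F n in sequentially. \<forall>\<alpha>\<in>{alpha_lower n..alpha_upper n}.
           ln (p \<theta>\<^sub>0 \<alpha>) \<ge> - (real n powr C3)"
    and q_density: "proper_density q" and q_cont: "continuous_on {0<..} q" and q_pos: "q \<alpha>\<^sub>0 > 0"
    and int_pq: "set_integrable lborel {0<..} (\<lambda>\<alpha>. p \<theta>\<^sub>0 \<alpha> * q \<alpha>)"
    and int_sqrt_pq: "set_integrable lborel {0<..} (\<lambda>\<alpha>. sqrt \<alpha> * p \<theta>\<^sub>0 \<alpha> * q \<alpha>)"
    and int_sqrt_q: "set_integrable lborel {0<..} (\<lambda>\<alpha>. sqrt \<alpha> * q \<alpha>)"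
    and tail_lower: "(\<lambda>n. sqrt (real n) * (LINT \<alpha>:{0<..<alpha_lower n}|lborel. sqrt \<alpha> * q \<alpha>)) \<longlonglongrightarrow> 0"
    and tail_upper: "(\<lambda>n. sqrt (real n) * (LINT \<alpha>:{alpha_upper n<..}|lborel. sqrt \<alpha> * q \<alpha>)) \<longlonglongrightarrow> 0"
begin

lemma q_nonneg: "\<alpha> > 0 \<Longrightarrow> q \<alpha> \<ge> 0"
  using q_density by (simp add: proper_density_def)

lemma p_nonneg: "\<theta> > 0 \<Longrightarrow> \<alpha> > 0 \<Longrightarrow> p \<theta> \<alpha> \<ge> 0"
  using p_density by (simp add: proper_density_def)

definition prior_q :: "real \<Rightarrow> real" where "prior_q \<alpha> = indicator {0<..} \<alpha> * q \<alpha>"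

text \<open>The conditional prior density of \<alpha> given \<open>\<theta>\<^sub>0\<close>,
  extended by 0 and without its normalizing constant.\<close>

definition prior_pq :: "real \<Rightarrow> real" where "prior_pq \<alpha> = indicator {0<..} \<alpha> * (p \<theta>\<^sub>0 \<alpha> * q \<alpha>)"

lemma prior_nonneg [simp]: "prior_q \<alpha> \<ge> 0" "prior_pq \<alpha> \<ge> 0"
  using q_nonneg p_nonneg[OF th0] by (auto simp: prior_q_def prior_pq_def split: split_indicator)

lemma measurable_prior [measurable]:
  "prior_q \<in> borel_measurable borel" "prior_pq \<in> borel_measurable borel"
proof -
  show [measurable]: "prior_q \<in> borel_measurable borel"
    using borel_measurable_continuous_on_indicator[OF _ q_cont] by (simp add: prior_q_def[abs_def])
  have [measurable]: "(\<lambda>\<alpha>. indicator {0<..} \<alpha> * p \<theta>\<^sub>0 \<alpha>) \<in> borel_measurable borel"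
    using borel_measurable_continuous_on_indicator[OF _ p_cont[OF th0]] by simp
  have "prior_pq = (\<lambda>\<alpha>. (indicator {0<..} \<alpha> * p \<theta>\<^sub>0 \<alpha>) * prior_q \<alpha>)"
    by (auto simp: prior_pq_def prior_q_def split: split_indicator)
  then show "prior_pq \<in> borel_measurable borel" by simp
qed

lemma integrable_prior:
  "integrable lborel (\<lambda>\<alpha>. sqrt \<alpha> * prior_pq \<alpha>)" "integrable lborel (\<lambda>\<alpha>. sqrt \<alpha> * prior_q \<alpha>)"
  "integrable lborel prior_pq"
  using int_sqrt_pq int_sqrt_q int_pq unfolding set_integrable_def
  by (simp_all add: prior_pq_def[abs_def] prior_q_def[abs_def] mult_ac)

text \<open>For negative \<alpha> the value of \<open>sqrt\<close> is negative, but there the priors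
  vanish.\<close>

lemma sqrt_prior_nonneg [simp]: "sqrt \<alpha> * prior_pq \<alpha> \<ge> 0" "sqrt \<alpha> * prior_q \<alpha> \<ge> 0"
  by (cases "\<alpha> > 0"; simp add: prior_pq_def prior_q_def q_nonneg p_nonneg th0)+

text \<open>By continuity \<open>q\<close> is positive just to the right of
  \<open>\<alpha>\<^sub>0\<close>, and so is \<open>prior_pq\<close>; an interval of length at most
  1 there has positive measure, so \<open>g\<close> cannot vanish almost everywhere.\<close>

lemma prior_integral_pos:
  assumes c: "\<And>\<alpha>. \<alpha> \<in> {0<..\<alpha>\<^sub>0 + 1} \<Longrightarrow> g \<alpha> \<ge> f \<alpha> * prior_pq \<alpha>" and f: "\<And>\<alpha>. \<alpha> > 0 \<Longrightarrow> f \<alpha> > 0"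
    and g: "integrable lborel g" "\<And>\<alpha>. g \<alpha> \<ge> 0"
  shows "(\<integral>\<alpha>. g \<alpha> \<partial>lborel) > 0"
proof (rule ccontr)
  assume "\<not> (\<integral>\<alpha>. g \<alpha> \<partial>lborel) > 0"
  then have "(\<integral>\<alpha>. g \<alpha> \<partial>lborel) = 0" using integral_nonneg_AE[of g lborel] g by (simp add: order.antisym)
  then have ae: "AE \<alpha> in lborel. g \<alpha> = 0" using integral_nonneg_eq_0_iff_AE[OF g(1)] g by simp
  have "isCont q \<alpha>\<^sub>0" using q_cont a0 by (simp add: continuous_on_eq_continuous_at)
  then have "\<forall>\<^sub>F x in at \<alpha>\<^sub>0. q x > 0" using q_pos by (simp add: isCont_def order_tendstoD)
  then obtain d where d: "d > 0" "\<And>x. x \<noteq> \<alpha>\<^sub>0 \<Longrightarrow> dist x \<alpha>\<^sub>0 < d \<Longrightarrow> q x > 0"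
    unfolding eventually_at by auto
  define e where "e = min d 1"
  have "AE \<alpha> in lborel. \<alpha> \<notin> {\<alpha>\<^sub>0<..<\<alpha>\<^sub>0 + e}"
    using ae
  proof eventually_elim
    case (elim \<alpha>)
    have "g \<alpha> > 0" if "\<alpha> \<in> {\<alpha>\<^sub>0<..<\<alpha>\<^sub>0 + e}"
    proof -
      have "q \<alpha> > 0" using d(2)[of \<alpha>] that by (auto simp: e_def dist_real_def)
      then have "f \<alpha> * prior_pq \<alpha> > 0" using that a0 p_pos f by (simp add: prior_pq_def)
      then show ?thesis 
      proof -
        have "\<alpha> \<in> {0<..\<alpha>\<^sub>0 + 1}" using that a0 by (auto simp: e_def min_def split: if_splits)
        from c[OF this] \<open>f \<alpha> * prior_pq \<alpha> > 0\<close> show ?thesis by linarith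
      qed
    qed
    then show ?case using elim by auto
  qed
  then have "emeasure lborel {\<alpha>\<^sub>0<..<\<alpha>\<^sub>0 + e} = 0"
    by (subst (asm) AE_iff_measurable[where N = "{\<alpha>\<^sub>0<..<\<alpha>\<^sub>0 + e}"]) auto
  then show False using d(1) by (simp add: e_def)
qed

definition profile_density :: "nat \<Rightarrow> real \<Rightarrow> real \<Rightarrow> real \<Rightarrow> real" where
  "profile_density n u v \<alpha> = profile_weight n u v \<alpha> * prior_pq \<alpha>"

definition limit_density :: "real \<Rightarrow> real \<Rightarrow> real \<Rightarrow> real" where
  "limit_density u v \<alpha> = limit_weight u v \<alpha> * prior_pq \<alpha>"

text \<open>Unlike \<^const>\<open>theta_tilde\<close>, which is computed by Gaussian elimination, this expression is visibly
  measurable in \<open>\<alpha>\<close>.\<close>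

definition theta_tilde_expl :: "nat \<Rightarrow> (nat \<Rightarrow> real) \<Rightarrow> real \<Rightarrow> real" where
  "theta_tilde_expl n y \<alpha> = \<alpha> * ((stat_A1 n y * (exp (- \<alpha> / real n))\<^sup>2 - 2 * stat_A2 n y * exp (- \<alpha> / real n)
      + stat_A3 n y) / (1 - (exp (- \<alpha> / real n))\<^sup>2)) / real n"

lemma theta_tilde_expl: "n \<ge> 2 \<Longrightarrow> \<alpha> > 0 \<Longrightarrow> theta_tilde n y \<alpha> = theta_tilde_expl n y \<alpha>"
  by (simp add: theta_tilde_def theta_tilde_expl_def det_corr_mat_and_quad_form(3))

lemma measurable_theta_tilde_expl [measurable]: "theta_tilde_expl n y \<in> borel_measurable borel"
  unfolding theta_tilde_expl_def by measurable

text \<open>The density of the joint posterior as factorized in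
  \<open>log_lik_factorization\<close>, without the factors that depend on \<open>n\<close> and
  \<open>y\<close> only.\<close>

definition joint_density :: "nat \<Rightarrow> (nat \<Rightarrow> real) \<Rightarrow> real \<times> real \<Rightarrow> real" where
  "joint_density n y = (\<lambda>(\<theta>, \<alpha>). profile_weight n (u_star n y) (v_star n y) \<alpha>
     * theta_kernel \<theta>\<^sub>0 n (theta_tilde_expl n y \<alpha>) \<theta>
     * (indicator {0<..} \<theta> * (indicator {0<..} \<alpha> * p \<theta> \<alpha>)) * prior_q \<alpha>)"

lemma measurable_densities [measurable]:
  "profile_density n u v \<in> borel_measurable borel" "limit_density u v \<in> borel_measurable borel"
  "joint_density n y \<in> borel_measurable lborel2"
proof -
  show "profile_density n u v \<in> borel_measurable borel" "limit_density u v \<in> borel_measurable borel"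
    unfolding profile_density_def limit_density_def by measurable
  have [measurable]: "(\<lambda>(\<theta>, \<alpha>). indicator {0<..} \<theta> * (indicator {0<..} \<alpha> * p \<theta> \<alpha>)) \<in> borel_measurable lborel2"
    using p_C1 C1_differentiable_imp_continuous_on p_cont by (intro measurable_separately_continuous) blast+
  have "joint_density n y = (\<lambda>z. profile_weight n (u_star n y) (v_star n y) (snd z)
     * theta_kernel \<theta>\<^sub>0 n (theta_tilde_expl n y (snd z)) (fst z)
     * (case z of (\<theta>, \<alpha>) \<Rightarrow> indicator {0<..} \<theta> * (indicator {0<..} \<alpha> * p \<theta> \<alpha>)) * prior_q (snd z))"
    by (auto simp: joint_density_def)
  also have "\<dots> \<in> borel_measurable lborel2" by measurable
  finally show "joint_density n y \<in> borel_measurable lborel2" .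
qed

lemma density_nonneg:
  assumes "K > 0" "\<bar>u\<bar> \<le> K" "v > 0" "1 / v \<le> K" "real n \<ge> 2 * K ^ 3" "n > 0"
  shows "profile_density n u v \<alpha> \<ge> 0" "profile_density n u v \<alpha> \<le> exp (K ^ 3) * (sqrt \<alpha> * prior_pq \<alpha>)"
    "limit_density u v \<alpha> \<ge> 0" "limit_density u v \<alpha> \<le> exp (K ^ 3) * (sqrt \<alpha> * prior_pq \<alpha>)"
    "\<bar>profile_density n u v \<alpha> - limit_density u v \<alpha>\<bar> \<le> weight_gap K n \<alpha> * (sqrt \<alpha> * prior_pq \<alpha>)"
proof -
  have "profile_density n u v \<alpha> \<ge> 0 \<and> profile_density n u v \<alpha> \<le> exp (K ^ 3) * (sqrt \<alpha> * prior_pq \<alpha>) \<and>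
    limit_density u v \<alpha> \<ge> 0 \<and> limit_density u v \<alpha> \<le> exp (K ^ 3) * (sqrt \<alpha> * prior_pq \<alpha>) \<and>
    \<bar>profile_density n u v \<alpha> - limit_density u v \<alpha>\<bar> \<le> weight_gap K n \<alpha> * (sqrt \<alpha> * prior_pq \<alpha>)"
  proof (cases "\<alpha> > 0")
    case True
    note pw = profile_weight_bounds[OF assms, of \<alpha>] and lw = limit_weight_bounds[OF assms(1-4), of \<alpha>]
      and wd = weight_difference[OF assms True]
    have "\<bar>profile_density n u v \<alpha> - limit_density u v \<alpha>\<bar> = \<bar>profile_weight n u v \<alpha> - limit_weight u v \<alpha>\<bar> * prior_pq \<alpha>"
      unfolding profile_density_def limit_density_def left_diff_distrib[symmetric] abs_mult by simp
    also have "\<dots> \<le> weight_gap K n \<alpha> * sqrt \<alpha> * prior_pq \<alpha>" using wd by (intro mult_right_mono) auto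
    finally show ?thesis
      using mult_right_mono[OF pw(2) prior_nonneg(2)[of \<alpha>]] mult_right_mono[OF lw(2) prior_nonneg(2)[of \<alpha>]] pw(1) lw(1) True
      by (simp add: profile_density_def limit_density_def mult_ac)
  qed (simp add: profile_density_def limit_density_def prior_pq_def)
  then show "profile_density n u v \<alpha> \<ge> 0" "profile_density n u v \<alpha> \<le> exp (K ^ 3) * (sqrt \<alpha> * prior_pq \<alpha>)"
    "limit_density u v \<alpha> \<ge> 0" "limit_density u v \<alpha> \<le> exp (K ^ 3) * (sqrt \<alpha> * prior_pq \<alpha>)"
    "\<bar>profile_density n u v \<alpha> - limit_density u v \<alpha>\<bar> \<le> weight_gap K n \<alpha> * (sqrt \<alpha> * prior_pq \<alpha>)"
    by auto
qed

lemma joint_density_nonneg: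
  assumes "regular_sample \<theta> K n y" "K > 0" "real n \<ge> 2 * K ^ 3" "n > 0"
  shows "joint_density n y z \<ge> 0"
proof (cases z)
  case (Pair \<theta> \<alpha>)
  show ?thesis
  proof (cases "\<alpha> > 0 \<and> \<theta> > 0")
    case True
    have "profile_weight n (u_star n y) (v_star n y) \<alpha> \<ge> 0"
      using profile_weight_bounds[OF assms(2) regularD(1-3)[OF assms(1)] assms(3,4), of \<alpha>] True by simp
    then show ?thesis using True p_nonneg[of \<theta> \<alpha>] by (simp add: joint_density_def Pair)
  qed (auto simp: joint_density_def Pair)
qed

text \<open>The posteriors involve these densities up to positive constants \<open>k1\<close>,
  \<open>k2\<close>, \<open>I\<close> and, from completing the square,
  \<open>exp (- (u\<^sup>2 / (2 * v)))\<close>; normalization removes them.\<close>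

lemma posteriors_normalized:
  assumes reg: "regular_sample \<theta> K n y" and K: "K > 0" "real n \<ge> 2 * K ^ 3" and n: "n \<ge> 2"
  shows "joint_posterior p q n y = normalized lborel2 (joint_density n y)"
    and "profile_posterior p q \<theta>\<^sub>0 n y = normalized lborel (profile_density n (u_star n y) (v_star n y))"
    and "star_posterior p q \<theta>\<^sub>0 n y = normalized lborel (limit_density (u_star n y) (v_star n y))"
proof -
  let ?u = "u_star n y" and ?v = "v_star n y"
  note r = regularD[OF reg]
  have np: "n > 0" using n by simp
  have pos: "1 + ((lag n \<alpha>)\<^sup>2 - 2 * ?u * lag n \<alpha>) / (real n * ?v) > 0" for \<alpha>
    using profile_argument_pos(1)[OF K(1) r(1-3) K(2) np, where x = "lag n \<alpha>"]
      profile_argument_pos(2)[OF K(1) r(1-3) K(2) np] by linarith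
  define k1 where "k1 = exp (- (real n / 2 * ln (quad_var n y))) * sqrt (2 / real n)"
  define k2 where "k2 = exp (real n / 2 * ln (real n) - real n / 2) / sqrt (real n / (4 * pi * \<theta>\<^sub>0\<^sup>2))"
  have k: "k1 > 0" "k2 > 0" using np th0 by (auto simp: k1_def k2_def)
  note fac = log_lik_factorization[OF n r(2) th0 _ _ pos, folded k1_def k2_def]
  have "(\<lambda>(\<theta>, \<alpha>). indicator {0<..} \<theta> * indicator {0<..} \<alpha> * (exp (log_lik n y (\<theta> / \<alpha>) \<alpha>) * p \<theta> \<alpha> * q \<alpha>))
      = (\<lambda>z. (k1 * k2) * joint_density n y z)"
  proof (rule ext, clarify)
    fix \<theta> \<alpha> :: real
    show "indicator {0<..} \<theta> * indicator {0<..} \<alpha> * (exp (log_lik n y (\<theta> / \<alpha>) \<alpha>) * p \<theta> \<alpha> * q \<alpha>)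
       = k1 * k2 * joint_density n y (\<theta>, \<alpha>)"
      using fac(1,2)[of \<theta> \<alpha>] theta_tilde_expl[OF n, of \<alpha> y]
      by (cases "\<theta> > 0 \<and> \<alpha> > 0") (auto simp: joint_density_def prior_q_def)
  qed
  then show "joint_posterior p q n y = normalized lborel2 (joint_density n y)"
    unfolding joint_posterior_def
    using k joint_density_nonneg[OF reg K np] by (simp only: normalized_scale[OF mult_pos_pos] measurable_densities)
  define I where "I = (LINT a:{0<..}|lborel. p \<theta>\<^sub>0 a * q a)"
  have "I = (\<integral>\<alpha>. prior_pq \<alpha> \<partial>lborel)" by (simp add: I_def set_lebesgue_integral_def prior_pq_def)
  also have "\<dots> > 0"
    by (rule prior_integral_pos[where f = "\<lambda>_. 1"]) (auto simp: integrable_prior)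
  finally have I: "I > 0" .
  have "(\<lambda>\<alpha>. indicator {0<..} \<alpha> * (exp (log_lik_tilde n y \<alpha>) * alpha_prior_given p q \<theta>\<^sub>0 \<alpha>))
      = (\<lambda>\<alpha>. (k1 / I) * profile_density n ?u ?v \<alpha>)"
    using fac(1)[of 1]
    by (intro ext) (auto simp: profile_density_def prior_pq_def alpha_prior_given_def I_def split: split_indicator)
  then show "profile_posterior p q \<theta>\<^sub>0 n y = normalized lborel (profile_density n ?u ?v)"
    unfolding profile_posterior_def
    using normalized_scale[OF divide_pos_pos[OF k(1) I], where M = lborel and f = "profile_density n ?u ?v"]
      density_nonneg(1)[OF K(1) r(1-3) K(2) np] by simp
  have "(\<lambda>\<alpha>. indicator {0<..} \<alpha> *
          (sqrt \<alpha> * exp (- ((\<alpha> - ?u)\<^sup>2 / (2 * ?v))) * alpha_prior_given p q \<theta>\<^sub>0 \<alpha>))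
      = (\<lambda>\<alpha>. (exp (- (?u\<^sup>2 / (2 * ?v))) / I) * limit_density ?u ?v \<alpha>)"
  proof (rule ext)
    fix \<alpha>
    have "exp (- ((\<alpha> - ?u)\<^sup>2 / (2 * ?v))) = exp (- (?u\<^sup>2 / (2 * ?v))) * exp (- ((\<alpha>\<^sup>2 - 2 * ?u * \<alpha>) / (2 * ?v)))"
      unfolding exp_add[symmetric] using r(2)
      by (simp add: power2_eq_square add_divide_distrib[symmetric] diff_divide_distrib[symmetric] algebra_simps)
    then show "indicator {0<..} \<alpha> *
          (sqrt \<alpha> * exp (- ((\<alpha> - ?u)\<^sup>2 / (2 * ?v))) * alpha_prior_given p q \<theta>\<^sub>0 \<alpha>)
       = (exp (- (?u\<^sup>2 / (2 * ?v))) / I) * limit_density ?u ?v \<alpha>"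
      by (auto simp: limit_density_def limit_weight_def prior_pq_def alpha_prior_given_def I_def split: split_indicator)
  qed
  then show "star_posterior p q \<theta>\<^sub>0 n y = normalized lborel (limit_density ?u ?v)"
    unfolding star_posterior_def
    using normalized_scale[OF divide_pos_pos[OF exp_gt_zero I], where M = lborel and f = "limit_density ?u ?v"]
      density_nonneg(3)[OF K(1) r(1-3) K(2) np] by simp
qed

section \<open>Laplace approximation, uniformly in the sample and in the range of \<alpha>\<close>

text \<open>The exponent by which the window exceeds the normal width
  \<open>n powr (- 1 / 2)\<close>. It uses half of the room between \<open>C1\<close> and
  \<open>1 / 2\<close>, so that the log prior stays nearly constant on the window; the cap
  \<open>1 / 10\<close> controls the cubic remainder.\<close>

definition slack :: real where "slack = min (1 / 10) ((1 / 2 - C1) / 2)"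

lemma slack: "0 < slack" "slack \<le> 1 / 10" "C1 + slack < 1 / 2"
  using C1 by (auto simp: slack_def min_def field_simps)

text \<open>The shift is twice the deviation of a maximizer from \<open>quad_var n y / 2\<close>,
  with the exponent \<open>- 99 / 100\<close> rounded up to the \<open>- 9 / 10\<close> of
  \<open>laplace_error_tendsto_0\<close>.\<close>

definition theta_error :: "real \<Rightarrow> nat \<Rightarrow> real" where
  "theta_error K n = laplace_error \<theta>\<^sub>0 n (real n powr (slack - 1 / 2))
     ((3 * \<theta>\<^sub>0 * (2 + 3 * K * (1 + 2 * K))) * real n powr (- 9 / 10))
     (real n powr C1) (real n powr C2) (exp (real n powr C3))"

lemma theta_error_tendsto_0: "theta_error K \<longlonglongrightarrow> 0"
  unfolding theta_error_def using slack C3 th0 by (intro laplace_error_tendsto_0) auto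

lemma theta_error_nonneg: "K > 0 \<Longrightarrow> theta_error K n \<ge> 0"
  unfolding theta_error_def laplace_error_def using th0
  by (intro add_nonneg_nonneg mult_nonneg_nonneg divide_nonneg_nonneg) auto

text \<open>The normal density is centred at the maximizer for \<open>\<alpha>\<^sub>0\<close>,
  whatever \<alpha> is; this is what decouples \<theta> from \<alpha>. Of the prior bounds, the one
  on the derivative gives the slope, the one on ratios the supremum, and the lower bound on
  \<open>ln (p \<theta>\<^sub>0 \<alpha>)\<close> bounds the total integral
  \<open>1 / p \<theta>\<^sub>0 \<alpha>\<close>.\<close>

lemma p_laplace:
  assumes K: "K > 0"
  shows "\<forall>\<^sub>F n in sequentially. \<forall>y. \<forall>\<alpha>\<in>{alpha_lower n..alpha_upper n}.
     regular_sample \<theta>\<^sub>0 K n y \<longrightarrow> (\<integral>\<^sup>+\<theta>. ennreal \<bar>theta_kernel \<theta>\<^sub>0 n (theta_tilde_expl n y \<alpha>) \<theta> * (indicator {0<..} \<theta> * (p \<theta> \<alpha> / p \<theta>\<^sub>0 \<alpha>))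
            - normal_density (theta_tilde n y \<alpha>\<^sub>0) (sqrt (2 * \<theta>\<^sub>0\<^sup>2 / real n)) \<theta>\<bar> \<partial>lborel)
         \<le> ennreal (theta_error K n)"
proof -
  define c where "c = 2 + 3 * K * (1 + 2 * K)"
  have c: "c > 0" using K by (simp add: c_def add_pos_pos)
  have ev1: "\<forall>\<^sub>F n in sequentially. K / sqrt (real n) \<le> \<theta>\<^sub>0"
    and ev2: "\<forall>\<^sub>F n in sequentially. 3 / 2 * \<theta>\<^sub>0 * c * real n powr (- 99 / 100) + K / (2 * sqrt (real n)) \<le> real n powr (slack - 1 / 2) / 2"
    and ev3: "\<forall>\<^sub>F n in sequentially. real n powr (slack - 1 / 2) \<le> \<theta>\<^sub>0 / 8"
    and ev4: "\<forall>\<^sub>F n in sequentially. alpha_upper n \<le> real n \<and> 1 \<le> alpha_upper n"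
  proof -
    have "(\<lambda>n. K / sqrt (real n)) \<longlonglongrightarrow> 0" by real_asymp
    from order_tendstoD(2)[OF this th0] show "\<forall>\<^sub>F n in sequentially. K / sqrt (real n) \<le> \<theta>\<^sub>0"
      by eventually_elim simp
    have "(\<lambda>n. (3 / 2 * \<theta>\<^sub>0 * c * real n powr (- 99 / 100) + K / (2 * sqrt (real n))) / (real n powr (slack - 1 / 2))) \<longlonglongrightarrow> 0"
      using slack(1,2) by real_asymp
    then have "\<forall>\<^sub>F n in sequentially. (3 / 2 * \<theta>\<^sub>0 * c * real n powr (- 99 / 100) + K / (2 * sqrt (real n))) / (real n powr (slack - 1 / 2)) < 1 / 2"
      by (rule order_tendstoD) simp
    then show "\<forall>\<^sub>F n in sequentially. 3 / 2 * \<theta>\<^sub>0 * c * real n powr (- 99 / 100) + K / (2 * sqrt (real n)) \<le> real n powr (slack - 1 / 2) / 2"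
      using eventually_gt_at_top[of 0] by eventually_elim (simp add: pos_divide_less_eq less_imp_le mult.commute)
    have "(\<lambda>n. real n powr (slack - 1 / 2)) \<longlonglongrightarrow> 0" using slack(1,2) by real_asymp
    from order_tendstoD(2)[OF this, of "\<theta>\<^sub>0 / 8"] th0 show "\<forall>\<^sub>F n in sequentially. real n powr (slack - 1 / 2) \<le> \<theta>\<^sub>0 / 8"
      by (auto elim: eventually_mono)
    show "\<forall>\<^sub>F n in sequentially. alpha_upper n \<le> real n \<and> 1 \<le> alpha_upper n"
      unfolding alpha_upper_def kappa_values
      using eventually_ge_at_top[of 1]
    proof eventually_elim
      case (elim n)
      then show ?case using powr_mono[of "1 / 200" 1 "real n"] ge_one_powr_ge_zero[of "real n" "1 / 200"] by simp
    qed
  qed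
  show ?thesis
    using ev1 ev2 ev3 ev4 eventually_ge_at_top[of 2] alpha_range_eventually[OF a0] deriv_bound ratio_bound ln_bound
  proof eventually_elim
    case (elim n)
    note db = elim(7) and rb = elim(8) and lb = elim(9)
    have n: "n \<ge> 2" "n > 0" using elim(5) by auto
    define d where "d = real n powr (slack - 1 / 2)"
    define w where "w = 3 * \<theta>\<^sub>0 * c * real n powr (- 9 / 10)"
    show ?case
    proof (intro allI ballI impI)
      fix y \<alpha> assume \<alpha>: "\<alpha> \<in> {alpha_lower n..alpha_upper n}" and reg: "regular_sample \<theta>\<^sub>0 K n y"
      note r = regularD[OF reg]
      have ap: "\<alpha> > 0"
        using \<alpha> n by (auto simp: alpha_lower_def intro: less_le_trans[of 0 "real n powr (- kappa_lower 1 (1 / 2))"])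
      have D: "\<bar>quad_var n y - 2 * \<theta>\<^sub>0\<bar> \<le> K / sqrt (real n)"
        using r(4) n by (simp add: pos_le_divide_eq mult.commute)
      then have D3: "quad_var n y \<le> 3 * \<theta>\<^sub>0" "quad_var n y > 0"
        using elim(1) th0 stat_polynomial(3)[OF n(2) r(2)] by linarith+
      have near: "\<bar>theta_tilde n y x - quad_var n y / 2\<bar> \<le> 3 / 2 * \<theta>\<^sub>0 * c * real n powr (- 99 / 100)"
        if x: "0 < x" "x \<le> alpha_upper n" for x
      proof -
        have "(alpha_upper n)\<^sup>2 / real n = real n powr (1 / 200) * real n powr (1 / 200) / real n powr 1"
          using n by (simp add: alpha_upper_def kappa_values power2_eq_square)
        also have "\<dots> = real n powr (- 99 / 100)" by (simp only: powr_add[symmetric] powr_diff[symmetric]) simp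
        finally have A: "(alpha_upper n)\<^sup>2 / real n = real n powr (- 99 / 100)" .
        have "\<bar>theta_tilde n y x - quad_var n y / 2\<bar> \<le> quad_var n y / 2 * (c * ((alpha_upper n)\<^sup>2 / real n))"
          unfolding c_def using elim(4) by (intro theta_tilde_near_quad_var n r K x) auto
        also have "\<dots> \<le> 3 * \<theta>\<^sub>0 / 2 * (c * ((alpha_upper n)\<^sup>2 / real n))"
          using D3 c by (intro mult_right_mono) auto
        finally show ?thesis unfolding A by (simp add: mult_ac)
      qed
      \<comment> \<open>The maximizer is within order \<open>n powr (- 99 / 100)\<close> of
        \<open>quad_var n y / 2\<close>, which is within order \<open>n powr (- 1 / 2)\<close> of
        \<open>\<theta>\<^sub>0\<close>; as \<open>slack\<close> is positive, the sum is eventually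
        below half the window.\<close>
      have near0: "\<bar>theta_tilde n y x - \<theta>\<^sub>0\<bar> \<le> d / 2" if x: "0 < x" "x \<le> alpha_upper n" for x
      proof -
        have "\<bar>quad_var n y / 2 - \<theta>\<^sub>0\<bar> \<le> K / (2 * sqrt (real n))"
        proof -
          have "quad_var n y / 2 - \<theta>\<^sub>0 = (quad_var n y - 2 * \<theta>\<^sub>0) / 2" by simp
          then show ?thesis using D by (simp only: abs_divide)
        qed
        then show ?thesis using near[OF x] elim(2) unfolding d_def by linarith
      qed
      have A0: "\<alpha>\<^sub>0 \<le> alpha_upper n" and A1: "\<alpha> \<le> alpha_upper n" using elim(6) \<alpha> by auto
      have te: "theta_tilde_expl n y \<alpha> = theta_tilde n y \<alpha>" using theta_tilde_expl[OF n(1) ap] by simp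
      have pw: "proper_density (\<lambda>\<theta>. p \<theta> \<alpha>)" by (rule p_density[OF ap])
      have contp: "continuous_on {0<..} (\<lambda>\<theta>. p \<theta> \<alpha>)" using p_C1[OF ap] by (rule C1_differentiable_imp_continuous_on)
      have meas: "(\<lambda>\<theta>. indicator {0<..} \<theta> * p \<theta> \<alpha>) \<in> borel_measurable borel"
        using borel_measurable_continuous_on_indicator[OF _ contp] by simp
      show "(\<integral>\<^sup>+\<theta>. ennreal \<bar>theta_kernel \<theta>\<^sub>0 n (theta_tilde_expl n y \<alpha>) \<theta> * (indicator {0<..} \<theta> * (p \<theta> \<alpha> / p \<theta>\<^sub>0 \<alpha>))
            - normal_density (theta_tilde n y \<alpha>\<^sub>0) (sqrt (2 * \<theta>\<^sub>0\<^sup>2 / real n)) \<theta>\<bar> \<partial>lborel)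
         \<le> ennreal (theta_error K n)"
        unfolding te theta_error_def d_def[symmetric] c_def[symmetric] w_def[symmetric]
      proof (rule laplace_approximation[OF th0 n(2)])
        show "0 < d" using n by (simp add: d_def)
        show "d \<le> \<theta>\<^sub>0 / 8" using elim(3) by (simp add: d_def)
        show "\<bar>theta_tilde n y \<alpha> - \<theta>\<^sub>0\<bar> \<le> d / 2" by (rule near0[OF ap A1])
        show "\<bar>theta_tilde n y \<alpha>\<^sub>0 - \<theta>\<^sub>0\<bar> \<le> d / 2" by (rule near0[OF a0 A0])
        have "real n powr (- 99 / 100) \<le> real n powr (- 9 / 10)" using n by (intro powr_mono) auto
        then have "3 * \<theta>\<^sub>0 * c * real n powr (- 99 / 100) \<le> w" unfolding w_def using th0 c by (intro mult_left_mono) auto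
        then show "\<bar>theta_tilde n y \<alpha> - theta_tilde n y \<alpha>\<^sub>0\<bar> \<le> w" using near[OF ap A1] near[OF a0 A0] by linarith
        have "(\<lambda>\<theta>. indicator {0<..} \<theta> * p \<theta> \<alpha> * (1 / p \<theta>\<^sub>0 \<alpha>)) \<in> borel_measurable borel"
          by (intro borel_measurable_times meas borel_measurable_const)
        then show "(\<lambda>\<theta>. indicator {0<..} \<theta> * (p \<theta> \<alpha> / p \<theta>\<^sub>0 \<alpha>)) \<in> borel_measurable borel"
          by simp
        show "p \<theta> \<alpha> / p \<theta>\<^sub>0 \<alpha> \<ge> 0" if "\<theta> > 0" for \<theta> using p_nonneg[OF that ap] p_pos[OF ap] by simp
        show "(\<integral>\<^sup>+\<theta>. ennreal (indicator {0<..} \<theta> * (p \<theta> \<alpha> / p \<theta>\<^sub>0 \<alpha>)) \<partial>lborel) \<le> ennreal (exp (real n powr C3))"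
        proof -
          have int: "integrable lborel (\<lambda>\<theta>. indicator {0<..} \<theta> * p \<theta> \<alpha>)" "(\<integral>\<theta>. indicator {0<..} \<theta> * p \<theta> \<alpha> \<partial>lborel) = 1"
            using pw by (auto simp: proper_density_def set_integrable_def set_lebesgue_integral_def)
          have eq: "indicator {0<..} \<theta> * (p \<theta> \<alpha> / p \<theta>\<^sub>0 \<alpha>) = indicator {0<..} \<theta> * p \<theta> \<alpha> * (1 / p \<theta>\<^sub>0 \<alpha>)" for \<theta> by simp
          have "(\<integral>\<^sup>+\<theta>. ennreal (indicator {0<..} \<theta> * (p \<theta> \<alpha> / p \<theta>\<^sub>0 \<alpha>)) \<partial>lborel)
              = ennreal (\<integral>\<theta>. indicator {0<..} \<theta> * p \<theta> \<alpha> * (1 / p \<theta>\<^sub>0 \<alpha>) \<partial>lborel)"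
            unfolding eq using int p_pos[OF ap] p_nonneg[OF _ ap]
            by (intro nn_integral_eq_integral integrable_mult_left) (auto split: split_indicator)
          also have "\<dots> = ennreal (1 / p \<theta>\<^sub>0 \<alpha>)" using int by (simp del: mult_1_right times_divide_eq_right)
          also have "\<dots> \<le> ennreal (exp (real n powr C3))"
          proof (rule ennreal_leI)
            have "exp (- (real n powr C3)) \<le> exp (ln (p \<theta>\<^sub>0 \<alpha>))" using lb \<alpha> by simp
            then have "exp (- (real n powr C3)) \<le> p \<theta>\<^sub>0 \<alpha>" using p_pos[OF ap] by simp
            then show "1 / p \<theta>\<^sub>0 \<alpha> \<le> exp (real n powr C3)"
              using p_pos[OF ap] by (simp add: exp_minus field_simps)
          qed
          finally show ?thesis .
        qed
        show "p \<theta> \<alpha> / p \<theta>\<^sub>0 \<alpha> \<le> real n powr C2" if "\<theta>\<^sub>0 / 2 < \<theta>" "\<theta> < 2 * \<theta>\<^sub>0" for \<theta>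
          using rb \<alpha> that by simp
        show "p \<theta> \<alpha> / p \<theta>\<^sub>0 \<alpha> > 0 \<and> \<bar>ln (p \<theta> \<alpha> / p \<theta>\<^sub>0 \<alpha>)\<bar> \<le> real n powr C1 * \<bar>\<theta> - \<theta>\<^sub>0\<bar>"
          if "\<theta>\<^sub>0 / 2 < \<theta>" "\<theta> < 2 * \<theta>\<^sub>0" for \<theta>
        proof -
          have "p \<theta> \<alpha> > 0 \<and> \<bar>ln (p \<theta> \<alpha> / p \<theta>\<^sub>0 \<alpha>)\<bar> \<le> real n powr C1 * \<bar>\<theta> - \<theta>\<^sub>0\<bar>"
          proof (rule log_derivative_bound[where f = "\<lambda>\<theta>. p \<theta> \<alpha>" and a = "\<theta>\<^sub>0 / 2" and b = "2 * \<theta>\<^sub>0"])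
            show "(\<lambda>\<theta>. p \<theta> \<alpha>) differentiable (at x)" if "x \<in> {\<theta>\<^sub>0 / 2<..<2 * \<theta>\<^sub>0}" for x
              using p_C1[OF ap] that th0 by (auto simp: C1_differentiable_on_eq)
            show "p x \<alpha> \<ge> 0" if "x \<in> {\<theta>\<^sub>0 / 2<..<2 * \<theta>\<^sub>0}" for x
              using that th0 by (intro p_nonneg ap) auto
          qed (use that th0 p_pos[OF ap] db \<alpha> in auto)
          then show ?thesis using p_pos[OF ap] by simp
        qed
      qed auto
    qed
  qed
qed

section \<open>Distance in \<open>L\<^sup>1\<close> from the joint density to the product
  density\<close>

definition kernel_bound :: "nat \<Rightarrow> real" where
  "kernel_bound n = sqrt (real n / (4 * pi * \<theta>\<^sub>0\<^sup>2))"

text \<open>Inside the range the difference is \<open>W * prior_pq \<alpha>\<close> times the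
  Laplace error of the prior ratio. Outside, the two terms are estimated separately: bounding the
  kernel by its maximum leaves the integral of \<open>p \<theta> \<alpha>\<close> over \<theta>,
  which is 1. Hence \<open>prior_q\<close> appears there, with a factor of order
  \<open>sqrt n\<close>.\<close>

lemma joint_profile_fibre:
  assumes K: "K > 0" "real n \<ge> 2 * K ^ 3" and n: "n \<ge> 2" and reg: "regular_sample \<theta>\<^sub>0 K n y"
    and lap: "\<alpha> \<in> {alpha_lower n..alpha_upper n} \<Longrightarrow>
      (\<integral>\<^sup>+\<theta>. ennreal \<bar>theta_kernel \<theta>\<^sub>0 n (theta_tilde_expl n y \<alpha>) \<theta> * (indicator {0<..} \<theta> * (p \<theta> \<alpha> / p \<theta>\<^sub>0 \<alpha>))
            - normal_density m s \<theta>\<bar> \<partial>lborel) \<le> ennreal \<eta>"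
    and s: "s > 0" and eta: "\<eta> \<ge> 0"
  shows "(\<integral>\<^sup>+\<theta>. ennreal \<bar>joint_density n y (\<theta>, \<alpha>) - normal_density m s \<theta> * profile_density n (u_star n y) (v_star n y) \<alpha>\<bar> \<partial>lborel)
     \<le> ennreal (exp (K ^ 3) * (\<eta> * (sqrt \<alpha> * prior_pq \<alpha>) + indicator (- {alpha_lower n..alpha_upper n}) \<alpha>
          * (kernel_bound n * (sqrt \<alpha> * prior_q \<alpha>) + sqrt \<alpha> * prior_pq \<alpha>)))"
proof (cases "\<alpha> > 0")
  case False
  then show ?thesis by (simp add: joint_density_def profile_density_def prior_pq_def prior_q_def)
next
  case ap: True
  define W where "W = profile_weight n (u_star n y) (v_star n y) \<alpha>"
  define C where "C = exp (K ^ 3)"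
  note r = regularD[OF reg]
  have np: "n > 0" using n by simp
  have W: "0 \<le> W" "W \<le> C * sqrt \<alpha>"
    unfolding W_def C_def using profile_weight_bounds[OF K(1) r(1-3) K(2) np, of \<alpha>] ap by auto
  have q: "q \<alpha> \<ge> 0" "prior_q \<alpha> = q \<alpha>" and pq: "prior_pq \<alpha> = p \<theta>\<^sub>0 \<alpha> * q \<alpha>"
    using q_nonneg[OF ap] ap by (auto simp: prior_q_def prior_pq_def)
  have p0: "p \<theta>\<^sub>0 \<alpha> > 0" by (rule p_pos[OF ap])
  have jd: "joint_density n y (\<theta>, \<alpha>) = W * theta_kernel \<theta>\<^sub>0 n (theta_tilde_expl n y \<alpha>) \<theta> * (indicator {0<..} \<theta> * p \<theta> \<alpha>) * q \<alpha>" for \<theta>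
    using ap by (simp add: joint_density_def W_def q)
  have pd: "profile_density n (u_star n y) (v_star n y) \<alpha> = W * prior_pq \<alpha>" by (simp add: profile_density_def W_def)
  have contp: "continuous_on {0<..} (\<lambda>\<theta>. p \<theta> \<alpha>)" using p_C1[OF ap] by (rule C1_differentiable_imp_continuous_on)
  have meas[measurable]: "(\<lambda>\<theta>. indicator {0<..} \<theta> * p \<theta> \<alpha>) \<in> borel_measurable borel"
    using borel_measurable_continuous_on_indicator[OF _ contp] by simp
  have pint: "(\<integral>\<^sup>+\<theta>. ennreal (indicator {0<..} \<theta> * p \<theta> \<alpha>) \<partial>lborel) = 1"
    using p_density[OF ap] p_nonneg[OF _ ap]
    by (subst nn_integral_eq_integral)
      (auto simp: proper_density_def set_integrable_def set_lebesgue_integral_def split: split_indicator)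
  show ?thesis
  proof (cases "\<alpha> \<in> {alpha_lower n..alpha_upper n}")
    case True
    let ?h = "\<lambda>\<theta>. theta_kernel \<theta>\<^sub>0 n (theta_tilde_expl n y \<alpha>) \<theta> * (indicator {0<..} \<theta> * (p \<theta> \<alpha> / p \<theta>\<^sub>0 \<alpha>)) - normal_density m s \<theta>"
    have [measurable]: "(\<lambda>\<theta>. indicator {0<..} \<theta> * (p \<theta> \<alpha> / p \<theta>\<^sub>0 \<alpha>)) \<in> borel_measurable borel"
      using borel_measurable_times[OF meas borel_measurable_const[of "1 / p \<theta>\<^sub>0 \<alpha>"]] by simp
    have "joint_density n y (\<theta>, \<alpha>) - normal_density m s \<theta> * (W * prior_pq \<alpha>) = W * prior_pq \<alpha> * ?h \<theta>" for \<theta>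
      unfolding jd pq using p0 by (simp add: field_simps)
    then have "(\<integral>\<^sup>+\<theta>. ennreal \<bar>joint_density n y (\<theta>, \<alpha>) - normal_density m s \<theta> * (W * prior_pq \<alpha>)\<bar> \<partial>lborel)
        = (\<integral>\<^sup>+\<theta>. ennreal (W * prior_pq \<alpha>) * ennreal \<bar>?h \<theta>\<bar> \<partial>lborel)"
      using W by (simp add: abs_mult ennreal_mult)
    also have "\<dots> = ennreal (W * prior_pq \<alpha>) * (\<integral>\<^sup>+\<theta>. ennreal \<bar>?h \<theta>\<bar> \<partial>lborel)"
      by (rule nn_integral_cmult) measurable
    also have "\<dots> \<le> ennreal (C * sqrt \<alpha> * prior_pq \<alpha>) * ennreal \<eta>"
      using W by (intro mult_mono lap[OF True] ennreal_leI mult_right_mono) auto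
    also have "\<dots> = ennreal (C * sqrt \<alpha> * prior_pq \<alpha> * \<eta>)"
      using ap eta by (intro ennreal_mult[symmetric]) (auto simp: C_def)
    finally show ?thesis unfolding pd using True by (simp add: C_def mult_ac)
  next
    case False
    have tp: "theta_tilde_expl n y \<alpha> > 0"
    proof -
      have "1 + ((lag n \<alpha>)\<^sup>2 - 2 * u_star n y * lag n \<alpha>) / (real n * v_star n y) > 0"
        using profile_argument_pos(1)[OF K(1) r(1-3) K(2) np, where x = "lag n \<alpha>"]
          profile_argument_pos(2)[OF K(1) r(1-3) K(2) np] by linarith
      from log_lik_factorization(3)[OF n r(2) th0 th0 ap this] show ?thesis
        using theta_tilde_expl[OF n ap] by simp
    qed
    have le: "\<bar>joint_density n y (\<theta>, \<alpha>) - normal_density m s \<theta> * (W * prior_pq \<alpha>)\<bar>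
        \<le> W * kernel_bound n * q \<alpha> * (indicator {0<..} \<theta> * p \<theta> \<alpha>) + W * prior_pq \<alpha> * normal_density m s \<theta>" for \<theta>
    proof -
      have "joint_density n y (\<theta>, \<alpha>) \<le> W * kernel_bound n * q \<alpha> * (indicator {0<..} \<theta> * p \<theta> \<alpha>)"
        unfolding jd
      proof (cases "\<theta> > 0")
        case th: True
        have "W * theta_kernel \<theta>\<^sub>0 n (theta_tilde_expl n y \<alpha>) \<theta> * (p \<theta> \<alpha> * q \<alpha>) \<le> W * kernel_bound n * (p \<theta> \<alpha> * q \<alpha>)"
          using W q p_nonneg[OF th ap] theta_kernel_le[OF tp th] unfolding kernel_bound_def
          by (intro mult_right_mono mult_left_mono) auto
        then show "W * theta_kernel \<theta>\<^sub>0 n (theta_tilde_expl n y \<alpha>) \<theta> * (indicator {0<..} \<theta> * p \<theta> \<alpha>) * q \<alpha>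
            \<le> W * kernel_bound n * q \<alpha> * (indicator {0<..} \<theta> * p \<theta> \<alpha>)"
          using th by (simp add: mult_ac)
      qed simp
      moreover have "joint_density n y (\<theta>, \<alpha>) \<ge> 0" by (rule joint_density_nonneg[OF reg K np])
      moreover have "W * prior_pq \<alpha> * normal_density m s \<theta> \<ge> 0" using W by simp
      ultimately show ?thesis by (simp add: mult_ac)
    qed
    have kb: "kernel_bound n \<ge> 0" by (simp add: kernel_bound_def)
    have "(\<integral>\<^sup>+\<theta>. ennreal \<bar>joint_density n y (\<theta>, \<alpha>) - normal_density m s \<theta> * (W * prior_pq \<alpha>)\<bar> \<partial>lborel)
        \<le> (\<integral>\<^sup>+\<theta>. ennreal (W * kernel_bound n * q \<alpha>) * ennreal (indicator {0<..} \<theta> * p \<theta> \<alpha>)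
           + ennreal (W * prior_pq \<alpha>) * ennreal (normal_density m s \<theta>) \<partial>lborel)"
      using W q kb p_nonneg[OF _ ap]
      by (intro nn_integral_mono order_trans[OF ennreal_leI[OF le]])
        (simp add: ennreal_mult[symmetric] ennreal_plus[symmetric] del: ennreal_plus split: split_indicator)
    also have "\<dots> = ennreal (W * kernel_bound n * q \<alpha>) + ennreal (W * prior_pq \<alpha>)"
    proof -
      have "(\<integral>\<^sup>+\<theta>. ennreal (normal_density m s \<theta>) \<partial>lborel) = 1"
        using s by (subst nn_integral_eq_integral) auto
      then show ?thesis by (subst nn_integral_add) (simp_all add: nn_integral_cmult pint)
    qed
    also have "\<dots> \<le> ennreal (C * sqrt \<alpha> * kernel_bound n * q \<alpha>) + ennreal (C * sqrt \<alpha> * prior_pq \<alpha>)"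
      using W q kb by (intro add_mono ennreal_leI mult_right_mono) auto
    also have "\<dots> = ennreal (C * (kernel_bound n * (sqrt \<alpha> * prior_q \<alpha>) + sqrt \<alpha> * prior_pq \<alpha>))"
      using ap q kb by (subst ennreal_plus[symmetric]) (auto simp: C_def algebra_simps)
    also have "\<dots> \<le> ennreal (C * (\<eta> * (sqrt \<alpha> * prior_pq \<alpha>) + 1 * (kernel_bound n * (sqrt \<alpha> * prior_q \<alpha>) + sqrt \<alpha> * prior_pq \<alpha>)))"
      using ap eta by (intro ennreal_leI mult_left_mono) (auto simp: C_def)
    finally show ?thesis unfolding pd using False by (simp add: C_def)
  qed
qed

definition joint_error :: "real \<Rightarrow> nat \<Rightarrow> real" where
  "joint_error K n = exp (K ^ 3) * (theta_error K n * (\<integral>\<alpha>. sqrt \<alpha> * prior_pq \<alpha> \<partial>lborel)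
     + kernel_bound n * (\<integral>\<alpha>. indicator (- {alpha_lower n..alpha_upper n}) \<alpha> * (sqrt \<alpha> * prior_q \<alpha>) \<partial>lborel)
     + (\<integral>\<alpha>. indicator (- {alpha_lower n..alpha_upper n}) \<alpha> * (sqrt \<alpha> * prior_pq \<alpha>) \<partial>lborel))"

definition weight_error :: "real \<Rightarrow> nat \<Rightarrow> real" where
  "weight_error K n = (\<integral>\<alpha>. weight_gap K n \<alpha> * (sqrt \<alpha> * prior_pq \<alpha>) \<partial>lborel)"

lemma integrable_indicator_prior:
  "integrable lborel (\<lambda>\<alpha>. indicator (- {a..b}) \<alpha> * (sqrt \<alpha> * prior_q \<alpha>))"
  "integrable lborel (\<lambda>\<alpha>. indicator (- {a..b}) \<alpha> * (sqrt \<alpha> * prior_pq \<alpha>))"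
  using integrable_real_mult_indicator[OF _ integrable_prior(2), of "- {a..b}"]
    integrable_real_mult_indicator[OF _ integrable_prior(1), of "- {a..b}"]
  by (simp_all add: mult.commute mult.left_commute)

text \<open>No rate is involved here: integrability of
  \<open>sqrt \<alpha> * prior_pq \<alpha>\<close> is enough.\<close>

lemma outside_tendsto_0:
  "(\<lambda>n. \<integral>\<alpha>. indicator (- {alpha_lower n..alpha_upper n}) \<alpha> * (sqrt \<alpha> * prior_pq \<alpha>) \<partial>lborel) \<longlonglongrightarrow> 0"
proof -
  have "(\<lambda>n. \<integral>\<alpha>. indicator (- {alpha_lower n..alpha_upper n}) \<alpha> * (sqrt \<alpha> * prior_pq \<alpha>) \<partial>lborel)
     \<longlonglongrightarrow> (\<integral>\<alpha>. 0 \<partial>(lborel :: real measure))"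
  proof (rule integral_dominated_convergence[where w = "\<lambda>\<alpha>. sqrt \<alpha> * prior_pq \<alpha>"])
    show "AE \<alpha> in lborel. (\<lambda>n. indicator (- {alpha_lower n..alpha_upper n}) \<alpha> * (sqrt \<alpha> * prior_pq \<alpha>)) \<longlonglongrightarrow> 0"
    proof (intro AE_I2)
      fix \<alpha> :: real
      show "(\<lambda>n. indicator (- {alpha_lower n..alpha_upper n}) \<alpha> * (sqrt \<alpha> * prior_pq \<alpha>)) \<longlonglongrightarrow> 0"
      proof (cases "\<alpha> > 0")
        case True
        show ?thesis
          by (rule tendsto_eventually) (use alpha_range_eventually[OF True] in eventually_elim, simp)
      qed (simp add: prior_pq_def)
    qed
    show "AE \<alpha> in lborel. norm (indicator (- {alpha_lower n..alpha_upper n}) \<alpha> * (sqrt \<alpha> * prior_pq \<alpha>)) \<le> sqrt \<alpha> * prior_pq \<alpha>" for n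
      using sqrt_prior_nonneg(1) by (intro AE_I2) (simp split: split_indicator)
  qed (auto simp: integrable_prior)
  then show ?thesis by simp
qed

text \<open>\<open>kernel_bound n\<close> grows like \<open>sqrt n\<close>, so dominated convergence
  does not suffice; this is where the two tail hypotheses enter.\<close>

lemma outside_q_tendsto_0:
  "(\<lambda>n. kernel_bound n * (\<integral>\<alpha>. indicator (- {alpha_lower n..alpha_upper n}) \<alpha> * (sqrt \<alpha> * prior_q \<alpha>) \<partial>lborel)) \<longlonglongrightarrow> 0"
proof -
  define k where "k = 1 / sqrt (4 * pi * \<theta>\<^sub>0\<^sup>2)"
  have "(\<lambda>n. k * (sqrt (real n) * (LINT \<alpha>:{0<..<alpha_lower n}|lborel. sqrt \<alpha> * q \<alpha>)
      + sqrt (real n) * (LINT \<alpha>:{alpha_upper n<..}|lborel. sqrt \<alpha> * q \<alpha>))) \<longlonglongrightarrow> k * (0 + 0)"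
    by (intro tendsto_mult tendsto_add tendsto_const tail_lower tail_upper)
  moreover have "\<forall>\<^sub>F n in sequentially. k * (sqrt (real n) * (LINT \<alpha>:{0<..<alpha_lower n}|lborel. sqrt \<alpha> * q \<alpha>)
      + sqrt (real n) * (LINT \<alpha>:{alpha_upper n<..}|lborel. sqrt \<alpha> * q \<alpha>))
    = kernel_bound n * (\<integral>\<alpha>. indicator (- {alpha_lower n..alpha_upper n}) \<alpha> * (sqrt \<alpha> * prior_q \<alpha>) \<partial>lborel)"
    using alpha_range_eventually[OF a0] eventually_gt_at_top[of 0]
  proof eventually_elim
    case (elim n)
    have lu: "alpha_lower n \<le> alpha_upper n" "0 < alpha_upper n" using elim a0 by auto
    have sub: "{0<..<alpha_lower n} \<subseteq> {0<..}" "{alpha_upper n<..} \<subseteq> {0<..}" using lu by auto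
    have "(\<integral>\<alpha>. indicator (- {alpha_lower n..alpha_upper n}) \<alpha> * (sqrt \<alpha> * prior_q \<alpha>) \<partial>lborel)
        = (\<integral>\<alpha>. indicator {0<..<alpha_lower n} \<alpha> * (sqrt \<alpha> * q \<alpha>) + indicator {alpha_upper n<..} \<alpha> * (sqrt \<alpha> * q \<alpha>) \<partial>lborel)"
      using lu by (intro Bochner_Integration.integral_cong) (auto simp: prior_q_def split: split_indicator)
    also have "\<dots> = (LINT \<alpha>:{0<..<alpha_lower n}|lborel. sqrt \<alpha> * q \<alpha>) + (LINT \<alpha>:{alpha_upper n<..}|lborel. sqrt \<alpha> * q \<alpha>)"
      using set_integrable_subset[OF int_sqrt_q _ sub(1)] set_integrable_subset[OF int_sqrt_q _ sub(2)]
      by (simp add: set_integrable_def set_lebesgue_integral_def)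
    finally show ?case by (simp add: kernel_bound_def k_def real_sqrt_divide algebra_simps)
  qed
  ultimately show ?thesis by (simp add: Lim_transform_eventually)
qed

lemma joint_error_tendsto_0: "joint_error K \<longlonglongrightarrow> 0"
proof -
  have "joint_error K \<longlonglongrightarrow> exp (K ^ 3) * (0 * (\<integral>\<alpha>. sqrt \<alpha> * prior_pq \<alpha> \<partial>lborel) + 0 + 0)"
    unfolding joint_error_def
    by (intro tendsto_mult tendsto_add tendsto_const theta_error_tendsto_0 outside_q_tendsto_0 outside_tendsto_0)
  then show ?thesis by simp
qed

lemma weight_error_tendsto_0: "K > 0 \<Longrightarrow> weight_error K \<longlonglongrightarrow> 0"
proof -
  assume K: "K > 0"
  have "(\<lambda>n. \<integral>\<alpha>. weight_gap K n \<alpha> * (sqrt \<alpha> * prior_pq \<alpha>) \<partial>lborel) \<longlonglongrightarrow> (\<integral>\<alpha>. 0 \<partial>(lborel :: real measure))"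
  proof (rule integral_dominated_convergence[where w = "\<lambda>\<alpha>. exp (K ^ 3) * (sqrt \<alpha> * prior_pq \<alpha>)"])
    show "AE \<alpha> in lborel. (\<lambda>n. weight_gap K n \<alpha> * (sqrt \<alpha> * prior_pq \<alpha>)) \<longlonglongrightarrow> 0"
      by (intro AE_I2 tendsto_mult_left_zero weight_gap_tendsto_0)
    show "AE \<alpha> in lborel. norm (weight_gap K n \<alpha> * (sqrt \<alpha> * prior_pq \<alpha>)) \<le> exp (K ^ 3) * (sqrt \<alpha> * prior_pq \<alpha>)" for n
    proof (intro AE_I2)
      fix \<alpha> :: real
      show "norm (weight_gap K n \<alpha> * (sqrt \<alpha> * prior_pq \<alpha>)) \<le> exp (K ^ 3) * (sqrt \<alpha> * prior_pq \<alpha>)"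
      proof (cases "\<alpha> > 0")
        case True
        then have "\<bar>weight_gap K n \<alpha>\<bar> \<le> exp (K ^ 3)" using weight_gap_bounds[OF K, of \<alpha> n] by simp
        from mult_right_mono[OF this sqrt_prior_nonneg(1)[of \<alpha>]] sqrt_prior_nonneg(1)[of \<alpha>] show ?thesis
          by (simp only: real_norm_def abs_mult[of "weight_gap K n \<alpha>"] abs_of_nonneg)
      qed (simp add: prior_pq_def)
    qed
  qed (auto simp: integrable_prior)
  then show ?thesis by (simp add: weight_error_def[abs_def])
qed

text \<open>The fibre estimate integrated over \<alpha>, with \<theta> as the inner
  variable.\<close>

lemma joint_profile_L1:
  assumes K: "K > 0"
  shows "\<forall>\<^sub>F n in sequentially. \<forall>y. regular_sample \<theta>\<^sub>0 K n y \<longrightarrow>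
    (\<integral>\<^sup>+z. ennreal \<bar>joint_density n y z - (case z of (\<theta>, \<alpha>) \<Rightarrow>
        normal_density (theta_tilde n y \<alpha>\<^sub>0) (sqrt (2 * \<theta>\<^sub>0\<^sup>2 / real n)) \<theta> * profile_density n (u_star n y) (v_star n y) \<alpha>)\<bar>
      \<partial>lborel2) \<le> ennreal (joint_error K n)"
proof -
  have "\<forall>\<^sub>F n in sequentially. 2 * K ^ 3 \<le> real n"
    using filterlim_real_sequentially by (simp add: filterlim_at_top)
  with p_laplace[OF K] eventually_ge_at_top[of 2] show ?thesis
  proof eventually_elim
    case (elim n)
    show ?case
    proof (intro allI impI)
      fix y assume reg: "regular_sample \<theta>\<^sub>0 K n y"
      let ?m = "theta_tilde n y \<alpha>\<^sub>0" and ?s = "sqrt (2 * \<theta>\<^sub>0\<^sup>2 / real n)"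
      let ?pd = "profile_density n (u_star n y) (v_star n y)"
      let ?I = "{alpha_lower n..alpha_upper n}"
      have s: "?s > 0" using th0 elim(2) by simp
      have kb: "kernel_bound n \<ge> 0" by (simp add: kernel_bound_def)
      let ?T = "\<lambda>\<alpha>. exp (K ^ 3) * (theta_error K n * (sqrt \<alpha> * prior_pq \<alpha>)
          + kernel_bound n * (indicator (- ?I) \<alpha> * (sqrt \<alpha> * prior_q \<alpha>)) + indicator (- ?I) \<alpha> * (sqrt \<alpha> * prior_pq \<alpha>))"
      have "(\<integral>\<^sup>+z. ennreal \<bar>joint_density n y z - (case z of (\<theta>, \<alpha>) \<Rightarrow> normal_density ?m ?s \<theta> * ?pd \<alpha>)\<bar> \<partial>lborel2)
        = (\<integral>\<^sup>+\<alpha>. \<integral>\<^sup>+\<theta>. ennreal \<bar>joint_density n y (\<theta>, \<alpha>) - normal_density ?m ?s \<theta> * ?pd \<alpha>\<bar> \<partial>lborel \<partial>lborel)"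
        by (subst lborel_pair.nn_integral_snd[symmetric]) (auto simp: case_prod_beta)
      also have "\<dots> \<le> (\<integral>\<^sup>+\<alpha>. ennreal (exp (K ^ 3) * (theta_error K n * (sqrt \<alpha> * prior_pq \<alpha>) + indicator (- ?I) \<alpha>
          * (kernel_bound n * (sqrt \<alpha> * prior_q \<alpha>) + sqrt \<alpha> * prior_pq \<alpha>))) \<partial>lborel)"
        using elim(1) reg s theta_error_nonneg[OF K]
        by (intro nn_integral_mono joint_profile_fibre[OF K elim(3,2) reg]) auto
      also have "\<dots> = (\<integral>\<^sup>+\<alpha>. ennreal (?T \<alpha>) \<partial>lborel)"
        by (intro nn_integral_cong arg_cong[where f = ennreal]) (simp add: algebra_simps)
      also have "\<dots> = ennreal (\<integral>\<alpha>. ?T \<alpha> \<partial>lborel)"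
      proof (rule nn_integral_eq_integral)
        show "AE \<alpha> in lborel. 0 \<le> ?T \<alpha>"
          by (intro AE_I2 mult_nonneg_nonneg add_nonneg_nonneg theta_error_nonneg[OF K] kb sqrt_prior_nonneg) auto
        show "integrable lborel (\<lambda>\<alpha>. ?T \<alpha>)"
          by (intro integrable_mult_right Bochner_Integration.integrable_add integrable_prior integrable_indicator_prior)
      qed
      also have "(\<integral>\<alpha>. ?T \<alpha> \<partial>lborel)
        = joint_error K n"
        unfolding joint_error_def
        using integrable_prior integrable_indicator_prior[of "alpha_lower n" "alpha_upper n"] by simp
      finally show "(\<integral>\<^sup>+z. ennreal \<bar>joint_density n y z - (case z of (\<theta>, \<alpha>) \<Rightarrow> normal_density ?m ?s \<theta> * ?pd \<alpha>)\<bar> \<partial>lborel2)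
        \<le> ennreal (joint_error K n)" .
    qed
  qed
qed

end

section \<open>From \<open>L\<^sup>1\<close> errors to total variation, and the exclusion of point
  masses\<close>

lemma normal_product_integral:
  assumes s: "s > 0" and [measurable]: "h \<in> borel_measurable borel" and h: "\<And>x. h x \<ge> 0" "integrable lborel h"
  shows "integrable lborel2 (\<lambda>(\<theta>, \<alpha>). normal_density m s \<theta> * h \<alpha>)"
    and "(\<integral>z. (case z of (\<theta>, \<alpha>) \<Rightarrow> normal_density m s \<theta> * h \<alpha>) \<partial>lborel2) = (\<integral>\<alpha>. h \<alpha> \<partial>lborel)"
proof -
  have "(\<integral>\<^sup>+\<theta>. ennreal (normal_density m s \<theta>) \<partial>lborel) = 1"
    using s by (subst nn_integral_eq_integral) auto
  then have "(\<integral>\<^sup>+z. ennreal (case z of (\<theta>, \<alpha>) \<Rightarrow> normal_density m s \<theta> * h \<alpha>) \<partial>lborel2)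
      = (\<integral>\<^sup>+\<alpha>. ennreal (h \<alpha>) \<partial>lborel)"
    by (subst lborel_pair.nn_integral_snd[symmetric]) (auto simp: case_prod_beta ennreal_mult' nn_integral_multc)
  also have "\<dots> = ennreal (\<integral>\<alpha>. h \<alpha> \<partial>lborel)" using h by (intro nn_integral_eq_integral) auto
  finally have nn: "(\<integral>\<^sup>+z. ennreal (case z of (\<theta>, \<alpha>) \<Rightarrow> normal_density m s \<theta> * h \<alpha>) \<partial>lborel2)
      = ennreal (\<integral>\<alpha>. h \<alpha> \<partial>lborel)" .
  show "integrable lborel2 (\<lambda>(\<theta>, \<alpha>). normal_density m s \<theta> * h \<alpha>)"
    by (rule integrableI_nonneg) (use h nn in \<open>auto simp: case_prod_beta\<close>)
  show "(\<integral>z. (case z of (\<theta>, \<alpha>) \<Rightarrow> normal_density m s \<theta> * h \<alpha>) \<partial>lborel2) = (\<integral>\<alpha>. h \<alpha> \<partial>lborel)"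
    by (subst integral_eq_nn_integral) (use h nn in \<open>auto simp: case_prod_beta\<close>)
qed

text \<open>A continuous tent of height 1 with support in \<open>{a - d..a + d}\<close>: the test
  function against convergence to the point mass at \<open>a\<close>.\<close>

definition bump :: "real \<Rightarrow> real \<Rightarrow> real \<Rightarrow> real" where
  "bump a d x = max 0 (1 - \<bar>x - a\<bar> / d)"

context ou_posterior begin

lemma integrable_densities:
  assumes "K > 0" "\<bar>u\<bar> \<le> K" "v > 0" "1 / v \<le> K" "real n \<ge> 2 * K ^ 3" "n > 0"
  shows "integrable lborel (profile_density n u v)" "integrable lborel (limit_density u v)"
proof -
  have I: "integrable lborel (\<lambda>\<alpha>. exp (K ^ 3) * (sqrt \<alpha> * prior_pq \<alpha>))" by (simp add: integrable_prior)
  show "integrable lborel (profile_density n u v)"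
    by (rule Bochner_Integration.integrable_bound[OF I])
      (use density_nonneg[OF assms] sqrt_prior_nonneg in \<open>auto simp: abs_of_nonneg\<close>)
  show "integrable lborel (limit_density u v)"
    by (rule Bochner_Integration.integrable_bound[OF I])
      (use density_nonneg[OF assms] sqrt_prior_nonneg in \<open>auto simp: abs_of_nonneg\<close>)
qed

text \<open>The sample-free lower bound for the weight, integrated over a bounded interval that
  reaches beyond \<open>\<alpha>\<^sub>0\<close>, near which the prior is positive.\<close>

definition min_mass :: "real \<Rightarrow> real" where
  "min_mass K = (\<integral>\<alpha>. indicator {0<..\<alpha>\<^sub>0 + 1} \<alpha> * (exp (- (K * (\<alpha>\<^sup>2 + 2 * K * \<alpha>))) * (sqrt \<alpha> * prior_pq \<alpha>)) \<partial>lborel)"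

lemma min_mass:
  assumes K: "K > 0"
  shows "min_mass K > 0"
    and "\<bar>u\<bar> \<le> K \<Longrightarrow> v > 0 \<Longrightarrow> 1 / v \<le> K \<Longrightarrow> min_mass K \<le> (\<integral>\<alpha>. limit_density u v \<alpha> \<partial>lborel)"
proof -
  let ?g = "\<lambda>\<alpha>. indicator {0<..\<alpha>\<^sub>0 + 1} \<alpha> * (exp (- (K * (\<alpha>\<^sup>2 + 2 * K * \<alpha>))) * (sqrt \<alpha> * prior_pq \<alpha>))"
  have nn: "?g \<alpha> \<ge> 0" for \<alpha> by (intro mult_nonneg_nonneg sqrt_prior_nonneg) auto
  have int: "integrable lborel ?g"
  proof (rule Bochner_Integration.integrable_bound[OF integrable_prior(1)])
    have "?g \<alpha> \<le> sqrt \<alpha> * prior_pq \<alpha>" for \<alpha>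
    proof (cases "\<alpha> \<in> {0<..\<alpha>\<^sub>0 + 1}")
      case True
      then have "K * (\<alpha>\<^sup>2 + 2 * K * \<alpha>) \<ge> 0" using K by simp
      then have "exp (- (K * (\<alpha>\<^sup>2 + 2 * K * \<alpha>))) \<le> 1" by simp
      from mult_right_mono[OF this sqrt_prior_nonneg(1)] True show ?thesis by simp
    qed (simp add: sqrt_prior_nonneg)
    then show "AE \<alpha> in lborel. norm (?g \<alpha>) \<le> norm (sqrt \<alpha> * prior_pq \<alpha>)"
      using nn sqrt_prior_nonneg(1) by (intro AE_I2) (simp only: real_norm_def abs_of_nonneg)
  qed simp
  show "min_mass K > 0"
    unfolding min_mass_def
  proof (rule prior_integral_pos[OF _ _ int nn])
    show "exp (- (K * (\<alpha>\<^sup>2 + 2 * K * \<alpha>))) * sqrt \<alpha> * prior_pq \<alpha> \<le> ?g \<alpha>" if "\<alpha> \<in> {0<..\<alpha>\<^sub>0 + 1}" for \<alpha>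
      using that by (simp add: mult_ac)
  qed simp
  assume uv: "\<bar>u\<bar> \<le> K" "v > 0" "1 / v \<le> K"
  \<comment> \<open>The limit density does not involve the sample size; any \<open>n\<close> past
    the threshold gives access to the bounds stated with \<open>n\<close>.\<close>
  obtain n0 :: nat where n0: "2 * K ^ 3 < real n0" using reals_Archimedean2 by blast
  define n where "n = Suc n0"
  have n: "real n \<ge> 2 * K ^ 3" "n > 0" using n0 by (simp_all add: n_def)
  show "min_mass K \<le> (\<integral>\<alpha>. limit_density u v \<alpha> \<partial>lborel)"
    unfolding min_mass_def
  proof (rule integral_mono[OF int integrable_densities(2)[OF K uv n]])
    fix \<alpha>
    show "?g \<alpha> \<le> limit_density u v \<alpha>"
    proof (cases "\<alpha> \<in> {0<..\<alpha>\<^sub>0 + 1}")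
      case True
      have "exp (- (K * (\<alpha>\<^sup>2 + 2 * K * \<alpha>))) * sqrt \<alpha> * prior_pq \<alpha> \<le> limit_weight u v \<alpha> * prior_pq \<alpha>"
        using limit_weight_bounds(3)[OF K uv, of \<alpha>] True by (intro mult_right_mono) auto
      then show ?thesis using True by (simp add: limit_density_def mult_ac)
    qed (use density_nonneg(3)[OF K uv n] in simp)
  qed
qed

lemma profile_limit_L1:
  assumes K: "K > 0" "\<bar>u\<bar> \<le> K" "v > 0" "1 / v \<le> K" "real n \<ge> 2 * K ^ 3" "n > 0" and s: "s > 0"
  shows "(\<integral>\<alpha>. \<bar>profile_density n u v \<alpha> - limit_density u v \<alpha>\<bar> \<partial>lborel) \<le> weight_error K n"
    and "(\<integral>\<^sup>+z. ennreal \<bar>(case z of (\<theta>, \<alpha>) \<Rightarrow> normal_density m s \<theta> * profile_density n u v \<alpha>)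
       - (case z of (\<theta>, \<alpha>) \<Rightarrow> normal_density m s \<theta> * limit_density u v \<alpha>)\<bar> \<partial>lborel2) \<le> ennreal (weight_error K n)" (is "?L \<le> _")
proof -
  let ?h = "\<lambda>\<alpha>. \<bar>profile_density n u v \<alpha> - limit_density u v \<alpha>\<bar>"
  have hi: "integrable lborel ?h" using integrable_densities[OF K] by simp
  show le: "(\<integral>\<alpha>. ?h \<alpha> \<partial>lborel) \<le> weight_error K n"
    unfolding weight_error_def
  proof (rule integral_mono[OF hi])
    show "integrable lborel (\<lambda>\<alpha>. weight_gap K n \<alpha> * (sqrt \<alpha> * prior_pq \<alpha>))"
    proof (rule Bochner_Integration.integrable_bound[where f = "\<lambda>\<alpha>. exp (K ^ 3) * (sqrt \<alpha> * prior_pq \<alpha>)"])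
      show "AE \<alpha> in lborel. norm (weight_gap K n \<alpha> * (sqrt \<alpha> * prior_pq \<alpha>)) \<le> norm (exp (K ^ 3) * (sqrt \<alpha> * prior_pq \<alpha>))"
      proof (intro AE_I2)
        fix \<alpha> :: real
        show "norm (weight_gap K n \<alpha> * (sqrt \<alpha> * prior_pq \<alpha>)) \<le> norm (exp (K ^ 3) * (sqrt \<alpha> * prior_pq \<alpha>))"
        proof (cases "\<alpha> > 0")
          case True
          then have "\<bar>weight_gap K n \<alpha>\<bar> \<le> \<bar>exp (K ^ 3)\<bar>" using weight_gap_bounds[OF K(1), of \<alpha> n] by simp
          from mult_right_mono[OF this abs_ge_zero[of "sqrt \<alpha> * prior_pq \<alpha>"]] show ?thesis
            by (simp only: real_norm_def abs_mult)
        qed (simp add: prior_pq_def)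
      qed
    qed (auto simp: integrable_prior)
  qed (rule density_nonneg(5)[OF K])
  have "?L
      = (\<integral>\<^sup>+z. ennreal (case z of (\<theta>, \<alpha>) \<Rightarrow> normal_density m s \<theta> * ?h \<alpha>) \<partial>lborel2)"
    by (intro nn_integral_cong) (auto simp: right_diff_distrib[symmetric] abs_mult)
  also have "\<dots> = ennreal (\<integral>z. (case z of (\<theta>, \<alpha>) \<Rightarrow> normal_density m s \<theta> * ?h \<alpha>) \<partial>lborel2)"
    by (intro nn_integral_eq_integral normal_product_integral s hi) auto
  also have "\<dots> = ennreal (\<integral>\<alpha>. ?h \<alpha> \<partial>lborel)"
    by (subst normal_product_integral[OF s _ _ hi]) auto
  also have "\<dots> \<le> ennreal (weight_error K n)" by (intro ennreal_leI le)
  finally show "?L \<le> ennreal (weight_error K n)" .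
qed

text \<open>The product with the limit density has mass at least \<open>c = min_mass K\<close>, that
  with the profile density at least \<open>c / 2\<close>. So \<open>L\<^sup>1\<close> errors of
  \<open>2 * e'\<close> and \<open>e'\<close> translate into total variation. The last clause
  compares the posterior with the limit and then the limit with its dominating function; its right
  side does not depend on the sample.\<close>

lemma posterior_approximation:
  assumes K: "K > 0" and e: "e > 0"
  shows "\<forall>\<^sub>F n in sequentially. \<forall>y. regular_sample \<theta>\<^sub>0 K n y \<longrightarrow>
     \<bar>tv_dist (joint_posterior p q n y) (normal_measure (theta_tilde n y \<alpha>\<^sub>0) (2 * \<theta>\<^sub>0\<^sup>2 / real n)
        \<Otimes>\<^sub>M profile_posterior p q \<theta>\<^sub>0 n y)\<bar> \<le> e
   \<and> \<bar>tv_dist (joint_posterior p q n y) (normal_measure (theta_tilde n y \<alpha>\<^sub>0) (2 * \<theta>\<^sub>0\<^sup>2 / real n)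
        \<Otimes>\<^sub>M star_posterior p q \<theta>\<^sub>0 n y)\<bar> \<le> e
   \<and> prob_space (joint_posterior p q n y)
   \<and> (\<forall>B\<in>sets borel. measure (joint_posterior p q n y) (UNIV \<times> B)
        \<le> exp (K ^ 3) * (\<integral>\<alpha>. (sqrt \<alpha> * prior_pq \<alpha>) * indicator B \<alpha> \<partial>lborel) / min_mass K + e)"
    (is "\<forall>\<^sub>F n in _. \<forall>y. _ \<longrightarrow> ?Q n y")
proof -
  define c where "c = min_mass K"
  have c: "c > 0" unfolding c_def by (rule min_mass[OF K])
  \<comment> \<open>The 8 makes \<open>4 * e' / (c / 2)\<close> equal to \<open>min e 1\<close>; the
    minimum keeps the errors below the masses for large \<open>e\<close> as well.\<close>
  define e' where "e' = min e 1 * c / 8"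
  have e': "e' > 0" "e' < c / 4" "4 * e' / (c / 2) \<le> e"
    using e c by (auto simp: e'_def min_def field_simps)
  have ev: "\<forall>\<^sub>F n in sequentially. 2 * K ^ 3 \<le> real n"
    using filterlim_real_sequentially by (simp add: filterlim_at_top)
  show ?thesis
    using ev eventually_ge_at_top[of 2] joint_profile_L1[OF K]
      order_tendstoD(2)[OF joint_error_tendsto_0 e'(1), of K] order_tendstoD(2)[OF weight_error_tendsto_0[OF K] e'(1)]
  proof eventually_elim
    case (elim n)
    have n: "n > 0" using elim(2) by simp
    show ?case
    proof (intro allI impI)
      fix y assume reg: "regular_sample \<theta>\<^sub>0 K n y"
      note r = regularD(1-3)[OF reg]
      define m where "m = theta_tilde n y \<alpha>\<^sub>0"
      define V where "V = 2 * \<theta>\<^sub>0\<^sup>2 / real n"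
      define s where "s = sqrt V"
      define u v where "u = u_star n y" and "v = v_star n y"
      define f where "f = joint_density n y"
      define g1 where "g1 = (\<lambda>(\<theta>, \<alpha>). normal_density m s \<theta> * profile_density n u v \<alpha>)"
      define g2 where "g2 = (\<lambda>(\<theta>, \<alpha>). normal_density m s \<theta> * limit_density u v \<alpha>)"
      have V: "V > 0" using th0 n by (simp add: V_def)
      then have s: "s > 0" by (simp add: s_def)
      note uv = r[folded u_def v_def]
      note dn = density_nonneg[OF K uv elim(1) n] and di = integrable_densities[OF K uv elim(1) n]
      have mass2: "c \<le> (\<integral>\<alpha>. limit_density u v \<alpha> \<partial>lborel)" unfolding c_def by (rule min_mass(2)[OF K uv])
      have mass1: "c / 2 \<le> (\<integral>\<alpha>. profile_density n u v \<alpha> \<partial>lborel)"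
      proof -
        have "(\<integral>\<alpha>. limit_density u v \<alpha> \<partial>lborel) - (\<integral>\<alpha>. profile_density n u v \<alpha> \<partial>lborel)
            = - (\<integral>\<alpha>. profile_density n u v \<alpha> - limit_density u v \<alpha> \<partial>lborel)"
          using di by simp
        also have "\<dots> \<le> (\<integral>\<alpha>. \<bar>profile_density n u v \<alpha> - limit_density u v \<alpha>\<bar> \<partial>lborel)"
          using integral_abs_bound[of lborel "\<lambda>\<alpha>. profile_density n u v \<alpha> - limit_density u v \<alpha>"] by linarith
        also have "\<dots> \<le> e'" using profile_limit_L1(1)[OF K uv elim(1) n s] elim(5) by linarith
        finally show ?thesis using mass2 e' by linarith
      qed
      have [measurable]: "f \<in> borel_measurable lborel2" "g1 \<in> borel_measurable lborel2"
        "g2 \<in> borel_measurable lborel2"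
        by (simp_all add: f_def g1_def g2_def)
      have f0: "f z \<ge> 0" for z unfolding f_def by (rule joint_density_nonneg[OF reg K elim(1) n])
      have g0: "g1 z \<ge> 0" "g2 z \<ge> 0" for z using dn by (auto simp: g1_def g2_def split: prod.split)
      have gi: "integrable lborel2 g1" "integrable lborel2 g2"
        and gm: "(\<integral>z. g1 z \<partial>lborel2) = (\<integral>\<alpha>. profile_density n u v \<alpha> \<partial>lborel)"
          "(\<integral>z. g2 z \<partial>lborel2) = (\<integral>\<alpha>. limit_density u v \<alpha> \<partial>lborel)"
        unfolding g1_def g2_def using normal_product_integral[OF s _ _ di(1), of m] normal_product_integral[OF s _ _ di(2), of m] dn
        by auto
      have L1: "(\<integral>\<^sup>+z. ennreal \<bar>f z - g1 z\<bar> \<partial>lborel2) \<le> ennreal e'"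
        using elim(3) reg elim(4) unfolding f_def g1_def m_def s_def V_def u_def v_def
        by (auto intro: order_trans[OF _ ennreal_leI])
      have L2: "(\<integral>\<^sup>+z. ennreal \<bar>f z - g2 z\<bar> \<partial>lborel2) \<le> ennreal (2 * e')"
      proof -
        have "(\<integral>\<^sup>+z. ennreal \<bar>f z - g2 z\<bar> \<partial>lborel2)
            \<le> (\<integral>\<^sup>+z. ennreal \<bar>f z - g1 z\<bar> + ennreal \<bar>g1 z - g2 z\<bar> \<partial>lborel2)"
          by (intro nn_integral_mono) (simp add: ennreal_plus[symmetric] del: ennreal_plus)
        also have "\<dots> = (\<integral>\<^sup>+z. ennreal \<bar>f z - g1 z\<bar> \<partial>lborel2) + (\<integral>\<^sup>+z. ennreal \<bar>g1 z - g2 z\<bar> \<partial>lborel2)"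
          by (rule nn_integral_add) measurable
        also have "\<dots> \<le> ennreal e' + ennreal e'"
          using profile_limit_L1(2)[OF K uv elim(1) n s, of m] elim(5)
          by (intro add_mono L1) (auto simp: g1_def g2_def intro: order_trans[OF _ ennreal_leI])
        also have "\<dots> = ennreal (2 * e')" using e' by (simp add: ennreal_plus[symmetric] del: ennreal_plus)
        finally show ?thesis .
      qed
      have e'': "0 \<le> e'" "e' < c / 2" "0 \<le> 2 * e'" "2 * e' < c" using e' c by auto
      have G1: "c / 2 \<le> (\<integral>z. g1 z \<partial>lborel2)" using mass1 gm by simp
      have G2: "c \<le> (\<integral>z. g2 z \<partial>lborel2)" using mass2 gm by simp
      note close1 = normalized_close[OF _ _ f0 g0(1) gi(1) L1 e''(1,2) G1]
        and close2 = normalized_close[OF _ _ f0 g0(2) gi(2) L2 e''(3,4) G2]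
      note pn = posteriors_normalized[OF reg K elim(1,2), folded u_def v_def f_def]
      have pos: "(\<integral>\<alpha>. profile_density n u v \<alpha> \<partial>lborel) > 0" "(\<integral>\<alpha>. limit_density u v \<alpha> \<partial>lborel) > 0"
        using mass1 mass2 c by linarith+
      have P1: "normal_measure m V \<Otimes>\<^sub>M profile_posterior p q \<theta>\<^sub>0 n y = normalized lborel2 g1"
        unfolding pn g1_def s_def by (rule normal_measure_pair_normalized[OF V _ dn(1) di(1) pos(1)]) simp
      have P2: "normal_measure m V \<Otimes>\<^sub>M star_posterior p q \<theta>\<^sub>0 n y = normalized lborel2 g2"
        unfolding pn g2_def s_def by (rule normal_measure_pair_normalized[OF V _ dn(3) di(2) pos(2)]) simp
      have t1: "\<bar>tv_dist (joint_posterior p q n y) (normal_measure m V \<Otimes>\<^sub>M profile_posterior p q \<theta>\<^sub>0 n y)\<bar> \<le> e"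
      proof -
        have "2 * e' / (c / 2) \<le> 4 * e' / (c / 2)" using e' c by (intro divide_right_mono) auto
        then show ?thesis unfolding P1 pn(1) using close1(4) e'(3) by simp
      qed
      have ec: "2 * (2 * e') / c \<le> e"
      proof -
        have "2 * (2 * e') / c \<le> 4 * e' / (c / 2)" using e' c by (intro frac_le) auto
        then show ?thesis using e'(3) by linarith
      qed
      have t2: "\<bar>tv_dist (joint_posterior p q n y) (normal_measure m V \<Otimes>\<^sub>M star_posterior p q \<theta>\<^sub>0 n y)\<bar> \<le> e"
        unfolding P2 pn(1) using close2(4) ec by simp
      have t3: "prob_space (joint_posterior p q n y)"
        unfolding pn by (rule prob_space_normalized) (use f0 close1 in auto)
      have t4: "measure (joint_posterior p q n y) (UNIV \<times> B)
        \<le> exp (K ^ 3) * (\<integral>\<alpha>. (sqrt \<alpha> * prior_pq \<alpha>) * indicator B \<alpha> \<partial>lborel) / min_mass K + e" if B: "B \<in> sets borel" for B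
      proof -
        have [measurable]: "B \<in> sets borel" by fact
        have A: "UNIV \<times> B \<in> sets lborel2" by simp
        have "measure (joint_posterior p q n y) (UNIV \<times> B) \<le> measure (normalized lborel2 g2) (UNIV \<times> B) + e"
          unfolding pn using close2(3)[OF _ _ A] ec by simp
        also have "measure (normalized lborel2 g2) (UNIV \<times> B)
            = (\<integral>z. g2 z * indicator (UNIV \<times> B) z \<partial>lborel2) / (\<integral>z. g2 z \<partial>lborel2)"
          using c G2 A by (intro measure_normalized g0 gi) auto
        also have "(\<integral>z. g2 z * indicator (UNIV \<times> B) z \<partial>lborel2)
            = (\<integral>z. (case z of (\<theta>, \<alpha>) \<Rightarrow> normal_density m s \<theta> * (limit_density u v \<alpha> * indicator B \<alpha>)) \<partial>lborel2)"
          by (intro Bochner_Integration.integral_cong) (auto simp: g2_def indicator_def)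
        also have "\<dots> = (\<integral>\<alpha>. limit_density u v \<alpha> * indicator B \<alpha> \<partial>lborel)"
          using dn di by (intro normal_product_integral s integrable_real_mult_indicator) auto
        also have "\<dots> / (\<integral>z. g2 z \<partial>lborel2) \<le> (exp (K ^ 3) * (\<integral>\<alpha>. (sqrt \<alpha> * prior_pq \<alpha>) * indicator B \<alpha> \<partial>lborel)) / c"
        proof (rule frac_le)
          have "(\<integral>\<alpha>. limit_density u v \<alpha> * indicator B \<alpha> \<partial>lborel)
              \<le> (\<integral>\<alpha>. exp (K ^ 3) * ((sqrt \<alpha> * prior_pq \<alpha>) * indicator B \<alpha>) \<partial>lborel)"
          proof (rule integral_mono)
            show "integrable lborel (\<lambda>\<alpha>. limit_density u v \<alpha> * indicator B \<alpha>)"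
              using di by (intro integrable_real_mult_indicator) auto
            show "integrable lborel (\<lambda>\<alpha>. exp (K ^ 3) * ((sqrt \<alpha> * prior_pq \<alpha>) * indicator B \<alpha>))"
              by (intro integrable_mult_right integrable_real_mult_indicator integrable_prior) auto
            show "limit_density u v \<alpha> * indicator B \<alpha> \<le> exp (K ^ 3) * ((sqrt \<alpha> * prior_pq \<alpha>) * indicator B \<alpha>)" for \<alpha>
              using dn(4)[of \<alpha>] by (simp split: split_indicator)
          qed
          then show "(\<integral>\<alpha>. limit_density u v \<alpha> * indicator B \<alpha> \<partial>lborel)
              \<le> exp (K ^ 3) * (\<integral>\<alpha>. (sqrt \<alpha> * prior_pq \<alpha>) * indicator B \<alpha> \<partial>lborel)" by simp
          show "0 \<le> exp (K ^ 3) * (\<integral>\<alpha>. (sqrt \<alpha> * prior_pq \<alpha>) * indicator B \<alpha> \<partial>lborel)"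
            by (intro mult_nonneg_nonneg integral_nonneg_AE AE_I2 sqrt_prior_nonneg) auto
        qed (use c G2 in auto)
        finally show ?thesis unfolding c_def by simp
      qed
      show "?Q n y"
        using t1 t2 t3 t4 unfolding m_def V_def by blast
    qed
  qed
qed

text \<open>The dominating integral over \<open>{a - d..a + d}\<close> tends to 0 with
  \<open>d\<close>, because a single point is a null set. Its multiple is made smaller than
  \<open>1 / 4\<close>, and the approximation error takes the other \<open>1 / 4\<close>.\<close>

lemma alpha_posterior_bump:
  assumes K: "K > 0"
  shows "\<exists>d>0. \<forall>\<^sub>F n in sequentially. \<forall>y. regular_sample \<theta>\<^sub>0 K n y \<longrightarrow>
    (\<integral>x. bump a d x \<partial>alpha_posterior p q n y) \<le> 1 / 2"
proof -
  let ?J = "\<lambda>k :: nat. {a - 1 / real (Suc k)..a + 1 / real (Suc k)}"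
  have "(\<lambda>k. \<integral>\<alpha>. (sqrt \<alpha> * prior_pq \<alpha>) * indicator (?J k) \<alpha> \<partial>lborel) \<longlonglongrightarrow> (\<integral>\<alpha>. 0 \<partial>(lborel :: real measure))"
  proof (rule integral_dominated_convergence[where w = "\<lambda>\<alpha>. sqrt \<alpha> * prior_pq \<alpha>"])
    show "AE \<alpha> in lborel. (\<lambda>k. (sqrt \<alpha> * prior_pq \<alpha>) * indicator (?J k) \<alpha>) \<longlonglongrightarrow> 0"
      using AE_lborel_singleton[of a]
    proof eventually_elim
      case (elim \<alpha>)
      then have "\<bar>\<alpha> - a\<bar> > 0" by simp
      from order_tendstoD(2)[OF LIMSEQ_Suc[OF lim_const_over_n[of 1]] this]
      have "\<forall>\<^sub>F k in sequentially. 1 / real (Suc k) < \<bar>\<alpha> - a\<bar>" by simp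
      then show ?case
        by (intro tendsto_eventually) (erule eventually_mono, auto split: split_indicator)
    qed
    show "AE \<alpha> in lborel. norm ((sqrt \<alpha> * prior_pq \<alpha>) * indicator (?J k) \<alpha>) \<le> sqrt \<alpha> * prior_pq \<alpha>" for k
      using sqrt_prior_nonneg(1) by (intro AE_I2) (simp split: split_indicator)
  qed (auto simp: integrable_prior)
  then have lim: "(\<lambda>k. exp (K ^ 3) * (\<integral>\<alpha>. (sqrt \<alpha> * prior_pq \<alpha>) * indicator (?J k) \<alpha> \<partial>lborel) / min_mass K) \<longlonglongrightarrow> exp (K ^ 3) * 0 / min_mass K"
    using min_mass(1)[OF K] by (intro tendsto_intros) auto
  then have "\<forall>\<^sub>F k in sequentially. exp (K ^ 3) * (\<integral>\<alpha>. (sqrt \<alpha> * prior_pq \<alpha>) * indicator (?J k) \<alpha> \<partial>lborel) / min_mass K < 1 / 4"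
    by (rule order_tendstoD) simp
  then obtain k where k: "exp (K ^ 3) * (\<integral>\<alpha>. (sqrt \<alpha> * prior_pq \<alpha>) * indicator (?J k) \<alpha> \<partial>lborel) / min_mass K < 1 / 4"
    unfolding eventually_sequentially by blast
  define d where "d = 1 / real (Suc k)"
  have d: "d > 0" by (simp add: d_def)
  have "\<forall>\<^sub>F n in sequentially. \<forall>y. regular_sample \<theta>\<^sub>0 K n y \<longrightarrow>
    (\<integral>x. bump a d x \<partial>alpha_posterior p q n y) \<le> 1 / 2"
    using posterior_approximation[OF K, of "1 / 4", simplified]
  proof eventually_elim
    case (elim n)
    show ?case
    proof (intro allI impI)
      fix y assume reg: "regular_sample \<theta>\<^sub>0 K n y"
      let ?P = "joint_posterior p q n y"
      interpret P: prob_space ?P using elim reg by blast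
      have sets: "sets ?P = sets lborel2" by (simp add: joint_posterior_def)
      have [measurable]: "snd \<in> borel_measurable ?P"
        unfolding measurable_cong_sets[OF sets refl] by measurable
      have [measurable]: "bump a d \<in> borel_measurable borel" unfolding bump_def by measurable
      have A: "UNIV \<times> {a - d..a + d} \<in> sets ?P" unfolding sets by simp
      have "(\<integral>x. bump a d x \<partial>alpha_posterior p q n y) = (\<integral>z. bump a d (snd z) \<partial>?P)"
        unfolding alpha_posterior_def by (rule integral_distr) measurable
      also have "\<dots> \<le> (\<integral>z. indicator (UNIV \<times> {a - d..a + d}) z \<partial>?P)"
      proof (rule integral_mono)
        have b: "0 \<le> bump a d x" "bump a d x \<le> indicator {a - d..a + d} x" for x
          using d by (auto simp: bump_def field_simps abs_le_iff split: split_indicator)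
        then have b1: "bump a d x \<le> 1" for x using order_trans[OF b(2) indicator_le_1] by blast
        show "integrable ?P (\<lambda>z. bump a d (snd z))"
          by (rule P.integrable_const_bound[of _ 1]) (use b b1 in \<open>auto simp: abs_of_nonneg\<close>)
        show "integrable ?P (indicator (UNIV \<times> {a - d..a + d}) :: _ \<Rightarrow> real)"
          using A by (simp add: P.emeasure_finite less_top[symmetric])
        show "bump a d (snd z) \<le> indicator (UNIV \<times> {a - d..a + d}) z" for z
          using b(2)[of "snd z"] by (cases z) (auto simp: indicator_def split: if_splits)
      qed
      also have "\<dots> = measure ?P (UNIV \<times> {a - d..a + d})" using A by simp
      also have "\<dots> \<le> exp (K ^ 3) * (\<integral>\<alpha>. (sqrt \<alpha> * prior_pq \<alpha>) * indicator {a - d..a + d} \<alpha> \<partial>lborel) / min_mass K + 1 / 4"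
        using elim reg by auto
      also have "\<dots> \<le> 1 / 2" using k unfolding d_def by linarith
      finally show "(\<integral>x. bump a d x \<partial>alpha_posterior p q n y) \<le> 1 / 2" .
    qed
  qed
  then show ?thesis using d by blast
qed

end

section \<open>Transfer of the deterministic estimates to convergence in probability\<close>

theorem theorem3:
  fixes M :: "'w measure" and X :: "real \<Rightarrow> 'w \<Rightarrow> real"
    and \<sigma>2\<^sub>0 \<alpha>\<^sub>0 \<theta>\<^sub>0 :: real
    and p :: "real \<Rightarrow> real \<Rightarrow> real" and q :: "real \<Rightarrow> real"
    and C1 C2 C3 :: real
    and Y :: "nat \<Rightarrow> 'w \<Rightarrow> nat \<Rightarrow> real"
  assumes "\<sigma>2\<^sub>0 > 0" and "\<alpha>\<^sub>0 > 0" and "\<theta>\<^sub>0 = \<sigma>2\<^sub>0 * \<alpha>\<^sub>0"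
    and "ou_process M {0..1} \<sigma>2\<^sub>0 \<alpha>\<^sub>0 X"
    and "\<And>n w i. Y n w i = X (grid n i) w"
    and "\<And>\<alpha>. \<alpha> > 0 \<Longrightarrow> proper_density (\<lambda>\<theta>. p \<theta> \<alpha>)"
    and "\<And>\<alpha>. \<alpha> > 0 \<Longrightarrow> (\<lambda>\<theta>. p \<theta> \<alpha>) C1_differentiable_on {0<..}"
    and "\<And>\<theta>. \<theta> > 0 \<Longrightarrow> continuous_on {0<..} (\<lambda>\<alpha>. p \<theta> \<alpha>)"
    and "\<And>\<alpha>. \<alpha> > 0 \<Longrightarrow> p \<theta>\<^sub>0 \<alpha> > 0"
    and "C1 > 0" "C2 > 0" "C3 > 0" "C1 + C2 < 1 / 2" "C3 < 1"
    and "\<forall>\<^sub>F n in sequentially. \<forall>\<alpha>\<in>{alpha_lower n..alpha_upper n}. \<forall>\<theta>\<in>{\<theta>\<^sub>0 / 2<..<2 * \<theta>\<^sub>0}.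
           \<bar>deriv (\<lambda>t. ln (p t \<alpha>)) \<theta>\<bar> \<le> real n powr C1"
    and "\<forall>\<^sub>F n in sequentially. \<forall>\<alpha>\<in>{alpha_lower n..alpha_upper n}. \<forall>\<theta>\<in>{\<theta>\<^sub>0 / 2<..<2 * \<theta>\<^sub>0}.
           p \<theta> \<alpha> / p \<theta>\<^sub>0 \<alpha> \<le> real n powr C2"
    and "\<forall>\<^sub>F n in sequentially. \<forall>\<alpha>\<in>{alpha_lower n..alpha_upper n}.
           ln (p \<theta>\<^sub>0 \<alpha>) \<ge> - (real n powr C3)"
    and "proper_density q" and "continuous_on {0<..} q" and "q \<alpha>\<^sub>0 > 0"
    and "set_integrable lborel {0<..} (\<lambda>\<alpha>. p \<theta>\<^sub>0 \<alpha> * q \<alpha>)"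
    and "set_integrable lborel {0<..} (\<lambda>\<alpha>. sqrt \<alpha> * p \<theta>\<^sub>0 \<alpha> * q \<alpha>)"
    and "set_integrable lborel {0<..} (\<lambda>\<alpha>. sqrt \<alpha> * q \<alpha>)"
    and "(\<lambda>n. sqrt (real n) * (LINT \<alpha>:{0<..<alpha_lower n}|lborel. sqrt \<alpha> * q \<alpha>)) \<longlonglongrightarrow> 0"
    and "(\<lambda>n. sqrt (real n) * (LINT \<alpha>:{alpha_upper n<..}|lborel. sqrt \<alpha> * q \<alpha>)) \<longlonglongrightarrow> 0"
  shows "tendsto_in_prob M
           (\<lambda>n w. tv_dist (joint_posterior p q n (Y n w))
              (normal_measure (theta_tilde n (Y n w) \<alpha>\<^sub>0) (2 * \<theta>\<^sub>0\<^sup>2 / real n)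
                 \<Otimes>\<^sub>M profile_posterior p q \<theta>\<^sub>0 n (Y n w))) 0
       \<and> tendsto_in_prob M
           (\<lambda>n w. tv_dist (joint_posterior p q n (Y n w))
              (normal_measure (theta_tilde n (Y n w) \<alpha>\<^sub>0) (2 * \<theta>\<^sub>0\<^sup>2 / real n)
                 \<Otimes>\<^sub>M star_posterior p q \<theta>\<^sub>0 n (Y n w))) 0
       \<and> bounded_in_prob M (\<lambda>n w. u_star n (Y n w))
       \<and> (\<lambda>n. outer_measure_of M {w \<in> space M. \<not> v_star n (Y n w) > 0}) \<longlonglongrightarrow> 0
       \<and> bounded_in_prob M (\<lambda>n w. v_star n (Y n w))
       \<and> bounded_in_prob M (\<lambda>n w. 1 / v_star n (Y n w))
       \<and> (\<forall>a. \<not> weak_conv_in_prob M (\<lambda>n w. alpha_posterior p q n (Y n w)) (return borel a))"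
proof -
  interpret prob_space M using assms(4) unfolding ou_process_def gaussian_process_def by blast
  interpret O: ou_sample M X \<sigma>2\<^sub>0 \<alpha>\<^sub>0 by unfold_locales (use assms(1,2,4) in auto)
  have "\<theta>\<^sub>0 > 0" using assms(1,2,3) by simp
  moreover have "C1 < 1 / 2" using assms(11,13) by simp
  ultimately interpret Q: ou_posterior p q \<theta>\<^sub>0 \<alpha>\<^sub>0 C1 C2 C3
    by unfold_locales (use assms in \<open>blast+\<close>)
  have Y: "Y n w = (\<lambda>i. X (grid n i) w)" for n w using assms(5) by auto
  have reg: "\<sigma>2\<^sub>0 * \<alpha>\<^sub>0 = \<theta>\<^sub>0" using assms(3) by simp
  define N where "N n y = normal_measure (theta_tilde n y \<alpha>\<^sub>0) (2 * \<theta>\<^sub>0\<^sup>2 / real n)" for n y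
  \<comment> \<open>Stated for any second factor \<open>R\<close>, as both total variation claims
    pass to probability in the same way.\<close>
  have tv: "tendsto_in_prob M (\<lambda>n w. tv_dist (joint_posterior p q n (Y n w)) (N n (Y n w) \<Otimes>\<^sub>M R n (Y n w))) 0"
    if R: "\<And>K e. K > 0 \<Longrightarrow> e > 0 \<Longrightarrow> \<forall>\<^sub>F n in sequentially. \<forall>y. regular_sample \<theta>\<^sub>0 K n y \<longrightarrow>
      \<bar>tv_dist (joint_posterior p q n y) (N n y \<Otimes>\<^sub>M R n y)\<bar> \<le> e" for R
    unfolding tendsto_in_prob_def
  proof (intro allI impI O.tendsto_in_prob_of_regular)
    fix e K :: real assume "e > 0" "K > 0"
    from R[OF this(2,1)]
    show "\<forall>\<^sub>F n in sequentially. \<forall>w\<in>space M. regular_sample (\<sigma>2\<^sub>0 * \<alpha>\<^sub>0) K n (\<lambda>i. X (grid n i) w) \<longrightarrow>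
      \<not> e < \<bar>tv_dist (joint_posterior p q n (Y n w)) (N n (Y n w) \<Otimes>\<^sub>M R n (Y n w)) - 0\<bar>"
      by eventually_elim (simp add: reg Y not_less)
  qed
  note approx = Q.posterior_approximation[folded N_def]
  have tv1: "tendsto_in_prob M (\<lambda>n w. tv_dist (joint_posterior p q n (Y n w))
      (N n (Y n w) \<Otimes>\<^sub>M profile_posterior p q \<theta>\<^sub>0 n (Y n w))) 0"
    by (rule tv, drule (1) approx, erule eventually_mono) blast
  have tv2: "tendsto_in_prob M (\<lambda>n w. tv_dist (joint_posterior p q n (Y n w))
      (N n (Y n w) \<Otimes>\<^sub>M star_posterior p q \<theta>\<^sub>0 n (Y n w))) 0"
    by (rule tv, drule (1) approx, erule eventually_mono) blast
  have u: "bounded_in_prob M (\<lambda>n w. u_star n (Y n w))"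
    and v: "bounded_in_prob M (\<lambda>n w. v_star n (Y n w))"
    and iv: "bounded_in_prob M (\<lambda>n w. 1 / v_star n (Y n w))"
    by (rule O.bounded_in_prob_of_regular, simp add: regular_sample_def Y)+
  have vpos: "(\<lambda>n. outer_measure_of M {w \<in> space M. \<not> v_star n (Y n w) > 0}) \<longlonglongrightarrow> 0"
    by (rule O.tendsto_in_prob_of_regular) (simp add: regular_sample_def Y)
  have nc: "\<not> weak_conv_in_prob M (\<lambda>n w. alpha_posterior p q n (Y n w)) (return borel a)" for a
  proof
    assume wc: "weak_conv_in_prob M (\<lambda>n w. alpha_posterior p q n (Y n w)) (return borel a)"
    obtain K where K: "K > 0" "\<forall>\<^sub>F n in sequentially.
       outer_measure_of M {w \<in> space M. \<not> regular_sample (\<sigma>2\<^sub>0 * \<alpha>\<^sub>0) K n (\<lambda>i. X (grid n i) w)} < ennreal (1 / 2)"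
      using O.eventually_regular_in_prob[of "1 / 2"] by auto
    obtain d where d: "d > 0" "\<forall>\<^sub>F n in sequentially. \<forall>y. regular_sample \<theta>\<^sub>0 K n y \<longrightarrow>
      (\<integral>x. bump a d x \<partial>alpha_posterior p q n y) \<le> 1 / 2"
      using Q.alpha_posterior_bump[OF K(1), of a] by blast
    have cont: "continuous_on UNIV (bump a d)"
      unfolding bump_def using d(1) by (intro continuous_intros) auto
    have "bounded (range (bump a d))"
      using d(1) by (intro boundedI[where B = 1]) (auto simp: bump_def)
    with cont wc have "tendsto_in_prob M (\<lambda>n w. \<integral>x. bump a d x \<partial>alpha_posterior p q n (Y n w)) (\<integral>x. bump a d x \<partial>return borel a)"
      unfolding weak_conv_in_prob_def by blast
    moreover have "(\<integral>x. bump a d x \<partial>return borel a) = 1"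
      using borel_measurable_continuous_onI[OF cont] by (simp add: integral_return bump_def)
    ultimately have "\<forall>e>0. (\<lambda>n. outer_measure_of M {w \<in> space M.
        \<bar>(\<integral>x. bump a d x \<partial>alpha_posterior p q n (Y n w)) - 1\<bar> > e}) \<longlonglongrightarrow> 0"
      unfolding tendsto_in_prob_def by simp
    then have "(\<lambda>n. outer_measure_of M {w \<in> space M.
        \<bar>(\<integral>x. bump a d x \<partial>alpha_posterior p q n (Y n w)) - 1\<bar> > 1 / 4}) \<longlonglongrightarrow> 0"
      by (rule allE[where x = "1 / 4"]) linarith
    moreover have "0 < ennreal (1 / 2)" by (subst ennreal_0[symmetric], rule ennreal_lessI) auto
    ultimately have "\<forall>\<^sub>F n in sequentially. outer_measure_of M {w \<in> space M.
        \<bar>(\<integral>x. bump a d x \<partial>alpha_posterior p q n (Y n w)) - 1\<bar> > 1 / 4} < ennreal (1 / 2)"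
      by (rule order_tendstoD(2))
    from eventually_conj[OF eventually_conj[OF this K(2)] d(2)] obtain n
      where n: "outer_measure_of M {w \<in> space M.
        \<bar>(\<integral>x. bump a d x \<partial>alpha_posterior p q n (Y n w)) - 1\<bar> > 1 / 4} < ennreal (1 / 2)"
        "outer_measure_of M {w \<in> space M. \<not> regular_sample \<theta>\<^sub>0 K n (Y n w)} < ennreal (1 / 2)"
        "\<forall>y. regular_sample \<theta>\<^sub>0 K n y \<longrightarrow> (\<integral>x. bump a d x \<partial>alpha_posterior p q n y) \<le> 1 / 2"
      unfolding reg Y[symmetric] eventually_sequentially by blast
    let ?A = "{w \<in> space M. \<bar>(\<integral>x. bump a d x \<partial>alpha_posterior p q n (Y n w)) - 1\<bar> > 1 / 4}"
    let ?B = "{w \<in> space M. \<not> regular_sample \<theta>\<^sub>0 K n (Y n w)}"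
    \<comment> \<open>On a regular sample the integral of the tent is at most \<open>1 / 2\<close>,
      hence more than \<open>1 / 4\<close> away from its value 1 under the point mass. So two sets
      of outer probability below \<open>1 / 2\<close> cover the whole space.\<close>
    have "space M \<subseteq> ?A \<union> ?B"
    proof
      fix w assume "w \<in> space M"
      then show "w \<in> ?A \<union> ?B" using n(3)[rule_format, of "Y n w"] by auto
    qed
    then have "outer_measure_of M (space M) \<le> outer_measure_of M (?A \<union> ?B)" by (rule outer_measure_of_mono)
    also have "\<dots> \<le> outer_measure_of M ?A + outer_measure_of M ?B"
      by (rule outer_measure_of_subadditive) auto
    also have "\<dots> < ennreal (1 / 2) + ennreal (1 / 2)" using n(1,2) by (rule add_strict_mono)
    also have "\<dots> = ennreal (1 / 2 + 1 / 2)" by (rule ennreal_plus[symmetric]) auto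
    also have "\<dots> = 1" by simp
    finally show False by (simp add: emeasure_space_1)
  qed
  show ?thesis using tv1 tv2 u v iv vpos nc unfolding N_def by blast
qed

end
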